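(* Let $G_1$ and $G_2$ be two non-trivial countable amenable ICC groups and let $\Gamma = G_1 \times G_2$. Then there is a probability measure $\nu$ of full support on $\Gamma$ such that the Poisson–Furstenberg boundary $\partial(\Gamma,\nu)$ is non-trivial, $\Gamma$ acts essentially freely on $\partial(\Gamma,\nu)$, and the Poisson–Furstenberg boundaries $\partial(G_1,\mathrm{pr}_1(\nu))$ and $\partial(G_2,\mathrm{pr}_2(\nu))$ are trivial. Moreover, such a measure $\nu$ can be chosen to be symmetric (i.e. $\nu(g)=\nu(g^{-1})$ for all $g$).
   Context: A group is ICC (infinite conjugacy class) if every non-identity element has an infinite conjugacy class. For a countable group $G$ and a probability measure $\nu$ on $G$, the $\nu$-random walk is $Z_n = X_1\cdots X_n$ with $(X_i)$ i.i.d. of law $\nu$; the Poisson–Furstenberg boundary $\partial(G,\nu)$ is the space of ergodic components of the time-shift on the trajectory space $G^{\mathbb N}$ (equivalently, for non-degenerate $\nu$, the tail boundary), with the action of $G$ induced by left multiplication $g\cdot(\omega_1,\omega_2,\ldots)=(g\omega_1,g\omega_2,\ldots)$. The boundary is trivial if the corresponding $\sigma$-algebra is trivial mod 0. $\mathrm{pr}_j$ denotes the projection $G_1\times G_2\to G_j$, and $\mathrm{pr}_j(\nu)$ the pushforward measure. *)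

theory Defs
  imports "HOL-Probability.Probability" "HOL-Algebra.Coset"
begin

definition ICC :: "('a, 'm) monoid_scheme \<Rightarrow> bool" where
  "ICC G \<longleftrightarrow> (\<forall>g\<in>carrier G. g \<noteq> \<one>\<^bsub>G\<^esub> \<longrightarrow>
     infinite {inv\<^bsub>G\<^esub> h \<otimes>\<^bsub>G\<^esub> g \<otimes>\<^bsub>G\<^esub> h | h. h \<in> carrier G})"

definition amenable :: "('a, 'm) monoid_scheme \<Rightarrow> bool" where
  "amenable G \<longleftrightarrow> (\<exists>m :: 'a set \<Rightarrow> real.
     (\<forall>A. A \<subseteq> carrier G \<longrightarrow> 0 \<le> m A) \<and>
     m (carrier G) = 1 \<and>
     (\<forall>A B. A \<subseteq> carrier G \<longrightarrow> B \<subseteq> carrier G \<longrightarrow> A \<inter> B = {} \<longrightarrow>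
        m (A \<union> B) = m A + m B) \<and>
     (\<forall>g\<in>carrier G. \<forall>A. A \<subseteq> carrier G \<longrightarrow> m (g <#\<^bsub>G\<^esub> A) = m A))"

text \<open>Partial products: \<open>rw_prod G X n = X 0 \<otimes> X 1 \<otimes> ... \<otimes> X n\<close>, i.e. the
  position \<open>Z_(n+1)\<close> of the walk with increments \<open>X\<close>.\<close>
fun rw_prod :: "('a, 'm) monoid_scheme \<Rightarrow> (nat \<Rightarrow> 'a) \<Rightarrow> nat \<Rightarrow> 'a" where
  "rw_prod G X 0 = X 0"
| "rw_prod G X (Suc n) = rw_prod G X n \<otimes>\<^bsub>G\<^esub> X (Suc n)"

definition traj_space :: "(nat \<Rightarrow> 'a) measure" where
  "traj_space = PiM UNIV (\<lambda>_. count_space UNIV)"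

definition path_meas :: "('a, 'm) monoid_scheme \<Rightarrow> 'a pmf \<Rightarrow> 'a \<Rightarrow> (nat \<Rightarrow> 'a) measure" where
  "path_meas G \<nu> x = distr (PiM UNIV (\<lambda>_::nat. measure_pmf \<nu>)) traj_space
     (\<lambda>X n. x \<otimes>\<^bsub>G\<^esub> rw_prod G X n)"

text \<open>Shift-invariant sets of trajectories (the sigma-algebra whose ergodic
  components form the Poisson--Furstenberg boundary).\<close>
definition shift_inv_sets :: "(nat \<Rightarrow> 'a) set set" where
  "shift_inv_sets = {A \<in> sets traj_space. (\<lambda>\<omega>. \<omega> \<circ> Suc) -` A = A}"

text \<open>Null sets of the boundary measure class: null for the walk from every starting
  point (equivalently for \<open>P_\<theta>\<close> with a full-support initial distribution \<open>\<theta>\<close>).\<close>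
definition pb_null :: "('a, 'm) monoid_scheme \<Rightarrow> 'a pmf \<Rightarrow> (nat \<Rightarrow> 'a) set \<Rightarrow> bool" where
  "pb_null G \<nu> A \<longleftrightarrow> (\<forall>x\<in>carrier G. emeasure (path_meas G \<nu> x) A = 0)"

definition pb_trivial :: "('a, 'm) monoid_scheme \<Rightarrow> 'a pmf \<Rightarrow> bool" where
  "pb_trivial G \<nu> \<longleftrightarrow> (\<forall>A\<in>shift_inv_sets. pb_null G \<nu> A \<or> pb_null G \<nu> (UNIV - A))"

text \<open>Left action of \<open>g\<close> on sets of trajectories: \<open>g\<cdot>A = {g\<omega> | \<omega>\<in>A}\<close>,
  written as the preimage under left multiplication by \<open>g\<inverse>\<close>.\<close>
definition traj_act :: "('a, 'm) monoid_scheme \<Rightarrow> 'a \<Rightarrow> (nat \<Rightarrow> 'a) set \<Rightarrow> (nat \<Rightarrow> 'a) set" where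
  "traj_act G g A = (\<lambda>\<omega> n. inv\<^bsub>G\<^esub> g \<otimes>\<^bsub>G\<^esub> \<omega> n) -` A"

definition sdiff :: "'x set \<Rightarrow> 'x set \<Rightarrow> 'x set" where
  "sdiff A B = (A - B) \<union> (B - A)"

text \<open>Essential freeness of the action on the boundary, expressed in the measure algebra
  of the boundary: no non-identity \<open>g\<close> acts as the identity (mod 0) on a non-null
  invariant set \<open>E\<close>.  For a nonsingular action on a standard space this is
  equivalent to: the fixed point set of every \<open>g \<noteq> e\<close> is null.\<close>
definition pb_ess_free :: "('a, 'm) monoid_scheme \<Rightarrow> 'a pmf \<Rightarrow> bool" where
  "pb_ess_free G \<nu> \<longleftrightarrow> (\<forall>g\<in>carrier G. g \<noteq> \<one>\<^bsub>G\<^esub> \<longrightarrow>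
     \<not> (\<exists>E\<in>shift_inv_sets. \<not> pb_null G \<nu> E \<and>
          (\<forall>A\<in>shift_inv_sets. pb_null G \<nu> (sdiff (traj_act G g (A \<inter> E)) (A \<inter> E)))))"

end

theory Submission
  imports Defs
begin

text \<open>The increments have a random level \<open>k\<close> with \<open>P(level \<ge> k) = 1 / (k + 1)\<close>, and the law \<open>\<nu> k\<close> of the
  increments of level \<open>k\<close> is chosen after a finite set \<open>M k\<close> that contains all products of a bounded
  number of increments of lower levels. For this law almost surely all but finitely many record levels
  are attained only once and are reached soon enough that the position before and the displacement after
  a record of level \<open>k\<close> both lie in \<open>M k\<close>.

  An increment of level \<open>k\<close> is \<open>(a d(b, b') a'\<inverse>, b e(a, a') b'\<inverse>)\<close> or its inverse, with \<open>a, a'\<close> and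
  \<open>b, b'\<close> uniform in Folner sets of the two factors; with small probability it is instead the \<open>k\<close>-th
  element of the group or its inverse, which gives full support. Each coordinate alone is almost invariant under
  left translation by the projection of \<open>M k\<close>, so that bounded harmonic functions of the marginal walks
  are constant. The group elements \<open>d(b, b')\<close> and \<open>e(a, a')\<close> are chosen far apart, which is possible
  because in an amenable ICC group cosets of centralizers and solution sets of \<open>d x d y = 1\<close> have mean
  zero. So both coordinates together reveal \<open>a\<close> and \<open>b\<close>, hence the position before the record. The
  sequence of these positions is a function of the boundary point that is eventually equivariant, and
  this forces essential freeness.\<close>

(* subset_mset and l_coset share the symbol *)
no_notation subset_mset (infix "<#" 50)

section \<open>Marriage theorem\<close>

text \<open>The difficulty is to hide the past and to reveal it at once. In one coordinate a factor
  drawn from a Folner set washes out where the walk came from, so the information that decodes this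
  factor has to travel in the other coordinate. There it sits in the middle of the increment and
  does not spoil the almost invariance, because the pairs drawn for the two coordinates are
  independent. The tails \<open>1 / (k + 1)\<close> balance three sums. Level \<open>k\<close> is a
  record with probability of order \<open>1 / k\<close>, so a tie or a junk element at that record,
  each costing a further factor of this order, has summable probability, and
  \<open>(k + 1)\<^sup>2\<close> steps below level \<open>k\<close> have probability at most
  \<open>exp (- k)\<close>. Borel-Cantelli therefore applies to all failures, while records never
  stop. The deadline is deterministic, which allows the finite set \<open>M k\<close> to be fixed
  before \<open>\<nu> k\<close>. Amenability is given by an invariant mean. Folner sets are derived
  from it through the marriage theorem, and the mean itself provides the group elements in general
  position. Non-triviality of the boundary is deduced from freeness.\<close>

definition hall_on :: "'i set \<Rightarrow> ('i \<Rightarrow> 'a set) \<Rightarrow> bool" where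
  "hall_on I A \<longleftrightarrow> (\<forall>i\<in>I. finite (A i)) \<and>
     (\<forall>J. finite J \<longrightarrow> J \<subseteq> I \<longrightarrow> card J \<le> card (\<Union>(A ` J)))"

lemma tight_Un:
  assumes H: "hall_on I A" and J: "finite J" "J \<subseteq> I" "card (\<Union>(A ` J)) \<le> card J"
    and L: "finite L" "L \<subseteq> I" "card (\<Union>(A ` L)) \<le> card L"
  shows "card (\<Union>(A ` (J \<union> L))) \<le> card (J \<union> L)"
proof -
  have fin: "finite (\<Union>(A ` J))" "finite (\<Union>(A ` L))"
    using H J L by (auto simp: hall_on_def)
  have "card (J \<inter> L) \<le> card (\<Union>(A ` (J \<inter> L)))"
    using H J(1,2) unfolding hall_on_def by (metis finite_Int le_infI1)
  also have "\<dots> \<le> card (\<Union>(A ` J) \<inter> \<Union>(A ` L))"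
    using fin by (intro card_mono) auto
  finally have "card (J \<inter> L) \<le> card (\<Union>(A ` J) \<inter> \<Union>(A ` L))" .
  moreover have "card (\<Union>(A ` J)) + card (\<Union>(A ` L)) =
      card (\<Union>(A ` (J \<union> L))) + card (\<Union>(A ` J) \<inter> \<Union>(A ` L))"
    using card_Un_Int[OF fin] by (simp add: image_Un)
  moreover have "card J + card L = card (J \<union> L) + card (J \<inter> L)"
    by (rule card_Un_Int) (use J L in auto)
  ultimately show ?thesis using J L by linarith
qed

text \<open>A value that cannot be fixed is blocked by a tight set of other indices whose union
  contains it. If all values in \<open>A i\<close> were blocked, the union of the blocking sets
  would be tight again, and adding \<open>i\<close> would enlarge the index set but not the union,
  against Hall's condition.\<close>

lemma hall_choose:
  assumes H: "hall_on I A" and i: "i \<in> I"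
  shows "\<exists>a\<in>A i. hall_on I (A(i := {a}))"
proof (rule ccontr)
  assume "\<not> ?thesis"
  then have no: "\<And>a. a \<in> A i \<Longrightarrow> \<not> hall_on I (A(i := {a}))" by blast
  have "\<exists>J. finite J \<and> J \<subseteq> I - {i} \<and> a \<in> \<Union>(A ` J) \<and> card (\<Union>(A ` J)) \<le> card J"
    if a: "a \<in> A i" for a
  proof -
    obtain J where J: "finite J" "J \<subseteq> I" "card (\<Union>((A(i := {a})) ` J)) < card J"
    proof -
      have "\<forall>j\<in>I. finite ((A(i := {a})) j)" using H by (simp add: hall_on_def)
      then show ?thesis using no[OF a] that unfolding hall_on_def by (meson not_le)
    qed
    have iJ: "i \<in> J"
    proof (rule ccontr)
      assume "i \<notin> J"
      then have "(A(i := {a})) ` J = A ` J" by auto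
      then show False using J H by (auto simp: hall_on_def not_le)
    qed
    \<comment> \<open>Once \<open>i\<close> is removed from the violating set, Hall's condition for
      the rest leaves no room: \<open>a\<close> must occur there already.\<close>
    define L where "L = J - {i}"
    have L: "finite L" "L \<subseteq> I" "J = insert i L" "i \<notin> L" using J iJ by (auto simp: L_def)
    have eq: "\<Union>((A(i := {a})) ` J) = insert a (\<Union>(A ` L))" using L by auto
    have fin: "finite (\<Union>(A ` L))" using H L by (auto simp: hall_on_def)
    have c1: "card (insert a (\<Union>(A ` L))) \<le> card L" using J L unfolding eq by simp
    have c2: "card L \<le> card (\<Union>(A ` L))" using H L by (simp add: hall_on_def)
    have "a \<in> \<Union>(A ` L)"
      using c1 c2 fin by (metis card_insert_disjoint le_trans not_less_eq_eq order_refl)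
    then show ?thesis using c1 L by (intro exI[of _ L]) (auto simp: insert_absorb)
  qed
  then obtain J where J: "\<And>a. a \<in> A i \<Longrightarrow> finite (J a) \<and> J a \<subseteq> I - {i} \<and>
      a \<in> \<Union>(A ` J a) \<and> card (\<Union>(A ` J a)) \<le> card (J a)"
    by metis
  have tight: "finite (\<Union>(J ` B)) \<and> card (\<Union>(A ` (\<Union>(J ` B)))) \<le> card (\<Union>(J ` B))"
    if "finite B" "B \<subseteq> A i" for B
    using that
  proof (induction B rule: finite_induct)
    case (insert b B)
    have "card (\<Union>(A ` (J b \<union> \<Union>(J ` B)))) \<le> card (J b \<union> \<Union>(J ` B))"
    proof (rule tight_Un[OF H])
      have b: "b \<in> A i" and B: "B \<subseteq> A i" using insert.prems by auto
      show "finite (J b)" "J b \<subseteq> I" "card (\<Union>(A ` J b)) \<le> card (J b)" using J[OF b] by auto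
      show "finite (\<Union>(J ` B))" "card (\<Union>(A ` \<Union>(J ` B))) \<le> card (\<Union>(J ` B))"
        using insert.IH[OF B] by auto
      show "\<Union>(J ` B) \<subseteq> I" using J B by blast
    qed
    moreover have "finite (J b)" "finite (\<Union>(J ` B))" using insert J[of b] by auto
    ultimately show ?case by simp
  qed simp
  have finA: "finite (A i)" using H i by (auto simp: hall_on_def)
  define L where "L = \<Union>(J ` A i)"
  have L: "finite L" "card (\<Union>(A ` L)) \<le> card L" "i \<notin> L" "L \<subseteq> I"
    using tight[OF finA] J unfolding L_def by auto
  have "A i \<subseteq> \<Union>(A ` L)" using J unfolding L_def by blast
  then have "\<Union>(A ` insert i L) = \<Union>(A ` L)" by auto
  moreover have "card (insert i L) \<le> card (\<Union>(A ` insert i L))"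
    using H L i unfolding hall_on_def by (metis finite_insert insert_subset)
  ultimately show False using L by simp
qed

text \<open>Values are fixed one index at a time along the enumeration, and Hall's condition
  survives every choice. The sets only shrink and stay nonempty, so a set that has become a
  singleton never changes again. If two final values coincided, Hall's condition would fail for the
  pair of indices at a late stage.\<close>

lemma marriage_countable:
  fixes A :: "'i::countable \<Rightarrow> 'a set"
  assumes H: "hall_on UNIV A"
  shows "\<exists>\<phi>. inj \<phi> \<and> (\<forall>i. \<phi> i \<in> A i)"
proof -
  define pick where "pick B i = (SOME a. a \<in> B i \<and> hall_on UNIV (B(i := {a})))"
    for B :: "'i \<Rightarrow> 'a set" and i
  have pick: "pick B i \<in> B i" "hall_on UNIV (B(i := {pick B i}))" if "hall_on UNIV B" for B i
    using hall_choose[OF that, of i] unfolding pick_def by (metis (mono_tags, lifting) UNIV_I someI_ex)+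
  define As where "As = rec_nat A (\<lambda>n B. B(from_nat n := {pick B (from_nat n)}))"
  have As0: "As 0 = A"
    and AsS: "\<And>n. As (Suc n) = (As n)(from_nat n := {pick (As n) (from_nat n)})"
    by (simp_all add: As_def)
  have Hn: "hall_on UNIV (As n)" for n
    by (induction n) (auto simp: As0 AsS H pick simp del: fun_upd_apply)
  have anti: "As (Suc n) i \<subseteq> As n i" for n i
    using pick[OF Hn] by (auto simp: AsS)
  have sub: "As n i \<subseteq> A i" for n i
    by (induction n) (use anti As0 in auto)
  have ne: "As n i \<noteq> {}" for n i
    using Hn[of n] unfolding hall_on_def by (auto dest!: spec[of _ "{i}"])
  define \<phi> where "\<phi> i = pick (As (to_nat i)) i" for i
  have single: "As (Suc (to_nat i) + d) i = {\<phi> i}" for i d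
  proof (induction d)
    case 0
    show ?case by (simp add: AsS \<phi>_def)
  next
    case (Suc d)
    then show ?case using anti[of "Suc (to_nat i) + d" i] ne[of "Suc (to_nat i) + Suc d" i] by auto
  qed
  have "inj \<phi>"
  proof (rule injI, rule ccontr)
    fix i j assume eq: "\<phi> i = \<phi> j" and ij: "i \<noteq> j"
    define n where "n = Suc (to_nat i) + Suc (to_nat j)"
    have "As n i = {\<phi> i}" "As n j = {\<phi> j}"
      using single[of i "Suc (to_nat j)"] single[of j "Suc (to_nat i)"] by (simp_all add: n_def add.commute)
    moreover have "card {i, j} \<le> card (\<Union>(As n ` {i, j}))"
      using Hn[of n] unfolding hall_on_def by (metis finite.emptyI finite.insertI subset_UNIV)
    ultimately show False using eq ij by simp
  qed
  moreover have "\<phi> i \<in> A i" for i using single[of i 0] sub[of "Suc (to_nat i)" i] by auto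
  ultimately show ?thesis by blast
qed

section \<open>Amenable groups\<close>

locale mean_group = group +
  fixes m :: "'a set \<Rightarrow> real"
  assumes m_nonneg: "A \<subseteq> carrier G \<Longrightarrow> 0 \<le> m A"
    and m_carrier: "m (carrier G) = 1"
    and m_Un: "A \<subseteq> carrier G \<Longrightarrow> B \<subseteq> carrier G \<Longrightarrow> A \<inter> B = {} \<Longrightarrow> m (A \<union> B) = m A + m B"
    and m_left: "g \<in> carrier G \<Longrightarrow> A \<subseteq> carrier G \<Longrightarrow> m (g <# A) = m A"
begin

lemma m_mono: "A \<subseteq> B \<Longrightarrow> B \<subseteq> carrier G \<Longrightarrow> m A \<le> m B"
proof -
  assume "A \<subseteq> B" "B \<subseteq> carrier G"
  then have "m B = m A + m (B - A)" "0 \<le> m (B - A)"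
    using m_Un[of A "B - A"] m_nonneg[of "B - A"] by (auto simp: Un_absorb1 subset_eq)
  then show ?thesis by simp
qed

lemma m_le_1: "A \<subseteq> carrier G \<Longrightarrow> m A \<le> 1"
  using m_mono[of A "carrier G"] m_carrier by simp

lemma m_empty [simp]: "m {} = 0"
  using m_Un[of "{}" "{}"] by simp

lemma m_UN:
  assumes "finite I" "\<And>i. i \<in> I \<Longrightarrow> A i \<subseteq> carrier G" "disjoint_family_on A I"
  shows "m (\<Union>(A ` I)) = (\<Sum>i\<in>I. m (A i))"
  using assms
proof (induction I rule: finite_induct)
  case (insert i I)
  have "m (A i \<union> \<Union>(A ` I)) = m (A i) + m (\<Union>(A ` I))"
    using insert by (intro m_Un) (auto simp: disjoint_family_on_def)
  then show ?case using insert by (simp add: disjoint_family_on_def)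
qed simp

lemma m_UN_le:
  assumes "finite I" "\<And>i. i \<in> I \<Longrightarrow> A i \<subseteq> carrier G"
  shows "m (\<Union>(A ` I)) \<le> (\<Sum>i\<in>I. m (A i))"
  using assms
proof (induction I rule: finite_induct)
  case (insert i I)
  have "m (A i \<union> \<Union>(A ` I)) = m (A i \<union> (\<Union>(A ` I) - A i))" by simp
  also have "\<dots> = m (A i) + m (\<Union>(A ` I) - A i)"
    using insert by (intro m_Un) auto
  also have "\<dots> \<le> m (A i) + m (\<Union>(A ` I))"
    using insert by (intro add_left_mono m_mono) auto
  finally show ?case using insert by simp
qed simp

text \<open>A paradoxical decomposition in functional form: each of the two maps
  \<open>\<lambda>x. \<phi> (x, b)\<close> is a left translation on each of finitely many pieces, so
  its image has mean one, yet the two images are disjoint.\<close>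

lemma no_doubling:
  assumes \<phi>: "inj_on \<phi> (carrier G \<times> (UNIV :: bool set))" and L: "finite L" "L \<subseteq> carrier G"
    and mem: "\<And>x b. x \<in> carrier G \<Longrightarrow> \<exists>l\<in>L. \<phi> (x, b) = l \<otimes> x"
  shows False
proof -
  have cl: "\<phi> (x, b) \<in> carrier G" if "x \<in> carrier G" for x b
    using mem[OF that, of b] L that by auto
  have one: "m ((\<lambda>x. \<phi> (x, b)) ` carrier G) = 1" for b
  proof -
    \<comment> \<open>The pieces are disjoint because \<open>l\<close> is determined by
      \<open>x\<close> and \<open>\<phi> (x, b)\<close>; injectivity of \<open>\<phi>\<close> keeps
      the translated pieces disjoint as well.\<close>
    define D where "D l = {x \<in> carrier G. \<phi> (x, b) = l \<otimes> x}" for l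
    have Dc: "D l \<subseteq> carrier G" for l by (auto simp: D_def)
    have "m (\<Union>(D ` L)) = (\<Sum>l\<in>L. m (D l))"
      using L Dc by (intro m_UN) (auto simp: D_def disjoint_family_on_def subset_eq)
    moreover have "\<Union>(D ` L) = carrier G" using mem[of _ b] by (fastforce simp: D_def)
    moreover have "m (\<Union>l\<in>L. l <# D l) = (\<Sum>l\<in>L. m (l <# D l))"
    proof (rule m_UN[OF L(1)])
      show "l <# D l \<subseteq> carrier G" if "l \<in> L" for l
        using that L Dc by (intro l_coset_subset_G) auto
      show "disjoint_family_on (\<lambda>l. l <# D l) L"
      proof -
        have False if h: "l \<in> L" "l' \<in> L" "l \<noteq> l'" "z \<in> l <# D l" "z \<in> l' <# D l'" for l l' z
        proof -
          obtain x where x: "x \<in> carrier G" "\<phi> (x, b) = l \<otimes> x" "z = l \<otimes> x"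
            using h(4) unfolding D_def l_coset_def by blast
          obtain y where y: "y \<in> carrier G" "\<phi> (y, b) = l' \<otimes> y" "z = l' \<otimes> y"
            using h(5) unfolding D_def l_coset_def by blast
          have "(x, b) = (y, b)" by (rule inj_onD[OF \<phi>]) (use x y in auto)
          then have "x = y" by simp
          then show False using x y h L by (auto simp: subset_eq)
        qed
        then show ?thesis by (auto simp: disjoint_family_on_def)
      qed
    qed
    moreover have "(\<Union>l\<in>L. l <# D l) = (\<lambda>x. \<phi> (x, b)) ` carrier G" (is "?L = ?R")
    proof
      show "?L \<subseteq> ?R" by (auto simp: D_def l_coset_def image_iff) (metis)
      show "?R \<subseteq> ?L"
      proof
        fix z assume "z \<in> ?R"
        then obtain x where x: "x \<in> carrier G" "z = \<phi> (x, b)" by blast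
        then show "z \<in> ?L" using mem[OF x(1), of b] by (auto simp: D_def l_coset_def)
      qed
    qed
    moreover have "m (l <# D l) = m (D l)" if "l \<in> L" for l
      using that L Dc by (intro m_left) auto
    ultimately show ?thesis using m_carrier by simp
  qed
  have "m ((\<lambda>x. \<phi> (x, True)) ` carrier G \<union> (\<lambda>x. \<phi> (x, False)) ` carrier G) =
      m ((\<lambda>x. \<phi> (x, True)) ` carrier G) + m ((\<lambda>x. \<phi> (x, False)) ` carrier G)"
    using cl by (intro m_Un) (auto dest!: inj_onD[OF \<phi>])
  moreover have "m ((\<lambda>x. \<phi> (x, True)) ` carrier G \<union> (\<lambda>x. \<phi> (x, False)) ` carrier G) \<le> 1"
    using cl by (intro m_le_1) auto
  ultimately show False using one by simp
qed

end

lemma (in group) amenable_mean: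
  assumes "amenable G"
  obtains m where "mean_group G m"
proof -
  obtain m :: "'a set \<Rightarrow> real" where m: "\<forall>A. A \<subseteq> carrier G \<longrightarrow> 0 \<le> m A" "m (carrier G) = 1"
    "\<forall>A B. A \<subseteq> carrier G \<longrightarrow> B \<subseteq> carrier G \<longrightarrow> A \<inter> B = {} \<longrightarrow> m (A \<union> B) = m A + m B"
    "\<forall>g\<in>carrier G. \<forall>A. A \<subseteq> carrier G \<longrightarrow> m (g <# A) = m A"
    using assms unfolding amenable_def by blast
  have "mean_group G m" by unfold_locales (use m in blast)+
  then show ?thesis by (rule that)
qed

text \<open>Without a Folner set, \<open>T\<close> expands every finite set by the factor
  \<open>1 + \<epsilon>\<close>, and an iterate of \<open>T\<close> doubles it. Hall's condition
  then holds with every group element used twice, and the marriage theorem yields a map of the kind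
  excluded by \<open>no_doubling\<close>.\<close>

lemma (in group) folner:
  fixes \<epsilon> :: real
  assumes count: "countable (carrier G)" and am: "amenable G" and K: "finite K" "K \<subseteq> carrier G" and \<epsilon>: "\<epsilon> > 0"
  shows "\<exists>F. finite F \<and> F \<noteq> {} \<and> F \<subseteq> carrier G \<and> (\<forall>g\<in>K. card ((g <# F) - F) \<le> \<epsilon> * card F)"
proof (rule ccontr)
  assume no: "\<not> ?thesis"
  obtain m where "mean_group G m" using am by (rule amenable_mean)
  then interpret mean_group G m .
  define T where "T F = F \<union> (\<Union>g\<in>K. g <# F)" for F
  have finl: "finite (g <# F)" if "finite F" for g F using that by (simp add: l_coset_def)
  have Tfin: "finite (T F)" if "finite F" for F using that K by (auto simp: T_def intro: finl)
  have Tc: "T F \<subseteq> carrier G" if "F \<subseteq> carrier G" for F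
    unfolding T_def using that K(2) l_coset_subset_G[OF that] by blast
  have Tcard: "(1 + \<epsilon>) * card F \<le> card (T F)" if F: "finite F" "F \<subseteq> carrier G" for F
  proof (cases "F = {}")
    case False
    then obtain g where g: "g \<in> K" "card ((g <# F) - F) > \<epsilon> * card F"
      using no F by (meson not_le)
    have "card F + card ((g <# F) - F) = card (F \<union> ((g <# F) - F))"
      using F(1) finl[OF F(1), of g] by (intro card_Un_disjoint[symmetric]) auto
    also have "\<dots> \<le> card (T F)" using g Tfin[OF F(1)] by (intro card_mono) (auto simp: T_def)
    finally show ?thesis using g(2) by (simp add: algebra_simps)
  qed simp
  have Tn: "finite ((T ^^ n) F) \<and> (T ^^ n) F \<subseteq> carrier G \<and> (1 + \<epsilon>) ^ n * card F \<le> card ((T ^^ n) F)"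
    if F: "finite F" "F \<subseteq> carrier G" for F n
  proof (induction n)
    case 0 then show ?case using F by simp
  next
    case (Suc n)
    have "(1 + \<epsilon>) ^ Suc n * card F = (1 + \<epsilon>) * ((1 + \<epsilon>) ^ n * card F)" by simp
    also have "\<dots> \<le> (1 + \<epsilon>) * card ((T ^^ n) F)"
      using Suc \<epsilon> by (intro mult_left_mono) auto
    also have "\<dots> \<le> card (T ((T ^^ n) F))" using Suc by (intro Tcard) auto
    finally show ?case using Suc Tfin Tc by simp
  qed
  obtain n where n: "2 < (1 + \<epsilon>) ^ n"
    using \<epsilon> real_arch_pow[of "1 + \<epsilon>" 2] by auto
  define L where "L = (T ^^ n) {\<one>}"
  have L: "finite L" "L \<subseteq> carrier G" using Tn[of "{\<one>}" n] by (auto simp: L_def)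
  have TU: "(T ^^ n) (\<Union>x\<in>F. B x) = (\<Union>x\<in>F. (T ^^ n) (B x))" for F :: "'a set" and B n
  proof (induction n)
    case (Suc n)
    have "T (\<Union>x\<in>F. C x) = (\<Union>x\<in>F. T (C x))" for C
      unfolding T_def l_coset_def by blast
    then show ?case using Suc by simp
  qed simp
  \<comment> \<open>\<open>T\<close> multiplies on the left and so commutes with right
    multiplication by \<open>x\<close>. Hence the neighbourhoods of all points are the right
    translates of one finite set \<open>L\<close>.\<close>
  have Tr: "(T ^^ n) {x} = (\<lambda>l. l \<otimes> x) ` ((T ^^ n) {\<one>})" if x: "x \<in> carrier G" for x n
  proof (induction n)
    case 0 then show ?case using x by simp
  next
    case (Suc n)
    have c: "(T ^^ n) {\<one>} \<subseteq> carrier G" using Tn[of "{\<one>}"] by simp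
    have *: "g <# ((\<lambda>l. l \<otimes> x) ` B) = (\<lambda>l. l \<otimes> x) ` (g <# B)" if "g \<in> K" "B \<subseteq> carrier G" for g B
    proof -
      have lc: "g <# C = (\<lambda>c. g \<otimes> c) ` C" for C by (auto simp: l_coset_def)
      have "(\<lambda>c. g \<otimes> (c \<otimes> x)) ` B = (\<lambda>c. g \<otimes> c \<otimes> x) ` B"
        using that K x by (intro image_cong) (auto simp: m_assoc subset_eq)
      then show ?thesis by (simp add: lc image_image)
    qed
    have "(\<Union>g\<in>K. g <# ((\<lambda>l. l \<otimes> x) ` (T ^^ n) {\<one>})) = (\<Union>g\<in>K. (\<lambda>l. l \<otimes> x) ` (g <# (T ^^ n) {\<one>}))"
      using *[OF _ c] by (intro SUP_cong) auto
    then have "T ((\<lambda>l. l \<otimes> x) ` (T ^^ n) {\<one>}) = (\<lambda>l. l \<otimes> x) ` T ((T ^^ n) {\<one>})"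
      unfolding T_def by (simp only: image_Un image_UN)
    then show ?case using Suc by simp
  qed
  \<comment> \<open>The index \<open>(i, b)\<close> stands for copy \<open>b\<close> of the element
    with code \<open>i\<close>. An index that codes no element gets a point of its own in the right
    summand, where it competes with nothing; this makes the family total on a countable
    type.\<close>
  define A where "A = (\<lambda>(i::nat, b::bool). if i \<in> to_nat_on (carrier G) ` carrier G
     then Inl ` ((T ^^ n) {from_nat_into (carrier G) i}) else {Inr (i, b)})"
  have fn: "from_nat_into (carrier G) (to_nat_on (carrier G) x) = x" if "x \<in> carrier G" for x
    using that count by simp
  have "hall_on UNIV A"
    unfolding hall_on_def
  proof (intro conjI allI impI ballI)
    fix i :: "nat \<times> bool"
    show "finite (A i)" using Tn fn by (auto simp: A_def split: prod.splits)
  next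
    fix J :: "(nat \<times> bool) set" assume J: "finite J"
    define N where "N = to_nat_on (carrier G) ` carrier G"
    define J1 where "J1 = {p \<in> J. fst p \<in> N}"
    define J2 where "J2 = {p \<in> J. fst p \<notin> N}"
    define F where "F = from_nat_into (carrier G) ` fst ` J1"
    have JJ: "J = J1 \<union> J2" "J1 \<inter> J2 = {}" "finite J1" "finite J2"
      using J by (auto simp: J1_def J2_def)
    have F: "finite F" "F \<subseteq> carrier G" using JJ fn by (auto simp: F_def J1_def N_def)
    have e1: "\<Union>(A ` J1) = Inl ` ((T ^^ n) F)"
    proof -
      have "A p = Inl ` ((T ^^ n) {from_nat_into (carrier G) (fst p)})" if "p \<in> J1" for p
        using that by (auto simp: A_def J1_def N_def split: prod.splits)
      then have "\<Union>(A ` J1) = Inl ` (\<Union>x\<in>F. (T ^^ n) {x})" by (simp add: F_def image_UN)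
      also have "(\<Union>x\<in>F. (T ^^ n) {x}) = (T ^^ n) F" using TU[of n "\<lambda>x. {x}" F] by simp
      finally show ?thesis .
    qed
    have e2: "\<Union>(A ` J2) = Inr ` J2" by (auto simp: A_def J2_def N_def)
    have "inj_on (from_nat_into (carrier G)) N" using fn by (auto simp: N_def inj_on_def)
    then have cF: "card F = card (fst ` J1)"
      unfolding F_def by (intro card_image) (auto simp: J1_def inj_on_def)
    have "card J1 \<le> card (fst ` J1 \<times> (UNIV::bool set))"
      using JJ by (intro card_mono finite_cartesian_product) force+
    then have "card J1 \<le> 2 * card F" by (simp add: cF card_cartesian_product)
    moreover have "2 * card F \<le> card ((T ^^ n) F)"
    proof -
      have "2 * real (card F) \<le> (1 + \<epsilon>) ^ n * card F" using n by (intro mult_right_mono) auto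
      then show ?thesis using Tn[OF F, of n] by linarith
    qed
    moreover have "card (\<Union>(A ` J1)) = card ((T ^^ n) F)" unfolding e1 by (simp add: card_image)
    moreover have "card (\<Union>(A ` J2)) = card J2" unfolding e2 by (simp add: card_image)
    moreover have "card (\<Union>(A ` J)) = card (\<Union>(A ` J1)) + card (\<Union>(A ` J2))"
    proof -
      have "\<Union>(A ` J) = \<Union>(A ` J1) \<union> \<Union>(A ` J2)" using JJ by auto
      moreover have "card (\<Union>(A ` J1) \<union> \<Union>(A ` J2)) = card (\<Union>(A ` J1)) + card (\<Union>(A ` J2))"
        unfolding e1 e2 using Tn[OF F, of n] JJ by (intro card_Un_disjoint) auto
      ultimately show ?thesis by simp
    qed
    moreover have "card J = card J1 + card J2" using JJ by (metis card_Un_disjoint)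
    ultimately show "card J \<le> card (\<Union>(A ` J))" by linarith
  qed
  then obtain \<psi> where \<psi>: "inj \<psi>" "\<And>i. \<psi> i \<in> A i" using marriage_countable by blast
  define \<phi> where "\<phi> = (\<lambda>(x, b). projl (\<psi> (to_nat_on (carrier G) x, b)))"
  have \<phi>1: "\<exists>y\<in>L. \<psi> (to_nat_on (carrier G) x, b) = Inl (y \<otimes> x)" if "x \<in> carrier G" for x b
    using \<psi>(2)[of "(to_nat_on (carrier G) x, b)"] that fn[OF that] Tr[OF that, of n]
    by (auto simp: A_def L_def)
  show False
  proof (rule no_doubling[OF _ L])
    show "\<exists>l\<in>L. \<phi> (x, b) = l \<otimes> x" if "x \<in> carrier G" for x b
      using \<phi>1[OF that, of b] by (auto simp: \<phi>_def)
    show "inj_on \<phi> (carrier G \<times> (UNIV :: bool set))"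
    proof (rule inj_onI)
      fix p q assume p: "p \<in> carrier G \<times> (UNIV :: bool set)" and q: "q \<in> carrier G \<times> (UNIV :: bool set)"
        and eq: "\<phi> p = \<phi> q"
      obtain x b y c where xy: "p = (x, b)" "q = (y, c)" by fastforce
      have "\<psi> (to_nat_on (carrier G) x, b) = \<psi> (to_nat_on (carrier G) y, c)"
        using eq xy p q \<phi>1[of x b] \<phi>1[of y c] by (auto simp: \<phi>_def)
      then have "(to_nat_on (carrier G) x, b) = (to_nat_on (carrier G) y, c)" using \<psi>(1) by (rule injD[rotated])
      then show "p = q" using xy p q fn by (metis mem_Sigma_iff prod.inject)
    qed
  qed
qed

section \<open>Null sets of an invariant mean\<close>

context mean_group
begin

lemma m_UN_null_overlap:
  assumes "finite I" "\<And>i. i \<in> I \<Longrightarrow> A i \<subseteq> carrier G"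
    and "\<And>i j. i \<in> I \<Longrightarrow> j \<in> I \<Longrightarrow> i \<noteq> j \<Longrightarrow> m (A i \<inter> A j) = 0"
  shows "m (\<Union>(A ` I)) = (\<Sum>i\<in>I. m (A i))"
  using assms
proof (induction I rule: finite_induct)
  case (insert i I)
  let ?U = "\<Union>(A ` I)"
  have U: "?U \<subseteq> carrier G" and Ai: "A i \<subseteq> carrier G" using insert by auto
  have "m (\<Union>j\<in>I. A i \<inter> A j) \<le> (\<Sum>j\<in>I. m (A i \<inter> A j))"
    using insert.hyps insert.prems(1) by (intro m_UN_le) auto
  also have "\<dots> = 0" using insert.hyps insert.prems(2) by (intro sum.neutral) auto
  also have "(\<Union>j\<in>I. A i \<inter> A j) = A i \<inter> ?U" by blast
  finally have "m (A i \<inter> ?U) \<le> 0" .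
  moreover have "0 \<le> m (A i \<inter> ?U)" using Ai by (intro m_nonneg) auto
  ultimately have 0: "m (A i \<inter> ?U) = 0" by simp
  have "m ((A i \<inter> ?U) \<union> (?U - A i)) = m (A i \<inter> ?U) + m (?U - A i)"
    using U Ai by (intro m_Un) auto
  moreover have "(A i \<inter> ?U) \<union> (?U - A i) = ?U" by auto
  moreover have "m (A i \<union> (?U - A i)) = m (A i) + m (?U - A i)"
    using U Ai by (intro m_Un) auto
  moreover have "A i \<union> (?U - A i) = \<Union>(A ` insert i I)" by auto
  ultimately have "m (\<Union>(A ` insert i I)) = m (A i) + m ?U" using 0 by simp
  then show ?case using insert by simp
qed simp

text \<open>If \<open>m T\<close> were positive, \<open>n\<close> translates with null overlaps
  would have total mean \<open>n * m T\<close>, which exceeds one for large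
  \<open>n\<close>.\<close>

lemma null_of_translates:
  assumes T: "T \<subseteq> carrier G" and H: "infinite H" "H \<subseteq> carrier G"
    and null: "\<And>g h. g \<in> H \<Longrightarrow> h \<in> H \<Longrightarrow> g \<noteq> h \<Longrightarrow> m ((g <# T) \<inter> (h <# T)) = 0"
  shows "m T = 0"
proof (rule ccontr)
  assume "m T \<noteq> 0"
  then have pos: "0 < m T" using m_nonneg[OF T] by simp
  obtain n :: nat where n: "1 < n * m T" using reals_Archimedean3[OF pos] by blast
  obtain H' where H': "H' \<subseteq> H" "finite H'" "card H' = n"
    using infinite_arbitrarily_large[OF H(1)] by blast
  have "m (\<Union>g\<in>H'. g <# T) = (\<Sum>g\<in>H'. m (g <# T))"
  proof (rule m_UN_null_overlap[OF H'(2)])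
    show "g <# T \<subseteq> carrier G" if "g \<in> H'" for g
      using that H H' T by (intro l_coset_subset_G) auto
    show "m ((g <# T) \<inter> (h <# T)) = 0" if "g \<in> H'" "h \<in> H'" "g \<noteq> h" for g h
      using that H' by (intro null) auto
  qed
  also have "\<dots> = (\<Sum>g\<in>H'. m T)" using H H' T by (intro sum.cong m_left) auto
  also have "\<dots> = n * m T" using H' by simp
  also have "m (\<Union>g\<in>H'. g <# T) \<le> 1"
  proof (intro m_le_1 UN_least)
    show "g <# T \<subseteq> carrier G" if "g \<in> H'" for g
      using that H H' T by (intro l_coset_subset_G) auto
  qed
  ultimately show False using n by simp
qed

lemma null_mono: "A \<subseteq> B \<Longrightarrow> B \<subseteq> carrier G \<Longrightarrow> m B = 0 \<Longrightarrow> m A = 0"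
  using m_mono[of A B] m_nonneg[of A] by auto

lemma null_UN:
  assumes "finite I" "\<And>i. i \<in> I \<Longrightarrow> A i \<subseteq> carrier G" "\<And>i. i \<in> I \<Longrightarrow> m (A i) = 0"
  shows "m (\<Union>(A ` I)) = 0"
proof -
  have "m (\<Union>(A ` I)) \<le> (\<Sum>i\<in>I. m (A i))" using assms by (intro m_UN_le) auto
  also have "\<dots> = 0" using assms by (intro sum.neutral) auto
  finally show ?thesis using m_nonneg[of "\<Union>(A ` I)"] assms by force
qed

lemma null_singleton:
  assumes inf: "infinite (carrier G)" and a: "a \<in> carrier G"
  shows "m {a} = 0"
proof (rule null_of_translates[OF _ inf])
  fix g h assume gh: "g \<in> carrier G" "h \<in> carrier G" "g \<noteq> h"
  then have "(g <# {a}) \<inter> (h <# {a}) = {}" using a by (auto simp: l_coset_def)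
  then show "m ((g <# {a}) \<inter> (h <# {a})) = 0" by simp
qed (use a in auto)

lemma null_finite:
  assumes inf: "infinite (carrier G)" and A: "finite A" "A \<subseteq> carrier G"
  shows "m A = 0"
  using null_UN[of A "\<lambda>a. {a}"] A null_singleton[OF inf] by auto

end

lemma (in group) ICC_infinite:
  assumes "ICC G" "carrier G \<noteq> {\<one>}"
  shows "infinite (carrier G)"
proof
  assume fin: "finite (carrier G)"
  obtain g where g: "g \<in> carrier G" "g \<noteq> \<one>" using assms(2) one_closed by blast
  have "{inv h \<otimes> g \<otimes> h | h. h \<in> carrier G} \<subseteq> carrier G" using g by auto
  then have "finite {inv h \<otimes> g \<otimes> h | h. h \<in> carrier G}" using fin by (rule finite_subset)
  then show False using assms(1) g by (auto simp: ICC_def)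
qed

lemma (in group) mult3_eq_iff:
  "x \<in> carrier G \<Longrightarrow> d \<in> carrier G \<Longrightarrow> y \<in> carrier G \<Longrightarrow> e \<in> carrier G \<Longrightarrow>
    x \<otimes> d \<otimes> y = e \<longleftrightarrow> d = inv x \<otimes> e \<otimes> inv y"
  by (metis inv_closed inv_solve_left inv_solve_right m_assoc m_closed)

text \<open>The set is empty or a coset of the centralizer of \<open>x\<close>. All elements of its
  translate by \<open>g\<close> conjugate \<open>y\<close> to \<open>g x g^-1\<close>, so translates
  belonging to different conjugates of \<open>x\<close> are disjoint, and ICC provides infinitely
  many conjugates.\<close>

lemma (in mean_group) null_conj:
  assumes icc: "ICC G" and x: "x \<in> carrier G" "x \<noteq> \<one>"
  shows "m {d \<in> carrier G. inv d \<otimes> x \<otimes> d = y} = 0" (is "m ?T = 0")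
proof (cases "y \<in> carrier G")
  case False
  then have "?T = {}" using x by auto
  then show ?thesis by (simp only: m_empty)
next
  case y: True
  define C where "C = {inv h \<otimes> x \<otimes> h | h. h \<in> carrier G}"
  have C: "infinite C" using icc x by (auto simp: ICC_def C_def)
  have "\<forall>c\<in>C. \<exists>g\<in>carrier G. c = g \<otimes> x \<otimes> inv g"
    unfolding C_def by (smt (verit) inv_closed inv_inv mem_Collect_eq)
  then obtain r where r: "\<And>c. c \<in> C \<Longrightarrow> r c \<in> carrier G \<and> c = r c \<otimes> x \<otimes> inv (r c)" by metis
  have "inj_on r C" by (rule inj_onI) (metis r)
  then have inf: "infinite (r ` C)" using C finite_image_iff by blast
  have rC: "r ` C \<subseteq> carrier G" using r by blast
  show ?thesis
  proof (rule null_of_translates[OF _ inf rC])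
    fix g h assume gh: "g \<in> r ` C" "h \<in> r ` C" "g \<noteq> h"
    then have ne: "g \<otimes> x \<otimes> inv g \<noteq> h \<otimes> x \<otimes> inv h" using r by (metis imageE)
    have c: "g \<in> carrier G" "h \<in> carrier G" using gh rC by auto
    have key: "z \<otimes> y \<otimes> inv z = g \<otimes> x \<otimes> inv g" if g: "g \<in> carrier G" and z: "z \<in> g <# ?T" for z g
    proof -
      obtain d where d: "d \<in> carrier G" "inv d \<otimes> x \<otimes> d = y" "z = g \<otimes> d"
        using z by (auto simp: l_coset_def)
      have xy: "x = d \<otimes> y \<otimes> inv d" using d x y by (simp add: mult3_eq_iff)
      show ?thesis using d(1,3) x y g by (simp add: xy inv_mult_group m_assoc)
    qed
    have "(g <# ?T) \<inter> (h <# ?T) = {}"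
    proof (rule equals0I)
      fix z assume "z \<in> (g <# ?T) \<inter> (h <# ?T)"
      then have "z \<in> g <# ?T" "z \<in> h <# ?T" by blast+
      then show False using key[OF c(1), of z] key[OF c(2), of z] ne by simp
    qed
    then show "m ((g <# ?T) \<inter> (h <# ?T)) = 0" by (simp only: m_empty)
  qed auto
qed

text \<open>A point in the translates by \<open>g\<close> and \<open>h\<close> gives two solutions
  \<open>d\<close> and \<open>k d\<close> with \<open>k = g^-1 h\<close>. Eliminating
  \<open>x\<close> from their equations leaves a conjugacy equation for \<open>k\<close>, so
  distinct translates overlap only in a translate of a set that is null by
  \<open>null_conj\<close>.\<close>

lemma (in mean_group) null_twisted_involution:
  assumes icc: "ICC G" "carrier G \<noteq> {\<one>}" and x: "x \<in> carrier G" and y: "y \<in> carrier G"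
  shows "m {d \<in> carrier G. d \<otimes> x \<otimes> d \<otimes> y = \<one>} = 0" (is "m ?T = 0")
proof (rule null_of_translates[OF _ ICC_infinite[OF icc]])
  fix g h assume c: "g \<in> carrier G" "h \<in> carrier G" and ne: "g \<noteq> h"
  define k where "k = inv g \<otimes> h"
  have k: "k \<in> carrier G" "k \<noteq> \<one>" using c ne by (auto simp: k_def) (metis inv_equality inv_inv inv_closed)
  define U where "U = {d \<in> carrier G. inv d \<otimes> k \<otimes> d = y \<otimes> inv k \<otimes> inv y}"
  have U: "m U = 0" "U \<subseteq> carrier G" unfolding U_def by (rule null_conj[OF icc(1) k]) auto
  have "(g <# ?T) \<inter> (h <# ?T) \<subseteq> h <# U"
  proof
    fix z assume "z \<in> (g <# ?T) \<inter> (h <# ?T)"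
    then obtain d e where d: "d \<in> carrier G" "d \<otimes> x \<otimes> d \<otimes> y = \<one>" "z = h \<otimes> d"
      and e: "e \<in> carrier G" "e \<otimes> x \<otimes> e \<otimes> y = \<one>" "z = g \<otimes> e"
      by (auto simp: l_coset_def)
    have "e = inv g \<otimes> (h \<otimes> d)" using d e c by (simp add: inv_solve_left)
    then have ed: "e = k \<otimes> d" using c d by (simp add: k_def m_assoc)
    have dx: "d \<otimes> x = inv (d \<otimes> y)"
      using d x y by (intro inv_equality[symmetric]) (auto simp: m_assoc)
    have "\<one> = k \<otimes> (d \<otimes> x) \<otimes> (k \<otimes> d \<otimes> y)" using e ed k d x y by (simp add: m_assoc)
    also have "\<dots> = k \<otimes> inv y \<otimes> (inv d \<otimes> k \<otimes> d) \<otimes> y"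
      unfolding dx using k d x y by (simp add: inv_mult_group m_assoc)
    finally have "k \<otimes> inv y \<otimes> (inv d \<otimes> k \<otimes> d) \<otimes> y = \<one>" by simp
    then have "inv d \<otimes> k \<otimes> d = inv (k \<otimes> inv y) \<otimes> \<one> \<otimes> inv y"
      using k d y by (subst (asm) mult3_eq_iff) auto
    then have "d \<in> U" using k d y by (simp add: U_def inv_mult_group)
    then show "z \<in> h <# U" using d by (auto simp: l_coset_def)
  qed
  moreover have "h <# U \<subseteq> carrier G" using l_coset_subset_G U c by blast
  moreover have "m (h <# U) = 0" using U c by (simp add: m_left)
  ultimately show "m ((g <# ?T) \<inter> (h <# ?T)) = 0" by (rule null_mono)
qed auto

section \<open>Group elements in general position\<close>

definition signed :: "('a, 'm) monoid_scheme \<Rightarrow> bool \<Rightarrow> 'a \<Rightarrow> 'a" where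
  "signed G b d = (if b then d else inv\<^bsub>G\<^esub> d)"

lemma (in group) signed_closed [simp]: "d \<in> carrier G \<Longrightarrow> signed G b d \<in> carrier G"
  by (simp add: signed_def)

lemma (in group) inv_signed: "d \<in> carrier G \<Longrightarrow> inv (signed G b d) = signed G (\<not> b) d"
  by (simp add: signed_def)

text \<open>Greedy choice: the new element \<open>e\<close> has to avoid three sets of mean zero.
  Relations of \<open>e\<close> or its inverse with itself are conjugacy equations, relations
  between \<open>e\<close> and its inverse are twisted involution equations, and relations with
  \<open>K\<close> or with the elements chosen before exclude only finitely many values.\<close>

lemma (in group) free_family:
  assumes am: "amenable G" and icc: "ICC G" "carrier G \<noteq> {\<one>}"
    and K: "finite K" "K \<subseteq> carrier G" and I: "finite I"
  shows "\<exists>d. (\<forall>i\<in>I. d i \<in> carrier G) \<and> (\<forall>i\<in>I. \<forall>b. signed G b (d i) \<notin> K) \<and>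
    (\<forall>i\<in>I. \<forall>j\<in>I. \<forall>b c. \<forall>x\<in>K. \<forall>y\<in>K. x \<otimes> signed G b (d i) \<otimes> y = signed G c (d j)
       \<longrightarrow> i = j \<and> b = c \<and> x = \<one>)"
  using I
proof (induction I rule: finite_induct)
  case empty
  then show ?case by simp
next
  case (insert i I)
  obtain m where "mean_group G m" using am by (rule amenable_mean)
  then interpret mean_group G m .
  from insert.IH obtain d where D: "\<forall>i\<in>I. d i \<in> carrier G" "\<forall>i\<in>I. \<forall>b. signed G b (d i) \<notin> K"
    "\<forall>i\<in>I. \<forall>j\<in>I. \<forall>b c. \<forall>x\<in>K. \<forall>y\<in>K. x \<otimes> signed G b (d i) \<otimes> y = signed G c (d j)
       \<longrightarrow> i = j \<and> b = c \<and> x = \<one>"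
    by (elim exE conjE)
  have d: "\<And>i. i \<in> I \<Longrightarrow> d i \<in> carrier G" "\<And>i b. i \<in> I \<Longrightarrow> signed G b (d i) \<notin> K"
    using D by simp_all
  have d3: "i = j \<and> b = c \<and> x = \<one>" if h: "i \<in> I" "j \<in> I" "x \<in> K" "y \<in> K"
    and eq: "x \<otimes> signed G b (d i) \<otimes> y = signed G c (d j)" for i j b c x y
    by (rule D(3)[rule_format, OF h eq])
  \<comment> \<open>Closing \<open>K\<close> under inverses lets a relation for the inverse of
    \<open>e\<close> be rewritten as one for \<open>e\<close>.\<close>
  define L where "L = K \<union> (\<lambda>x. inv x) ` K"
  have L: "finite L" "L \<subseteq> carrier G" "K \<subseteq> L" "\<And>x. x \<in> L \<Longrightarrow> inv x \<in> L"
    using K by (auto simp: L_def subset_eq)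
  define B where "B = L \<union> (\<lambda>(x, y, c, j). x \<otimes> signed G c (d j) \<otimes> y) ` (L \<times> L \<times> UNIV \<times> I)"
  \<comment> \<open>\<open>\<one>\<close> is left out for \<open>x\<close>, since a trivial left
    factor is exactly what the conclusion permits.\<close>
  define W1 where "W1 = (\<Union>(x, y)\<in>(L - {\<one>}) \<times> L. {e \<in> carrier G. inv e \<otimes> x \<otimes> e = y})"
  define W2 where "W2 = (\<Union>(x, y)\<in>L \<times> L. {e \<in> carrier G. e \<otimes> x \<otimes> e \<otimes> y = \<one>})"
  have "m W1 = 0" unfolding W1_def
    by (rule null_UN) (use L in \<open>auto intro!: null_conj icc\<close>)
  moreover have "m W2 = 0" unfolding W2_def
    by (rule null_UN) (use L in \<open>auto intro!: null_twisted_involution icc\<close>)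
  moreover have Bf: "finite B" "B \<subseteq> carrier G"
    unfolding B_def using L d insert.hyps(1)
    by (auto intro!: finite_imageI finite_cartesian_product m_closed signed_closed)
  moreover have "m B = 0" by (rule null_finite[OF ICC_infinite[OF icc] Bf])
  moreover have W: "W1 \<subseteq> carrier G" "W2 \<subseteq> carrier G" by (auto simp: W1_def W2_def)
  ultimately have "m (\<Union>k\<in>{0,1,2::nat}. if k = 0 then W1 else if k = 1 then W2 else B) = 0"
    by (intro null_UN) auto
  then have "m (W1 \<union> W2 \<union> B) = 0" by (simp add: Un_ac)
  then have "W1 \<union> W2 \<union> B \<noteq> carrier G" using m_carrier by auto
  then obtain e where e: "e \<in> carrier G" "e \<notin> W1" "e \<notin> W2" "e \<notin> B" using W Bf by blast
  define d' where "d' = d(i := e)"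
  have d'i: "d' i = e" and d'I: "\<And>j. j \<in> I \<Longrightarrow> d' j = d j" using insert.hyps by (auto simp: d'_def)
  have e1: "x = \<one>" if "x \<in> L" "y \<in> L" "inv e \<otimes> x \<otimes> e = y" for x y
    using e(1,2) that by (auto simp: W1_def)
  have e2: "e \<otimes> x \<otimes> e \<otimes> y \<noteq> \<one>" if "x \<in> L" "y \<in> L" for x y
    using e(1,3) that by (auto simp: W2_def)
  have e3: "x \<otimes> signed G c (d j) \<otimes> y \<noteq> e" if "x \<in> L" "y \<in> L" "j \<in> I" for x y c j
    using e(4) that by (force simp: B_def)
  have e3': "x \<otimes> signed G c (d j) \<otimes> y \<noteq> signed G b e" if h: "x \<in> L" "y \<in> L" "j \<in> I" for x y c j b
  proof (cases b)
    case True then show ?thesis using e3[OF h] by (simp add: signed_def)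
  next
    case False
    have c: "x \<in> carrier G" "y \<in> carrier G" "d j \<in> carrier G" using h L d by auto
    show ?thesis
    proof
      assume "x \<otimes> signed G c (d j) \<otimes> y = signed G b e"
      then have "inv (x \<otimes> signed G c (d j) \<otimes> y) = e" using False e by (simp add: signed_def)
      then have "inv y \<otimes> signed G (\<not> c) (d j) \<otimes> inv x = e"
        using c by (simp add: inv_mult_group inv_signed m_assoc)
      then show False using e3 h L(4) by blast
    qed
  qed
  \<comment> \<open>\<open>signed G True y\<close> is just \<open>y\<close>. Equal signs force
    \<open>x = \<one>\<close> by \<open>e1\<close>, opposite signs are impossible by
    \<open>e2\<close>.\<close>
  have self: "b = c \<and> x = \<one>" if h: "x \<in> K" "y \<in> K" and eq: "x \<otimes> signed G b e \<otimes> signed G True y = signed G c e" for b c x y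
  proof -
    have xy: "x \<in> carrier G" "y \<in> carrier G" "x \<in> L" "y \<in> L" using h K L by auto
    have eq': "signed G b e = inv x \<otimes> signed G c e \<otimes> inv y"
      using eq xy e by (simp add: mult3_eq_iff signed_def[of _ True])
    consider "b" "c" | "\<not> b" "\<not> c" | "b" "\<not> c" | "\<not> b" "c" by blast
    then show ?thesis
    proof cases
      case 1
      have "inv e \<otimes> x \<otimes> e = inv y"
      proof -
        have "x \<otimes> e \<otimes> y = e" using eq 1 by (simp add: signed_def)
        then have "x \<otimes> e = e \<otimes> inv y" using xy e by (metis inv_solve_right m_closed)
        then show ?thesis using xy e by (metis inv_closed inv_solve_left m_assoc m_closed)
      qed
      then show ?thesis using e1 xy L(4) 1 by blast
    next
      case 2
      have "x \<otimes> inv e \<otimes> y = inv e" using eq 2 by (simp add: signed_def)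
      then have "inv e \<otimes> y = inv x \<otimes> inv e" using xy e by (metis inv_closed inv_solve_left m_assoc m_closed)
      then have "inv e \<otimes> y \<otimes> e = inv x" using xy e by (simp add: m_assoc)
      then have "y = \<one>" using e1 xy L(4) by blast
      then have "x = \<one>" using \<open>inv e \<otimes> y \<otimes> e = inv x\<close> xy e by (simp, metis inv_inv inv_one)
      then show ?thesis using 2 by simp
    next
      case 3
      have "x \<otimes> e \<otimes> y = inv e" using eq 3 by (simp add: signed_def)
      then have "e \<otimes> (x \<otimes> e \<otimes> y) = \<one>" using e by simp
      then have "e \<otimes> x \<otimes> e \<otimes> y = \<one>" using xy e by (simp add: m_assoc)
      then show ?thesis using e2 xy by blast
    next
      case 4
      have "inv e = inv x \<otimes> e \<otimes> inv y" using eq' 4 by (simp add: signed_def)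
      then have "e \<otimes> (inv x \<otimes> e \<otimes> inv y) = \<one>" using e by (metis r_inv)
      then have "e \<otimes> inv x \<otimes> e \<otimes> inv y = \<one>" using xy e by (simp add: m_assoc)
      then show ?thesis using e2 xy L(4) by blast
    qed
  qed
  show ?case
  proof (intro exI[of _ d'] conjI ballI allI impI)
    show "d' j \<in> carrier G" if "j \<in> insert i I" for j using that d'i d'I d e by auto
    have eL: "e \<notin> L" using e by (auto simp: B_def)
    have "signed G b e \<notin> K" for b
      using eL L(3) L(4)[of "inv e"] e(1) by (auto simp: signed_def)
    then show "signed G b (d' j) \<notin> K" if "j \<in> insert i I" for j b
      using that d'i d'I d(2) by auto
    fix j j' b c x y
    assume j: "j \<in> insert i I" "j' \<in> insert i I" and x: "x \<in> K" and y: "y \<in> K"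
      and eq: "x \<otimes> signed G b (d' j) \<otimes> y = signed G c (d' j')"
    have xy: "x \<in> carrier G" "y \<in> carrier G" "x \<in> L" "y \<in> L" using x y K L by auto
    have "j = j' \<and> b = c \<and> x = \<one>"
    proof (cases "j \<in> I")
      case jI: True
      show ?thesis
      proof (cases "j' \<in> I")
        case True then show ?thesis using d3[OF jI True x y, of b c] eq d'I[OF jI] d'I[OF True] by metis
      next
        case False
        then have "d' j' = e" using j d'i by auto
        then show ?thesis using eq e3'[OF xy(3,4) jI] d'I[OF jI] by auto
      qed
    next
      case False
      then have dj: "d' j = e" "j = i" using j d'i by auto
      show ?thesis
      proof (cases "j' \<in> I")
        case True
        then have "signed G b e = inv x \<otimes> signed G c (d j') \<otimes> inv y"
          using eq dj xy e d d'I by (simp add: mult3_eq_iff)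
        then show ?thesis using e3'[of "inv x" "inv y" j' c b] L(4) xy True by auto
      next
        case False
        then have "d' j' = e" "j' = i" using j d'i by auto
        then show ?thesis using self[OF x y, of b c] eq dj by (simp add: signed_def[of _ True])
      qed
    qed
    then show "j = j'" "b = c" "x = \<one>" by auto
  qed
qed

section \<open>Almost invariant step distributions\<close>

lemma pmf_integrable_bounded:
  fixes f :: "'a \<Rightarrow> real"
  assumes "\<And>x. \<bar>f x\<bar> \<le> B"
  shows "integrable (measure_pmf p) f"
  by (rule measure_pmf.integrable_const_bound[where B = B]) (use assms in auto)

lemma pmf_expectation_bind_bounded:
  fixes f :: "'b \<Rightarrow> real"
  assumes "\<And>x. \<bar>f x\<bar> \<le> B"
  shows "measure_pmf.expectation (bind_pmf A k) f =
    measure_pmf.expectation A (\<lambda>i. measure_pmf.expectation (k i) f)"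
  unfolding measure_pmf_bind
proof (rule integral_bind[where K = "count_space UNIV" and B' = 1])
  show "finite_measure (measure_pmf A)" by unfold_locales
  show "AE x in measure_pmf A. emeasure (measure_pmf (k x)) (space (measure_pmf (k x))) \<le> ennreal 1"
    by (simp add: measure_pmf.emeasure_space_1)
qed (use assms measure_pmf_in_subprob_algebra in auto)

lemma pmf_expectation_diff_le:
  fixes f g :: "'a \<Rightarrow> real"
  assumes f: "\<And>x. \<bar>f x\<bar> \<le> B" and g: "\<And>x. \<bar>g x\<bar> \<le> B"
    and le: "\<And>x. x \<in> set_pmf A \<Longrightarrow> \<bar>f x - g x\<bar> \<le> e"
  shows "\<bar>measure_pmf.expectation A f - measure_pmf.expectation A g\<bar> \<le> e"
proof -
  have i: "integrable (measure_pmf A) f" "integrable (measure_pmf A) g"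
    using f g by (auto intro: pmf_integrable_bounded)
  have "\<bar>measure_pmf.expectation A (\<lambda>x. f x - g x)\<bar> \<le> measure_pmf.expectation A (\<lambda>x. \<bar>f x - g x\<bar>)"
    by (rule integral_abs_bound)
  also have "\<dots> \<le> measure_pmf.expectation A (\<lambda>_. e)"
    using i le by (intro integral_mono_AE) (auto simp: AE_measure_pmf_iff)
  finally show ?thesis using i by simp
qed

lemma pmf_expectation_bounds:
  fixes f :: "'a \<Rightarrow> real"
  assumes "\<And>x. 0 \<le> f x" "\<And>x. f x \<le> 1"
  shows "0 \<le> measure_pmf.expectation A f" "measure_pmf.expectation A f \<le> 1"
proof -
  have i: "integrable (measure_pmf A) f"
    using assms by (intro pmf_integrable_bounded[where B = 1]) auto
  show "0 \<le> measure_pmf.expectation A f" using assms by simp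
  have "measure_pmf.expectation A f \<le> measure_pmf.expectation A (\<lambda>_. 1)"
    using assms i by (intro integral_mono) auto
  then show "measure_pmf.expectation A f \<le> 1" by simp
qed

text \<open>A total variation bound between the law and its left translates, stated through test
  functions because it will be applied to bounded harmonic functions.\<close>

definition near_inv :: "('a, 'm) monoid_scheme \<Rightarrow> 'a set \<Rightarrow> real \<Rightarrow> 'a pmf \<Rightarrow> bool" where
  "near_inv G M e \<mu> \<longleftrightarrow> (\<forall>f :: 'a \<Rightarrow> real. (\<forall>x. 0 \<le> f x \<and> f x \<le> 1) \<longrightarrow>
     (\<forall>y\<in>M. \<bar>measure_pmf.expectation \<mu> (\<lambda>s. f (y \<otimes>\<^bsub>G\<^esub> s)) - measure_pmf.expectation \<mu> f\<bar> \<le> e))"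

lemma near_invD:
  assumes "near_inv G M e \<mu>" "\<And>x. 0 \<le> f x" "\<And>x. f x \<le> 1" "y \<in> M"
  shows "\<bar>measure_pmf.expectation \<mu> (\<lambda>s. f (y \<otimes>\<^bsub>G\<^esub> s)) - measure_pmf.expectation \<mu> f\<bar> \<le> e"
  using assms unfolding near_inv_def by blast

lemma near_inv_bind:
  fixes G :: "('a, 'm) monoid_scheme"
  assumes "\<And>i. i \<in> set_pmf A \<Longrightarrow> near_inv G M e (k i)"
  shows "near_inv G M e (bind_pmf A k)"
  unfolding near_inv_def
proof (intro allI impI ballI)
  fix f :: "'a \<Rightarrow> real" and y
  assume f: "\<forall>x. 0 \<le> f x \<and> f x \<le> 1" and y: "y \<in> M"
  have b: "\<bar>f x\<bar> \<le> 1" for x using f[rule_format, of x] by linarith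
  have b': "\<bar>measure_pmf.expectation (k i) (\<lambda>s. f (h s))\<bar> \<le> 1" for i h
    using pmf_expectation_bounds[of "\<lambda>s. f (h s)" "k i"] f by auto
  show "\<bar>measure_pmf.expectation (bind_pmf A k) (\<lambda>s. f (y \<otimes>\<^bsub>G\<^esub> s)) - measure_pmf.expectation (bind_pmf A k) f\<bar> \<le> e"
    unfolding pmf_expectation_bind_bounded[where f = "\<lambda>s. f (y \<otimes>\<^bsub>G\<^esub> s)" and B = 1, OF b]
      pmf_expectation_bind_bounded[where f = f and B = 1, OF b]
  proof (rule pmf_expectation_diff_le[where B = 1, OF b' b'[where h = "\<lambda>s. s"]])
    show "\<bar>measure_pmf.expectation (k i) (\<lambda>s. f (y \<otimes>\<^bsub>G\<^esub> s)) - measure_pmf.expectation (k i) f\<bar> \<le> e"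
      if "i \<in> set_pmf A" for i
      using near_invD[OF assms[OF that]] f y by blast
  qed
qed

text \<open>The factor \<open>v\<close> on the right does not interfere with left translation. The
  averages over \<open>F\<close> and \<open>y F\<close> differ only through \<open>y F - F\<close>
  and \<open>F - y F\<close>; these have the same cardinality and enter with opposite signs, so the
  bound is \<open>e\<close> and not \<open>2 * e\<close>.\<close>

lemma (in group) near_inv_translates:
  fixes e :: real
  assumes F: "finite F" "F \<noteq> {}" "F \<subseteq> carrier G" and M: "M \<subseteq> carrier G" and v: "v \<in> carrier G"
    and inv: "\<And>g. g \<in> M \<Longrightarrow> card ((g <# F) - F) \<le> e * card F"
  shows "near_inv G M e (map_pmf (\<lambda>a. a \<otimes> v) (pmf_of_set F))"
  unfolding near_inv_def
proof (intro allI impI ballI)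
  fix f :: "'a \<Rightarrow> real" and y
  assume f: "\<forall>x. 0 \<le> f x \<and> f x \<le> 1" and y: "y \<in> M"
  define h where "h b = f (b \<otimes> v)" for b
  have h: "0 \<le> h b" "h b \<le> 1" for b using f by (auto simp: h_def)
  let ?T = "y <# F"
  have yc: "y \<in> carrier G" using y M by auto
  have T: "?T = (\<lambda>a. y \<otimes> a) ` F" by (auto simp: l_coset_def)
  have inj: "inj_on (\<lambda>a. y \<otimes> a) F" using yc F by (auto simp: inj_on_def subset_eq)
  have fT: "finite ?T" "card ?T = card F" using F inj by (simp_all add: T card_image)
  have cpos: "0 < real (card F)" using F by (simp add: card_gt_0_iff)
  have "(\<Sum>a\<in>F. f (y \<otimes> (a \<otimes> v))) = (\<Sum>a\<in>F. h (y \<otimes> a))"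
    using F yc v by (intro sum.cong) (auto simp: h_def m_assoc subset_eq)
  also have "\<dots> = sum h ?T" using inj by (simp add: T sum.reindex)
  finally have E1: "(\<Sum>a\<in>F. f (y \<otimes> (a \<otimes> v))) = sum h ?T" .
  have "sum h ?T = sum h (?T - F) + sum h (?T \<inter> F)"
    using fT by (subst sum.union_disjoint[symmetric]) (auto simp: Un_Diff_Int)
  moreover have "sum h F = sum h (F - ?T) + sum h (?T \<inter> F)"
    using F by (subst sum.union_disjoint[symmetric]) (auto simp: Un_Diff_Int Int_commute)
  moreover have c: "card (F - ?T) = card (?T - F)"
    using fT F by (simp add: card_Diff_subset_Int Int_commute)
  moreover have "sum h (?T - F) \<le> card (?T - F)" "sum h (F - ?T) \<le> card (F - ?T)"
    using sum_bounded_above[of "?T - F" h 1] sum_bounded_above[of "F - ?T" h 1] h by auto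
  moreover have "0 \<le> sum h (?T - F)" "0 \<le> sum h (F - ?T)" using h by (auto intro: sum_nonneg)
  moreover have "card (?T - F) \<le> e * card F" by (rule inv[OF y])
  ultimately have "\<bar>sum h ?T - sum h F\<bar> \<le> e * card F" by linarith
  then have "\<bar>sum h ?T / card F - sum h F / card F\<bar> \<le> e"
    using cpos by (simp add: diff_divide_distrib[symmetric] abs_divide pos_divide_le_eq)
  then show "\<bar>measure_pmf.expectation (map_pmf (\<lambda>a. a \<otimes> v) (pmf_of_set F)) (\<lambda>s. f (y \<otimes> s)) -
      measure_pmf.expectation (map_pmf (\<lambda>a. a \<otimes> v) (pmf_of_set F)) f\<bar> \<le> e"
    using F by (simp add: integral_pmf_of_set E1 h_def)
qed

text \<open>For \<open>t = (a, b)\<close> this is \<open>a d b^-1\<close> if \<open>s\<close> holds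
  and its inverse \<open>b d^-1 a^-1\<close> otherwise. Inversion thus merely flips
  \<open>s\<close>, which is the source of the symmetry of the step law.\<close>

definition sandwich :: "('a, 'm) monoid_scheme \<Rightarrow> bool \<Rightarrow> 'a \<Rightarrow> 'a \<times> 'a \<Rightarrow> 'a" where
  "sandwich G s d t = (if s then fst t else snd t) \<otimes>\<^bsub>G\<^esub> signed G s d \<otimes>\<^bsub>G\<^esub>
     inv\<^bsub>G\<^esub> (if s then snd t else fst t)"

lemma (in group) sandwich_closed:
  "d \<in> carrier G \<Longrightarrow> fst t \<in> carrier G \<Longrightarrow> snd t \<in> carrier G \<Longrightarrow> sandwich G s d t \<in> carrier G"
  by (simp add: sandwich_def)

lemma (in group) inv_sandwich:
  "d \<in> carrier G \<Longrightarrow> fst t \<in> carrier G \<Longrightarrow> snd t \<in> carrier G \<Longrightarrow>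
    inv (sandwich G s d t) = sandwich G (\<not> s) d t"
  by (simp add: sandwich_def inv_mult_group inv_signed m_assoc)

text \<open>Given the rightmost factor, the leftmost one is still uniform on \<open>F\<close>, so
  the law is a mixture of right translates of the uniform law. It matters that \<open>d\<close> does
  not depend on the pair being drawn.\<close>

lemma (in group) near_inv_sandwich:
  fixes e :: real
  assumes F: "finite F" "F \<noteq> {}" "F \<subseteq> carrier G" and M: "M \<subseteq> carrier G" and d: "d \<in> carrier G"
    and inv: "\<And>g. g \<in> M \<Longrightarrow> card ((g <# F) - F) \<le> e * card F"
  shows "near_inv G M e (map_pmf (sandwich G s d) (pair_pmf (pmf_of_set F) (pmf_of_set F)))"
proof -
  have P: "near_inv G M e (bind_pmf (pmf_of_set F) (\<lambda>b. map_pmf (\<lambda>a. a \<otimes> (signed G s d \<otimes> inv b)) (pmf_of_set F)))"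
    using F M d inv by (intro near_inv_bind near_inv_translates) auto
  have eq: "map_pmf (\<lambda>a. a \<otimes> (signed G s d \<otimes> inv b)) (pmf_of_set F)
     = map_pmf (\<lambda>a. a \<otimes> signed G s d \<otimes> inv b) (pmf_of_set F)" if "b \<in> set_pmf (pmf_of_set F)" for b
    using that F d by (intro map_pmf_cong) (auto simp: m_assoc subset_eq)
  have "map_pmf (sandwich G s d) (pair_pmf (pmf_of_set F) (pmf_of_set F)) =
      bind_pmf (pmf_of_set F) (\<lambda>b. map_pmf (\<lambda>a. a \<otimes> signed G s d \<otimes> inv b) (pmf_of_set F))"
  proof (cases s)
    case True
    have "map_pmf (sandwich G s d) (pair_pmf (pmf_of_set F) (pmf_of_set F)) =
       bind_pmf (pmf_of_set F) (\<lambda>a. bind_pmf (pmf_of_set F) (\<lambda>b. return_pmf (a \<otimes> signed G s d \<otimes> inv b)))"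
      using True by (simp add: pair_pmf_def map_bind_pmf sandwich_def)
    \<comment> \<open>For \<open>s\<close> true the rightmost factor is the second component, so the
      order of the two draws is exchanged.\<close>
    then show ?thesis by (subst (asm) bind_commute_pmf) (simp add: map_pmf_def)
  next
    case False
    then show ?thesis
      by (simp add: pair_pmf_def sandwich_def map_pmf_def bind_assoc_pmf bind_return_pmf)
  qed
  also have "\<dots> = bind_pmf (pmf_of_set F) (\<lambda>b. map_pmf (\<lambda>a. a \<otimes> (signed G s d \<otimes> inv b)) (pmf_of_set F))"
    by (rule bind_pmf_cong) (simp_all add: eq)
  finally show ?thesis using P by simp
qed

text \<open>Comparing two sandwiches surrounded by elements of \<open>U\<close> collects four
  factors on each side of \<open>d\<close>, padded with \<open>\<one>\<close>; excluding that a
  surrounded sandwich lies in \<open>U\<close> collects five.\<close>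

definition prod5 :: "('a, 'm) monoid_scheme \<Rightarrow> 'a set \<Rightarrow> 'a set" where
  "prod5 G U = {p \<otimes>\<^bsub>G\<^esub> q \<otimes>\<^bsub>G\<^esub> r \<otimes>\<^bsub>G\<^esub> s \<otimes>\<^bsub>G\<^esub> t | p q r s t. p \<in> U \<and> q \<in> U \<and> r \<in> U \<and> s \<in> U \<and> t \<in> U}"

text \<open>All factors from \<open>U\<close> are moved next to \<open>d i\<close>, and freeness of
  the family makes the left collection trivial. The product thus reveals the index, the sign and
  \<open>m\<close> times the leftmost factor, but not \<open>m\<close> itself.\<close>

lemma (in group) sandwich_separated:
  assumes U: "U \<subseteq> carrier G" "\<one> \<in> U" "\<And>x. x \<in> U \<Longrightarrow> inv x \<in> U"
    and d: "\<And>i. i \<in> I \<Longrightarrow> d i \<in> carrier G"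
    and free: "\<And>i j b c x y. i \<in> I \<Longrightarrow> j \<in> I \<Longrightarrow> x \<in> prod5 G U \<Longrightarrow> y \<in> prod5 G U \<Longrightarrow>
      x \<otimes> signed G b (d i) \<otimes> y = signed G c (d j) \<Longrightarrow> i = j \<and> b = c \<and> x = \<one>"
    and ij: "i \<in> I" "j \<in> I"
    and u: "m \<in> U" "n \<in> U" "m' \<in> U" "n' \<in> U" "fst t \<in> U" "snd t \<in> U" "fst t' \<in> U" "snd t' \<in> U"
    and eq: "m \<otimes> sandwich G b (d i) t \<otimes> n = m' \<otimes> sandwich G c (d j) t' \<otimes> n'"
  shows "i = j \<and> b = c \<and> m \<otimes> (if b then fst t else snd t) = m' \<otimes> (if c then fst t' else snd t')"
proof -
  define p where "p = (if b then fst t else snd t)"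
  define q where "q = (if b then snd t else fst t)"
  define p' where "p' = (if c then fst t' else snd t')"
  define q' where "q' = (if c then snd t' else fst t')"
  have pq: "p \<in> U" "q \<in> U" "p' \<in> U" "q' \<in> U" using u by (auto simp: p_def q_def p'_def q'_def)
  let ?D = "signed G b (d i)" and ?E = "signed G c (d j)"
  have DE: "?D \<in> carrier G" "?E \<in> carrier G" using d ij by auto
  have cl: "\<And>x. x \<in> U \<Longrightarrow> x \<in> carrier G" using U by auto
  note [simp] = cl[OF pq(1)] cl[OF pq(2)] cl[OF pq(3)] cl[OF pq(4)] cl[OF u(1)] cl[OF u(2)] cl[OF u(3)] cl[OF u(4)] DE
  have "(m \<otimes> p) \<otimes> ?D \<otimes> (inv q \<otimes> n) = (m' \<otimes> p') \<otimes> ?E \<otimes> (inv q' \<otimes> n')"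
    using eq unfolding sandwich_def p_def[symmetric] q_def[symmetric] p'_def[symmetric] q'_def[symmetric]
    by (simp add: m_assoc)
  then have "?E = inv (m' \<otimes> p') \<otimes> ((m \<otimes> p) \<otimes> ?D \<otimes> (inv q \<otimes> n)) \<otimes> inv (inv q' \<otimes> n')"
    using mult3_eq_iff[of "m' \<otimes> p'" ?E "inv q' \<otimes> n'" "(m \<otimes> p) \<otimes> ?D \<otimes> (inv q \<otimes> n)"] by simp
  then have E: "(inv (m' \<otimes> p') \<otimes> (m \<otimes> p)) \<otimes> ?D \<otimes> (inv q \<otimes> n \<otimes> inv (inv q' \<otimes> n')) = ?E"
    by (simp add: m_assoc)
  have "inv (m' \<otimes> p') \<otimes> (m \<otimes> p) = \<one> \<otimes> inv p' \<otimes> inv m' \<otimes> m \<otimes> p"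
    by (simp add: inv_mult_group m_assoc)
  then have x: "inv (m' \<otimes> p') \<otimes> (m \<otimes> p) \<in> prod5 G U"
    unfolding prod5_def using U u pq by blast
  have "inv q \<otimes> n \<otimes> inv (inv q' \<otimes> n') = \<one> \<otimes> inv q \<otimes> n \<otimes> inv n' \<otimes> q'"
    by (simp add: inv_mult_group m_assoc)
  then have y: "inv q \<otimes> n \<otimes> inv (inv q' \<otimes> n') \<in> prod5 G U"
    unfolding prod5_def using U u pq by blast
  have r: "i = j" "b = c" "inv (m' \<otimes> p') \<otimes> (m \<otimes> p) = \<one>" using free[OF ij x y E] by auto
  then have "m \<otimes> p = m' \<otimes> p'"
    by (metis cl inv_closed inv_equality inv_inv m_closed pq(1) pq(3) u(1) u(3))
  then show ?thesis using r by (simp add: p_def p'_def)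
qed

lemma (in group) sandwich_notin:
  assumes U: "U \<subseteq> carrier G" "\<one> \<in> U" "\<And>x. x \<in> U \<Longrightarrow> inv x \<in> U"
    and d: "d \<in> carrier G" "signed G b d \<notin> prod5 G U"
    and u: "m \<in> U" "n \<in> U" "fst t \<in> U" "snd t \<in> U"
  shows "m \<otimes> sandwich G b d t \<otimes> n \<notin> U"
proof
  assume z: "m \<otimes> sandwich G b d t \<otimes> n \<in> U"
  define p where "p = (if b then fst t else snd t)"
  define q where "q = (if b then snd t else fst t)"
  have pq: "p \<in> U" "q \<in> U" using u by (auto simp: p_def q_def)
  have cl: "\<And>x. x \<in> U \<Longrightarrow> x \<in> carrier G" using U by auto
  let ?D = "signed G b d" and ?z = "m \<otimes> sandwich G b d t \<otimes> n"
  have D: "?D \<in> carrier G" using d by auto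
  note [simp] = cl[OF pq(1)] cl[OF pq(2)] cl[OF u(1)] cl[OF u(2)] D
  have "?z = (m \<otimes> p) \<otimes> ?D \<otimes> (inv q \<otimes> n)"
    unfolding sandwich_def p_def[symmetric] q_def[symmetric] by (simp add: m_assoc)
  then have "?D = inv (m \<otimes> p) \<otimes> ?z \<otimes> inv (inv q \<otimes> n)"
    using mult3_eq_iff[of "m \<otimes> p" ?D "inv q \<otimes> n" ?z] cl[OF z] by simp
  also have "\<dots> = inv p \<otimes> inv m \<otimes> ?z \<otimes> inv n \<otimes> q"
    using cl[OF z] by (simp add: inv_mult_group m_assoc)
  finally have "?D \<in> prod5 G U" unfolding prod5_def using U u pq z by blast
  then show False using d by simp
qed


text \<open>One \<open>q\<close> pays for the branch \<open>B\<close>, which is arbitrary but has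
  weight \<open>q\<close>, the other for the defect of \<open>A\<close>.\<close>

lemma near_inv_mixture:
  assumes J: "0 \<le> q" "q \<le> 1" and A: "near_inv G M q A"
  shows "near_inv G M (2 * q) (bind_pmf (bernoulli_pmf q) (\<lambda>j. if j then B else A))"
  unfolding near_inv_def
proof (intro allI impI ballI)
  fix f :: "'a \<Rightarrow> real" and y
  assume f: "\<forall>x. 0 \<le> f x \<and> f x \<le> 1" and y: "y \<in> M"
  have b: "\<bar>f x\<bar> \<le> 1" for x using f[rule_format, of x] by linarith
  let ?E = "\<lambda>p g. measure_pmf.expectation p g"
  let ?g = "\<lambda>s. f (y \<otimes>\<^bsub>G\<^esub> s)"
  have B: "0 \<le> ?E B f" "?E B f \<le> 1" "0 \<le> ?E B ?g" "?E B ?g \<le> 1"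
    using f by (auto intro!: pmf_expectation_bounds)
  have A': "\<bar>?E A ?g - ?E A f\<bar> \<le> q" using near_invD[OF A, of f y] f y by blast
  have "?E (bind_pmf (bernoulli_pmf q) (\<lambda>j. if j then B else A)) ?g -
      ?E (bind_pmf (bernoulli_pmf q) (\<lambda>j. if j then B else A)) f
     = q * (?E B ?g - ?E B f) + (1 - q) * (?E A ?g - ?E A f)"
    using J by (simp add: pmf_expectation_bind_bounded[where f = ?g and B = 1, OF b]
        pmf_expectation_bind_bounded[where f = f and B = 1, OF b] algebra_simps)
  also have "\<bar>\<dots>\<bar> \<le> q * \<bar>?E B ?g - ?E B f\<bar> + (1 - q) * \<bar>?E A ?g - ?E A f\<bar>"
    using J by (intro order_trans[OF abs_triangle_ineq]) (simp add: abs_mult)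
  also have "\<dots> \<le> q * 1 + 1 * q"
    using J A' B by (intro add_mono mult_mono) auto
  finally show "\<bar>?E (bind_pmf (bernoulli_pmf q) (\<lambda>j. if j then B else A)) ?g -
      ?E (bind_pmf (bernoulli_pmf q) (\<lambda>j. if j then B else A)) f\<bar> \<le> 2 * q" by simp
qed

lemma (in group) ex_symmetric_superset:
  assumes "finite W" "W \<subseteq> carrier G"
  shows "\<exists>U. finite U \<and> U \<subseteq> carrier G \<and> \<one> \<in> U \<and> (\<forall>x\<in>U. inv x \<in> U) \<and> W \<subseteq> U"
proof (intro exI conjI ballI)
  let ?U = "insert \<one> W \<union> (\<lambda>x. inv x) ` insert \<one> W"
  show "finite ?U" "?U \<subseteq> carrier G" "\<one> \<in> ?U" "W \<subseteq> ?U" using assms by auto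
  fix x assume "x \<in> ?U"
  then consider "x \<in> insert \<one> W" | y where "y \<in> insert \<one> W" "x = inv y" by blast
  then show "inv x \<in> ?U"
  proof cases
    case 1 then show ?thesis by blast
  next
    case 2
    then have "inv x = y" using assms by auto
    then show ?thesis using 2 by blast
  qed
qed

text \<open>The interface between the construction of one level and the walk. \<open>M\<close> holds
  what may surround a step, \<open>S\<close> the steps that can be recognized, and
  \<open>\<gamma>\<close> is charged for the sake of full support. The two clauses about products
  let the position before a step be read off, and separate the result from all of
  \<open>M\<close>.\<close>

definition step_ok :: "('a, 'm) monoid_scheme \<Rightarrow> ('b, 'n) monoid_scheme \<Rightarrow> ('a \<times> 'b) set \<Rightarrow> 'a \<times> 'b \<Rightarrow> real \<Rightarrow>
    ('a \<times> 'b) pmf \<Rightarrow> ('a \<times> 'b) set \<Rightarrow> bool" where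
  "step_ok G1 G2 M \<gamma> q \<nu> S \<longleftrightarrow>
     finite (set_pmf \<nu>) \<and> set_pmf \<nu> \<subseteq> carrier (G1 \<times>\<times> G2) \<and> \<gamma> \<in> set_pmf \<nu> \<and>
     map_pmf (\<lambda>x. inv\<^bsub>G1 \<times>\<times> G2\<^esub> x) \<nu> = \<nu> \<and> measure_pmf.prob \<nu> (- S) \<le> q \<and>
     (\<forall>m\<in>M. \<forall>n\<in>M. \<forall>m'\<in>M. \<forall>n'\<in>M. \<forall>s\<in>S. \<forall>s'\<in>S.
        m \<otimes>\<^bsub>G1 \<times>\<times> G2\<^esub> s \<otimes>\<^bsub>G1 \<times>\<times> G2\<^esub> n = m' \<otimes>\<^bsub>G1 \<times>\<times> G2\<^esub> s' \<otimes>\<^bsub>G1 \<times>\<times> G2\<^esub> n' \<longrightarrow> m = m') \<and>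
     (\<forall>m\<in>M. \<forall>n\<in>M. \<forall>s\<in>S. m \<otimes>\<^bsub>G1 \<times>\<times> G2\<^esub> s \<otimes>\<^bsub>G1 \<times>\<times> G2\<^esub> n \<notin> M) \<and>
     near_inv G1 (fst ` M) (2 * q) (map_pmf fst \<nu>) \<and> near_inv G2 (snd ` M) (2 * q) (map_pmf snd \<nu>)"

lemma map_pmf_Not_bernoulli_half: "map_pmf Not (bernoulli_pmf (1 / 2)) = bernoulli_pmf (1 / 2)"
proof (rule pmf_eqI)
  fix b
  have "pmf (map_pmf Not (bernoulli_pmf (1 / 2))) (\<not> \<not> b) = pmf (bernoulli_pmf (1 / 2)) (\<not> b)"
    by (rule pmf_map_inj') (auto simp: inj_def)
  then show "pmf (map_pmf Not (bernoulli_pmf (1 / 2))) b = pmf (bernoulli_pmf (1 / 2)) b" by simp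
qed

text \<open>The pair \<open>r\<close> drawn for the second coordinate selects the middle element of
  the first coordinate, and the pair \<open>t\<close> drawn for the first selects that of the
  second. As \<open>t\<close> and \<open>r\<close> are independent, each coordinate alone stays
  almost invariant. Jointly, the first reveals \<open>r\<close> and the second reveals
  \<open>t\<close>, and these can be cancelled to recover \<open>m\<close>.\<close>

lemma ex_step_ok:
  fixes G1 :: "('a, 'm) monoid_scheme" and G2 :: "('b, 'n) monoid_scheme"
  assumes G1: "group G1" "countable (carrier G1)" "amenable G1" "ICC G1" "carrier G1 \<noteq> {\<one>\<^bsub>G1\<^esub>}"
    and G2: "group G2" "countable (carrier G2)" "amenable G2" "ICC G2" "carrier G2 \<noteq> {\<one>\<^bsub>G2\<^esub>}"
    and M: "finite M" "M \<subseteq> carrier (G1 \<times>\<times> G2)" and \<gamma>: "\<gamma> \<in> carrier (G1 \<times>\<times> G2)"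
    and q: "0 < q" "q \<le> 1"
  shows "\<exists>\<nu> S. step_ok G1 G2 M \<gamma> q \<nu> S"
proof -
  interpret A: group G1 by (rule G1)
  interpret B: group G2 by (rule G2)
  let ?G = "G1 \<times>\<times> G2"
  interpret P: group ?G by (rule DirProd_group[OF G1(1) G2(1)])
  have MA: "finite (fst ` M)" "fst ` M \<subseteq> carrier G1" and MB: "finite (snd ` M)" "snd ` M \<subseteq> carrier G2"
    using M by auto
  obtain E where E: "finite E" "E \<noteq> {}" "E \<subseteq> carrier G1"
      "\<And>g. g \<in> fst ` M \<Longrightarrow> card ((g <#\<^bsub>G1\<^esub> E) - E) \<le> q * card E"
    using A.folner[OF G1(2,3) MA q(1)] by blast
  obtain F where F: "finite F" "F \<noteq> {}" "F \<subseteq> carrier G2"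
      "\<And>g. g \<in> snd ` M \<Longrightarrow> card ((g <#\<^bsub>G2\<^esub> F) - F) \<le> q * card F"
    using B.folner[OF G2(2,3) MB q(1)] by blast
  \<comment> \<open>\<open>U\<close> contains the Folner set besides the projection of
    \<open>M\<close>, so that the outer factors of a sandwich count as short elements too; likewise
    \<open>V\<close>.\<close>
  obtain U where U: "finite U" "U \<subseteq> carrier G1" "\<one>\<^bsub>G1\<^esub> \<in> U" "\<And>x. x \<in> U \<Longrightarrow> inv\<^bsub>G1\<^esub> x \<in> U" "fst ` M \<subseteq> U" "E \<subseteq> U"
    using A.ex_symmetric_superset[of "fst ` M \<union> E"] MA E(1,3) by (metis finite_Un le_sup_iff)
  obtain V where V: "finite V" "V \<subseteq> carrier G2" "\<one>\<^bsub>G2\<^esub> \<in> V" "\<And>x. x \<in> V \<Longrightarrow> inv\<^bsub>G2\<^esub> x \<in> V" "snd ` M \<subseteq> V" "F \<subseteq> V"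
    using B.ex_symmetric_superset[of "snd ` M \<union> F"] MB F(1,3) by (metis finite_Un le_sup_iff)
  have p5: "finite (prod5 H W)" if "finite W" for H :: "('c, 'd) monoid_scheme" and W
  proof -
    have "prod5 H W \<subseteq> (\<lambda>(p, q, r, s, t). p \<otimes>\<^bsub>H\<^esub> q \<otimes>\<^bsub>H\<^esub> r \<otimes>\<^bsub>H\<^esub> s \<otimes>\<^bsub>H\<^esub> t) ` (W \<times> W \<times> W \<times> W \<times> W)"
    proof
      fix x assume "x \<in> prod5 H W"
      then obtain p q r s t where "x = p \<otimes>\<^bsub>H\<^esub> q \<otimes>\<^bsub>H\<^esub> r \<otimes>\<^bsub>H\<^esub> s \<otimes>\<^bsub>H\<^esub> t"
        "p \<in> W" "q \<in> W" "r \<in> W" "s \<in> W" "t \<in> W" unfolding prod5_def by blast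
      then show "x \<in> (\<lambda>(p, q, r, s, t). p \<otimes>\<^bsub>H\<^esub> q \<otimes>\<^bsub>H\<^esub> r \<otimes>\<^bsub>H\<^esub> s \<otimes>\<^bsub>H\<^esub> t) ` (W \<times> W \<times> W \<times> W \<times> W)"
        by (intro image_eqI[of _ _ "(p, q, r, s, t)"]) auto
    qed
    then show ?thesis using that by (elim finite_subset) (intro finite_imageI finite_cartesian_product)
  qed
  have p5U: "prod5 G1 U \<subseteq> carrier G1" and p5V: "prod5 G2 V \<subseteq> carrier G2"
    using U(2) V(2) by (auto simp: prod5_def subset_eq)
  from A.free_family[OF G1(3-5) p5[OF U(1)] p5U finite_cartesian_product[OF F(1) F(1)]]
  obtain d where d: "\<forall>i\<in>F \<times> F. d i \<in> carrier G1" "\<forall>i\<in>F \<times> F. \<forall>b. signed G1 b (d i) \<notin> prod5 G1 U"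
    "\<forall>i\<in>F \<times> F. \<forall>j\<in>F \<times> F. \<forall>b c. \<forall>x\<in>prod5 G1 U. \<forall>y\<in>prod5 G1 U.
      x \<otimes>\<^bsub>G1\<^esub> signed G1 b (d i) \<otimes>\<^bsub>G1\<^esub> y = signed G1 c (d j) \<longrightarrow> i = j \<and> b = c \<and> x = \<one>\<^bsub>G1\<^esub>"
    by (elim exE conjE)
  from B.free_family[OF G2(3-5) p5[OF V(1)] p5V finite_cartesian_product[OF E(1) E(1)]]
  obtain e where e: "\<forall>i\<in>E \<times> E. e i \<in> carrier G2" "\<forall>i\<in>E \<times> E. \<forall>b. signed G2 b (e i) \<notin> prod5 G2 V"
    "\<forall>i\<in>E \<times> E. \<forall>j\<in>E \<times> E. \<forall>b c. \<forall>x\<in>prod5 G2 V. \<forall>y\<in>prod5 G2 V.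
      x \<otimes>\<^bsub>G2\<^esub> signed G2 b (e i) \<otimes>\<^bsub>G2\<^esub> y = signed G2 c (e j) \<longrightarrow> i = j \<and> b = c \<and> x = \<one>\<^bsub>G2\<^esub>"
    by (elim exE conjE)
  define el where "el s t r = (sandwich G1 s (d r) t, sandwich G2 s (e t) r)" for s t r
  define PE where "PE = pair_pmf (pmf_of_set E) (pmf_of_set E)"
  define PF where "PF = pair_pmf (pmf_of_set F) (pmf_of_set F)"
  have sPE: "set_pmf PE = E \<times> E" and sPF: "set_pmf PF = F \<times> F"
    using E F by (simp_all add: PE_def PF_def)
  define good where "good = bind_pmf (bernoulli_pmf (1/2)) (\<lambda>s. bind_pmf PE (\<lambda>t. bind_pmf PF (\<lambda>r. return_pmf (el s t r))))"
  define junk where "junk = pmf_of_set {\<gamma>, inv\<^bsub>?G\<^esub> \<gamma>}"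
  define \<nu> where "\<nu> = bind_pmf (bernoulli_pmf q) (\<lambda>j. if j then junk else good)"
  define S where "S = set_pmf good"
  have S: "S = {el s t r | s t r. t \<in> E \<times> E \<and> r \<in> F \<times> F}"
  proof -
    have "set_pmf (bernoulli_pmf (1/2)) = UNIV" by simp
    then show ?thesis unfolding S_def good_def set_bind_pmf sPE sPF set_return_pmf by blast
  qed
  have el_in: "el s t r \<in> carrier ?G" if "t \<in> E \<times> E" "r \<in> F \<times> F" for s t r
    using that E(3) F(3) d(1) e(1) unfolding el_def carrier_DirProd
    by (auto intro!: A.sandwich_closed B.sandwich_closed)
  have inv_el: "inv\<^bsub>?G\<^esub> (el s t r) = el (\<not> s) t r" if tr: "t \<in> E \<times> E" "r \<in> F \<times> F" for s t r
  proof -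
    have "fst t \<in> carrier G1" "snd t \<in> carrier G1" "fst r \<in> carrier G2" "snd r \<in> carrier G2"
      using tr E(3) F(3) by auto
    moreover have "d r \<in> carrier G1" "e t \<in> carrier G2" using d(1) e(1) tr by blast+
    ultimately show ?thesis
      using inv_DirProd[OF G1(1) G2(1), of "sandwich G1 s (d r) t" "sandwich G2 s (e t) r"]
      by (simp add: el_def A.inv_sandwich B.inv_sandwich A.sandwich_closed B.sandwich_closed)
  qed
  have Sfin: "finite S" and Sc: "S \<subseteq> carrier ?G"
  proof -
    show "finite S" unfolding S_def good_def set_bind_pmf sPE sPF set_return_pmf
      using E(1) F(1) by (intro finite_UN_I finite_cartesian_product) auto
    show "S \<subseteq> carrier ?G" unfolding S using el_in by blast
  qed
  have junk: "set_pmf junk = {\<gamma>, inv\<^bsub>?G\<^esub> \<gamma>}" unfolding junk_def by (rule set_pmf_of_set) auto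
  have s\<nu>: "set_pmf \<nu> \<subseteq> S \<union> {\<gamma>, inv\<^bsub>?G\<^esub> \<gamma>}" 
  proof
    fix x assume "x \<in> set_pmf \<nu>"
    then obtain j where "x \<in> set_pmf (if j then junk else good)" unfolding \<nu>_def set_bind_pmf by blast
    then show "x \<in> S \<union> {\<gamma>, inv\<^bsub>?G\<^esub> \<gamma>}" unfolding S_def junk[symmetric] by (cases j) simp_all
  qed
  have sym_good: "map_pmf (\<lambda>x. inv\<^bsub>?G\<^esub> x) good = good"
  proof -
    have "map_pmf (\<lambda>x. inv\<^bsub>?G\<^esub> x) good = bind_pmf (bernoulli_pmf (1/2)) (\<lambda>s. bind_pmf PE (\<lambda>t. bind_pmf PF (\<lambda>r. return_pmf (inv\<^bsub>?G\<^esub> (el s t r)))))"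
      by (simp add: good_def map_bind_pmf)
    also have "\<dots> = bind_pmf (bernoulli_pmf (1/2)) (\<lambda>s. bind_pmf PE (\<lambda>t. bind_pmf PF (\<lambda>r. return_pmf (el (\<not> s) t r))))"
      by (intro bind_pmf_cong refl) (simp add: sPE sPF inv_el)
    also have "\<dots> = bind_pmf (map_pmf Not (bernoulli_pmf (1/2))) (\<lambda>s. bind_pmf PE (\<lambda>t. bind_pmf PF (\<lambda>r. return_pmf (el s t r))))"
      by (simp add: bind_map_pmf)
    finally show ?thesis by (simp only: map_pmf_Not_bernoulli_half good_def)
  qed
  have sym_junk: "map_pmf (\<lambda>x. inv\<^bsub>?G\<^esub> x) junk = junk"
  proof -
    have "inj_on (\<lambda>x. inv\<^bsub>?G\<^esub> x) {\<gamma>, inv\<^bsub>?G\<^esub> \<gamma>}"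
    proof (rule inj_onI)
      fix x y assume xy: "x \<in> {\<gamma>, inv\<^bsub>?G\<^esub> \<gamma>}" "y \<in> {\<gamma>, inv\<^bsub>?G\<^esub> \<gamma>}" and eq: "inv\<^bsub>?G\<^esub> x = inv\<^bsub>?G\<^esub> y"
      have "x \<in> carrier ?G" "y \<in> carrier ?G" using xy \<gamma> P.inv_closed[OF \<gamma>] by blast+
      then show "x = y" using eq P.inv_inv by metis
    qed
    then have "map_pmf (\<lambda>x. inv\<^bsub>?G\<^esub> x) junk = pmf_of_set ((\<lambda>x. inv\<^bsub>?G\<^esub> x) ` {\<gamma>, inv\<^bsub>?G\<^esub> \<gamma>})"
      unfolding junk_def by (intro map_pmf_of_set_inj) auto
    also have "(\<lambda>x. inv\<^bsub>?G\<^esub> x) ` {\<gamma>, inv\<^bsub>?G\<^esub> \<gamma>} = {\<gamma>, inv\<^bsub>?G\<^esub> \<gamma>}" using P.inv_inv[OF \<gamma>] by (simp only: image_insert image_empty) blast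
    finally show ?thesis by (simp only: junk_def)
  qed
  have sym: "map_pmf (\<lambda>x. inv\<^bsub>?G\<^esub> x) \<nu> = \<nu>"
    unfolding \<nu>_def map_bind_pmf by (intro bind_pmf_cong refl) (simp add: sym_good sym_junk)
  have prob: "measure_pmf.prob \<nu> (- S) \<le> q"
  proof -
    have i: "\<bar>indicator (- S) x :: real\<bar> \<le> 1" for x by (simp add: indicator_def)
    have "measure_pmf.prob \<nu> (- S) = measure_pmf.expectation \<nu> (indicator (- S))" by simp
    also have "\<dots> = measure_pmf.expectation junk (indicator (- S)) * q + measure_pmf.expectation good (indicator (- S)) * (1 - q)"
      unfolding \<nu>_def using q by (subst pmf_expectation_bind_bounded[where B = 1, OF i]) simp
    also have "measure_pmf.expectation good (indicator (- S)) = (0 :: real)"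
    proof -
      have "measure_pmf.prob good (- S) = 0" by (simp add: S_def measure_pmf_zero_iff)
      moreover have "measure_pmf.prob good (- S) = measure_pmf.expectation good (indicator (- S))" by simp
      ultimately show ?thesis by (simp only:)
    qed
    also have "measure_pmf.expectation junk (indicator (- S)) * q + 0 * (1 - q) \<le> (q :: real)"
    proof -
      have "measure_pmf.expectation junk (indicator (- S)) \<le> (1::real)"
        by (intro pmf_expectation_bounds) (auto simp: indicator_def)
      then have "measure_pmf.expectation junk (indicator (- S)) * q \<le> 1 * q"
        using q by (intro mult_right_mono) auto
      then show ?thesis by simp
    qed
    finally show ?thesis .
  qed
  have niE: "near_inv G1 (fst ` M) (2 * q) (map_pmf fst \<nu>)"
  proof -
    \<comment> \<open>Only \<open>t\<close> is averaged here, with the sign and \<open>r\<close>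
      held fixed; mixing over these afterwards preserves the bound.\<close>
    have "near_inv G1 (fst ` M) q (map_pmf (\<lambda>t. sandwich G1 s (d r) t) PE)" if "r \<in> F \<times> F" for s r
      unfolding PE_def by (rule A.near_inv_sandwich[OF E(1-3) MA(2) _ E(4)]) (use d(1) that in blast)+
    then have "near_inv G1 (fst ` M) q (bind_pmf (bernoulli_pmf (1/2)) (\<lambda>s. bind_pmf PF (\<lambda>r. map_pmf (\<lambda>t. sandwich G1 s (d r) t) PE)))"
      by (intro near_inv_bind) (auto simp: sPF)
    also have "bind_pmf (bernoulli_pmf (1/2)) (\<lambda>s. bind_pmf PF (\<lambda>r. map_pmf (\<lambda>t. sandwich G1 s (d r) t) PE)) = map_pmf fst good"
      unfolding good_def map_bind_pmf map_return_pmf el_def fst_conv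
      by (subst bind_commute_pmf) (simp add: map_pmf_def)
    finally have "near_inv G1 (fst ` M) q (map_pmf fst good)" .
    then have "near_inv G1 (fst ` M) (2 * q) (bind_pmf (bernoulli_pmf q) (\<lambda>j. if j then map_pmf fst junk else map_pmf fst good))"
      using q by (intro near_inv_mixture) auto
    also have "bind_pmf (bernoulli_pmf q) (\<lambda>j. if j then map_pmf fst junk else map_pmf fst good) = map_pmf fst \<nu>"
      unfolding \<nu>_def map_bind_pmf by (intro bind_pmf_cong refl) simp
    finally show ?thesis .
  qed
  have niF: "near_inv G2 (snd ` M) (2 * q) (map_pmf snd \<nu>)"
  proof -
    have "near_inv G2 (snd ` M) q (map_pmf (\<lambda>r. sandwich G2 s (e t) r) PF)" if "t \<in> E \<times> E" for s t
      unfolding PF_def by (rule B.near_inv_sandwich[OF F(1-3) MB(2) _ F(4)]) (use e(1) that in blast)+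
    then have "near_inv G2 (snd ` M) q (bind_pmf (bernoulli_pmf (1/2)) (\<lambda>s. bind_pmf PE (\<lambda>t. map_pmf (\<lambda>r. sandwich G2 s (e t) r) PF)))"
      by (intro near_inv_bind) (auto simp: sPE)
    also have "bind_pmf (bernoulli_pmf (1/2)) (\<lambda>s. bind_pmf PE (\<lambda>t. map_pmf (\<lambda>r. sandwich G2 s (e t) r) PF)) = map_pmf snd good"
      unfolding good_def map_bind_pmf map_return_pmf el_def snd_conv by (simp add: map_pmf_def)
    finally have "near_inv G2 (snd ` M) q (map_pmf snd good)" .
    then have "near_inv G2 (snd ` M) (2 * q) (bind_pmf (bernoulli_pmf q) (\<lambda>j. if j then map_pmf snd junk else map_pmf snd good))"
      using q by (intro near_inv_mixture) auto
    also have "bind_pmf (bernoulli_pmf q) (\<lambda>j. if j then map_pmf snd junk else map_pmf snd good) = map_pmf snd \<nu>"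
      unfolding \<nu>_def map_bind_pmf by (intro bind_pmf_cong refl) simp
    finally show ?thesis .
  qed
  have freed: "\<And>i j b c x y. i \<in> F \<times> F \<Longrightarrow> j \<in> F \<times> F \<Longrightarrow> x \<in> prod5 G1 U \<Longrightarrow> y \<in> prod5 G1 U \<Longrightarrow>
      x \<otimes>\<^bsub>G1\<^esub> signed G1 b (d i) \<otimes>\<^bsub>G1\<^esub> y = signed G1 c (d j) \<Longrightarrow> i = j \<and> b = c \<and> x = \<one>\<^bsub>G1\<^esub>"
    by (rule d(3)[rule_format])
  have freee: "\<And>i j b c x y. i \<in> E \<times> E \<Longrightarrow> j \<in> E \<times> E \<Longrightarrow> x \<in> prod5 G2 V \<Longrightarrow> y \<in> prod5 G2 V \<Longrightarrow>
      x \<otimes>\<^bsub>G2\<^esub> signed G2 b (e i) \<otimes>\<^bsub>G2\<^esub> y = signed G2 c (e j) \<Longrightarrow> i = j \<and> b = c \<and> x = \<one>\<^bsub>G2\<^esub>"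
    by (rule e(3)[rule_format])
  have decode: "m = m'"
    if m: "m \<in> M" "n \<in> M" "m' \<in> M" "n' \<in> M" and s: "s \<in> S" "s' \<in> S"
      and eq: "m \<otimes>\<^bsub>?G\<^esub> s \<otimes>\<^bsub>?G\<^esub> n = m' \<otimes>\<^bsub>?G\<^esub> s' \<otimes>\<^bsub>?G\<^esub> n'" for m n m' n' s s'
  proof -
    obtain b t r where s1: "s = el b t r" "t \<in> E \<times> E" "r \<in> F \<times> F" using s(1) S by blast
    obtain b' t' r' where s2: "s' = el b' t' r'" "t' \<in> E \<times> E" "r' \<in> F \<times> F" using s(2) S by blast
    have mU: "fst m \<in> U" "fst n \<in> U" "fst m' \<in> U" "fst n' \<in> U" using m U(5) by auto
    have mV: "snd m \<in> V" "snd n \<in> V" "snd m' \<in> V" "snd n' \<in> V" using m V(5) by auto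
    have tU: "fst t \<in> U" "snd t \<in> U" "fst t' \<in> U" "snd t' \<in> U" using s1 s2 U(6) by auto
    have rV: "fst r \<in> V" "snd r \<in> V" "fst r' \<in> V" "snd r' \<in> V" using s1 s2 V(6) by auto
    have eq1: "fst m \<otimes>\<^bsub>G1\<^esub> sandwich G1 b (d r) t \<otimes>\<^bsub>G1\<^esub> fst n = fst m' \<otimes>\<^bsub>G1\<^esub> sandwich G1 b' (d r') t' \<otimes>\<^bsub>G1\<^esub> fst n'"
     and eq2: "snd m \<otimes>\<^bsub>G2\<^esub> sandwich G2 b (e t) r \<otimes>\<^bsub>G2\<^esub> snd n = snd m' \<otimes>\<^bsub>G2\<^esub> sandwich G2 b' (e t') r' \<otimes>\<^bsub>G2\<^esub> snd n'"
      using eq by (simp_all add: mult_DirProd' s1 s2 el_def)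
    have r1: "r = r' \<and> b = b' \<and> fst m \<otimes>\<^bsub>G1\<^esub> (if b then fst t else snd t) = fst m' \<otimes>\<^bsub>G1\<^esub> (if b' then fst t' else snd t')"
      by (rule A.sandwich_separated[where d = d and I = "F \<times> F", OF U(2-4) _ freed s1(3) s2(3) mU tU eq1]) (use d(1) in auto)
    have r2: "t = t' \<and> b = b' \<and> snd m \<otimes>\<^bsub>G2\<^esub> (if b then fst r else snd r) = snd m' \<otimes>\<^bsub>G2\<^esub> (if b' then fst r' else snd r')"
      by (rule B.sandwich_separated[where d = e and I = "E \<times> E", OF V(2-4) _ freee s1(2) s2(2) mV rV eq2]) (use e(1) in auto)
    \<comment> \<open>Both pairs and the sign agree by now, so the leftmost factors on the two sides
      are equal and cancel.\<close>
    define p where "p = (if b then fst t else snd t)"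
    define p' where "p' = (if b then fst r else snd r)"
    have "fst m \<otimes>\<^bsub>G1\<^esub> p = fst m' \<otimes>\<^bsub>G1\<^esub> p" "snd m \<otimes>\<^bsub>G2\<^esub> p' = snd m' \<otimes>\<^bsub>G2\<^esub> p'"
      using r1 r2 by (auto simp: p_def p'_def)
    moreover have "p \<in> carrier G1" "p' \<in> carrier G2" using tU rV U(2) V(2) by (auto simp: p_def p'_def)
    moreover have "fst m \<in> carrier G1" "fst m' \<in> carrier G1" "snd m \<in> carrier G2" "snd m' \<in> carrier G2"
      using mU mV U(2) V(2) by auto
    ultimately show ?thesis by (simp add: prod_eq_iff)
  qed
  have notin: "m \<otimes>\<^bsub>?G\<^esub> s \<otimes>\<^bsub>?G\<^esub> n \<notin> M" if m: "m \<in> M" "n \<in> M" and s: "s \<in> S" for m n s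
  proof
    assume z: "m \<otimes>\<^bsub>?G\<^esub> s \<otimes>\<^bsub>?G\<^esub> n \<in> M"
    obtain b t r where s1: "s = el b t r" "t \<in> E \<times> E" "r \<in> F \<times> F" using s S by blast
    have "fst (m \<otimes>\<^bsub>?G\<^esub> s \<otimes>\<^bsub>?G\<^esub> n) \<in> U" using z U(5) by blast
    then have "fst m \<otimes>\<^bsub>G1\<^esub> sandwich G1 b (d r) t \<otimes>\<^bsub>G1\<^esub> fst n \<in> U"
      by (simp add: mult_DirProd' s1 el_def)
    moreover have "fst m \<otimes>\<^bsub>G1\<^esub> sandwich G1 b (d r) t \<otimes>\<^bsub>G1\<^esub> fst n \<notin> U"
      by (rule A.sandwich_notin[OF U(2-4)]) (use d s1 m U(5,6) in auto)
    ultimately show False by simp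
  qed
  have "step_ok G1 G2 M \<gamma> q \<nu> S"
    unfolding step_ok_def
  proof (intro conjI ballI impI)
    show "finite (set_pmf \<nu>)" using finite_subset[OF s\<nu>] Sfin by simp
    show "set_pmf \<nu> \<subseteq> carrier ?G" using s\<nu> Sc \<gamma> P.inv_closed[OF \<gamma>] by blast
    show "\<gamma> \<in> set_pmf \<nu>"
    proof -
      have "True \<in> set_pmf (bernoulli_pmf q)" using q by (simp add: set_pmf_iff)
      then show ?thesis using junk unfolding \<nu>_def set_bind_pmf by (intro UN_I[of True]) auto
    qed
  qed (rule sym prob niE niF | rule decode notin; assumption)+
  then show ?thesis by blast
qed

section \<open>Walks with constant bounded harmonic functions\<close>

primrec words :: "('a, 'm) monoid_scheme \<Rightarrow> nat \<Rightarrow> 'a set \<Rightarrow> 'a set" where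
  "words G 0 B = {\<one>\<^bsub>G\<^esub>}"
| "words G (Suc n) B = {w \<otimes>\<^bsub>G\<^esub> s | w s. w \<in> words G n B \<and> s \<in> B}"

lemma (in monoid) words_closed: "B \<subseteq> carrier G \<Longrightarrow> words G n B \<subseteq> carrier G"
  by (induction n) auto

text \<open>The walks from \<open>x\<close> and from \<open>\<one>\<close> are driven by the same
  steps. While only levels below \<open>k\<close> occur, and at most \<open>N k\<close> steps are
  made, both positions lie in \<open>M k\<close>; the next step of level at least \<open>k\<close>
  then gives \<open>f\<close> nearly the same expectation from either position. The chance that no
  such step occurs in \<open>N k\<close> trials is controlled by \<open>decay\<close>.\<close>

lemma (in group) harmonic_const:
  fixes f :: "'a \<Rightarrow> real" and \<nu> :: "nat \<Rightarrow> 'a pmf" and p :: "nat pmf" and N :: "nat \<Rightarrow> nat"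
  assumes f: "\<And>x. 0 \<le> f x" "\<And>x. f x \<le> 1"
    and harm: "\<And>x. x \<in> carrier G \<Longrightarrow>
      f x = measure_pmf.expectation p (\<lambda>k. measure_pmf.expectation (\<nu> k) (\<lambda>s. f (x \<otimes> s)))"
    and supp: "\<And>k. set_pmf (\<nu> k) \<subseteq> carrier G"
    and near: "\<And>k y. y \<in> M k \<Longrightarrow>
      \<bar>measure_pmf.expectation (\<nu> k) (\<lambda>s. f (y \<otimes> s)) - measure_pmf.expectation (\<nu> k) f\<bar> \<le> e k"
    and e: "e \<longlonglongrightarrow> 0"
    and Mmono: "\<And>j k. j \<le> k \<Longrightarrow> M j \<subseteq> M k"
    and absorb: "\<And>x. x \<in> carrier G \<Longrightarrow> \<exists>k0. \<forall>k\<ge>k0. \<forall>n\<le>N k. \<forall>w\<in>words G n (\<Union>j<k. set_pmf (\<nu> j)). x \<otimes> w \<in> M k"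
    and decay: "(\<lambda>k. measure_pmf.prob p {..<k} ^ N k) \<longlonglongrightarrow> 0"
    and x: "x \<in> carrier G"
  shows "f x = f \<one>"
proof -
  define F where "F k y = measure_pmf.expectation (\<nu> k) (\<lambda>s. f (y \<otimes> s))" for k y
  have F: "0 \<le> F k y" "F k y \<le> 1" for k y
    unfolding F_def using f by (auto intro: pmf_expectation_bounds)
  have small: "\<bar>f x - f \<one>\<bar> \<le> \<epsilon>" if \<epsilon>: "0 < \<epsilon>" for \<epsilon>
  proof -
    obtain k1 where k1: "\<And>k. k \<ge> k1 \<Longrightarrow> \<bar>e k\<bar> < \<epsilon> / 4"
      using LIMSEQ_D[OF e, of "\<epsilon> / 4"] \<epsilon> by auto
    obtain k2 where k2: "\<And>k. k \<ge> k2 \<Longrightarrow> \<bar>measure_pmf.prob p {..<k} ^ N k\<bar> < \<epsilon> / 2"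
      using LIMSEQ_D[OF decay, of "\<epsilon> / 2"] \<epsilon> by auto
    obtain k3 where k3: "\<And>k n w. k \<ge> k3 \<Longrightarrow> n \<le> N k \<Longrightarrow> w \<in> words G n (\<Union>j<k. set_pmf (\<nu> j)) \<Longrightarrow> x \<otimes> w \<in> M k"
      using absorb[OF x] by blast
    obtain k4 where k4: "\<And>k n w. k \<ge> k4 \<Longrightarrow> n \<le> N k \<Longrightarrow> w \<in> words G n (\<Union>j<k. set_pmf (\<nu> j)) \<Longrightarrow> \<one> \<otimes> w \<in> M k"
      using absorb[OF one_closed] by blast
    define k where "k = k1 + k2 + k3 + k4"
    have k: "k \<ge> k1" "k \<ge> k2" "k \<ge> k3" "k \<ge> k4" by (auto simp: k_def)
    define B where "B = (\<Union>j<k. set_pmf (\<nu> j))"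
    have Bc: "B \<subseteq> carrier G" using supp by (auto simp: B_def)
    define a where "a = measure_pmf.prob p {..<k}"
    have a: "0 \<le> a" by (simp add: a_def)
    \<comment> \<open>\<open>w\<close> is the word of the \<open>n\<close> steps made so far and
      \<open>m\<close> the number of steps still allowed. The term \<open>a ^ m\<close> covers the
      case that all of these have level below \<open>k\<close>; for \<open>m = 0\<close> it is the
      trivial bound one.\<close>
    have claim: "\<bar>f (x \<otimes> w) - f w\<bar> \<le> a ^ m + \<epsilon> / 2"
      if "n + m \<le> N k" "w \<in> words G n B" for m n w
      using that
    proof (induction m arbitrary: n w)
      case 0
      then show ?case using f[of "x \<otimes> w"] f[of w] \<epsilon> by (simp add: abs_le_iff)
    next
      case (Suc m)
      have w: "w \<in> carrier G" using Suc.prems words_closed[OF Bc] by blast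
      \<comment> \<open>Bound according to the level \<open>j\<close> of the next step: a low level
        leads to the induction hypothesis, a high level ends the comparison at cost
        \<open>\<epsilon> / 2\<close>, that is \<open>\<epsilon> / 4\<close> for each of the two
        positions. Averaging turns \<open>a ^ m\<close> into \<open>a ^ Suc m\<close>.\<close>
      define g where "g j = a ^ m * indicator {..<k} j + \<epsilon> / 2" for j :: nat
      have pw: "\<bar>F j (x \<otimes> w) - F j w\<bar> \<le> g j" for j
      proof (cases "j < k")
        case True
        have "\<bar>F j (x \<otimes> w) - F j w\<bar> \<le> a ^ m + \<epsilon> / 2"
          unfolding F_def
        proof (rule pmf_expectation_diff_le[where B = 1])
          fix s assume s: "s \<in> set_pmf (\<nu> j)"
          have "w \<otimes> s \<in> words G (Suc n) B" using s Suc.prems True by (auto simp: B_def)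
          then have "\<bar>f (x \<otimes> (w \<otimes> s)) - f (w \<otimes> s)\<bar> \<le> a ^ m + \<epsilon> / 2"
            using Suc.prems by (intro Suc.IH[of "Suc n"]) auto
          then show "\<bar>f (x \<otimes> w \<otimes> s) - f (w \<otimes> s)\<bar> \<le> a ^ m + \<epsilon> / 2"
            using s supp w x by (simp add: m_assoc subset_eq)
        qed (use f in \<open>auto simp: abs_le_iff intro: order_trans[of _ 0]\<close>)
        then show ?thesis using True by (simp add: g_def)
      next
        case False
        \<comment> \<open>A step of level \<open>j \<ge> k\<close> is almost invariant under
          \<open>M j\<close>, in particular under the smaller set \<open>M k\<close>.\<close>
        then have "M k \<subseteq> M j" by (intro Mmono) auto
        moreover have "x \<otimes> w \<in> M k" "\<one> \<otimes> w \<in> M k"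
          using Suc.prems k3[OF k(3), of n w] k4[OF k(4), of n w] by (auto simp: B_def)
        ultimately have "\<bar>F j (x \<otimes> w) - measure_pmf.expectation (\<nu> j) f\<bar> \<le> e j"
            "\<bar>F j w - measure_pmf.expectation (\<nu> j) f\<bar> \<le> e j"
          using near[of "x \<otimes> w" j] near[of w j] w unfolding F_def by auto
        moreover have "e j < \<epsilon> / 4" using k1[of j] False k(1) by auto
        ultimately have "\<bar>F j (x \<otimes> w) - F j w\<bar> \<le> \<epsilon> / 2" by linarith
        then show ?thesis using False by (simp add: g_def)
      qed
      have iF: "integrable (measure_pmf p) (\<lambda>j. F j y)" for y
        using F by (intro pmf_integrable_bounded[where B = 1]) (auto simp: abs_le_iff intro: order_trans[of _ 0])
      have ig: "integrable (measure_pmf p) g"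
        unfolding g_def using a \<epsilon>
        by (intro pmf_integrable_bounded[where B = "a ^ m + \<epsilon> / 2"]) (auto simp: indicator_def)
      have "f (x \<otimes> w) - f w = measure_pmf.expectation p (\<lambda>j. F j (x \<otimes> w) - F j w)"
        using harm[of "x \<otimes> w"] harm[OF w] x w iF by (simp add: F_def)
      also have "\<bar>\<dots>\<bar> \<le> measure_pmf.expectation p (\<lambda>j. \<bar>F j (x \<otimes> w) - F j w\<bar>)"
        by (rule integral_abs_bound)
      also have "\<dots> \<le> measure_pmf.expectation p g"
        using pw iF ig by (intro integral_mono) auto
      also have "\<dots> = a ^ Suc m + \<epsilon> / 2"
      proof -
        have "integrable (measure_pmf p) (\<lambda>j. a ^ m * indicator {..<k} j :: real)"
          using a by (intro pmf_integrable_bounded[where B = "a ^ m"]) (auto simp: indicator_def)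
        then show ?thesis unfolding g_def by (subst Bochner_Integration.integral_add) (simp_all add: a_def)
      qed
      finally show ?case .
    qed
    have "\<bar>f (x \<otimes> \<one>) - f \<one>\<bar> \<le> a ^ N k + \<epsilon> / 2" by (rule claim[of 0]) auto
    also have "a ^ N k < \<epsilon> / 2" using k2[OF k(2)] unfolding a_def by auto
    finally show ?thesis using x by simp
  qed
  show ?thesis
  proof (rule ccontr)
    assume "f x \<noteq> f \<one>"
    then show False using small[of "\<bar>f x - f \<one>\<bar> / 2"] by auto
  qed
qed

section \<open>Laws of independent increments and of walks\<close>

abbreviation iid :: "'a pmf \<Rightarrow> (nat \<Rightarrow> 'a) measure" where
  "iid \<mu> \<equiv> PiM UNIV (\<lambda>_. measure_pmf \<mu>)"

lemma space_iid [simp]: "space (iid \<mu>) = UNIV"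
  by (simp add: space_PiM)

lemma space_traj_space [simp]: "space traj_space = UNIV"
  by (simp add: traj_space_def space_PiM)

lemma sequence_space_pmf: "sequence_space (measure_pmf \<mu>)"
  by (intro sequence_space.intro product_prob_spaceI measure_pmf.prob_space_axioms)

lemma prob_space_iid: "prob_space (iid \<mu>)"
  by (intro prob_space_PiM measure_pmf.prob_space_axioms)

lemma coordinate_measurable [measurable]: "(\<lambda>X. X i) \<in> iid \<mu> \<rightarrow>\<^sub>M count_space UNIV"
  using measurable_component_singleton[of i UNIV "\<lambda>_. measure_pmf \<mu>"] by simp

lemma traj_coordinate_measurable [measurable]: "(\<lambda>X. X i) \<in> traj_space \<rightarrow>\<^sub>M count_space UNIV"
  unfolding traj_space_def by measurable

lemma binop_measurable:
  fixes g :: "'x \<Rightarrow> 'a::countable" and h :: "'x \<Rightarrow> 'b::countable"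
  assumes g: "g \<in> M \<rightarrow>\<^sub>M count_space UNIV" and h: "h \<in> M \<rightarrow>\<^sub>M count_space UNIV"
  shows "(\<lambda>x. F (g x) (h x)) \<in> M \<rightarrow>\<^sub>M count_space UNIV"
  by (rule measurable_compose_countable[OF measurable_compose_countable[OF _ h] g]) simp

lemma rw_prod_measurable:
  fixes G :: "('a::countable, 'm) monoid_scheme"
  shows "(\<lambda>X. rw_prod G X n) \<in> iid \<mu> \<rightarrow>\<^sub>M count_space UNIV"
  by (induction n) (auto intro: binop_measurable)

lemma walk_measurable [measurable]:
  fixes G :: "('a::countable, 'm) monoid_scheme"
  shows "(\<lambda>X n. x \<otimes>\<^bsub>G\<^esub> rw_prod G X n) \<in> iid \<mu> \<rightarrow>\<^sub>M traj_space"
  unfolding traj_space_def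
proof (rule measurable_abs_UNIV)
  fix n
  show "(\<lambda>X. x \<otimes>\<^bsub>G\<^esub> rw_prod G X n) \<in> iid \<mu> \<rightarrow>\<^sub>M count_space UNIV"
    by (rule measurable_compose[OF rw_prod_measurable]) simp
qed

lemma emeasure_path_meas:
  fixes G :: "('a::countable, 'm) monoid_scheme"
  assumes "A \<in> sets traj_space"
  shows "emeasure (path_meas G \<mu> x) A = emeasure (iid \<mu>) {X. (\<lambda>n. x \<otimes>\<^bsub>G\<^esub> rw_prod G X n) \<in> A}"
  unfolding path_meas_def using assms by (subst emeasure_distr[OF walk_measurable]) (auto simp: vimage_def)

text \<open>The product space contains sequences that leave the carrier, where the group laws say
  nothing; they are discarded as a null set.\<close>

lemma AE_iid_carrier:
  assumes "set_pmf \<mu> \<subseteq> B"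
  shows "AE X in iid \<mu>. \<forall>i. X i \<in> B"
proof -
  have "AE X in iid \<mu>. X i \<in> B" for i
    using assms by (intro AE_PiM_component measure_pmf.prob_space_axioms) (auto simp: AE_measure_pmf_iff)
  then show ?thesis by (simp add: AE_all_countable)
qed

lemma cylinder_measurable: "{Y. \<forall>l<n. Y l \<in> B l} \<in> sets (iid \<kappa>)"
proof (induction n)
  case 0
  then show ?case using sets.top[of "iid \<kappa>"] by simp
next
  case (Suc n)
  have "(\<lambda>Y. Y n) -` B n \<inter> space (iid \<kappa>) \<in> sets (iid \<kappa>)"
    by (rule measurable_sets[OF coordinate_measurable]) simp
  then have "{Y. \<forall>l<n. Y l \<in> B l} \<inter> {Y. Y n \<in> B n} \<in> sets (iid \<kappa>)"
    using Suc by (intro sets.Int) (simp_all add: vimage_def)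
  moreover have "{Y. \<forall>l<n. Y l \<in> B l} \<inter> {Y. Y n \<in> B n} = {Y. \<forall>l<Suc n. Y l \<in> B l}"
    by (auto simp: less_Suc_eq)
  ultimately show ?case by simp
qed

lemma emeasure_iid_cons:
  assumes E: "E \<in> sets (iid \<mu>)"
  shows "emeasure (iid \<mu>) E = (\<integral>\<^sup>+ s. emeasure (iid \<mu>) {X. case_nat s X \<in> E} \<partial>measure_pmf \<mu>)"
proof -
  interpret sequence_space "measure_pmf \<mu>" by (rule sequence_space_pmf)
  interpret P: prob_space "iid \<mu>" by (rule prob_space_iid)
  have m: "(\<lambda>(s, X). case_nat s X) \<in> measure_pmf \<mu> \<Otimes>\<^sub>M iid \<mu> \<rightarrow>\<^sub>M iid \<mu>"
    by measurable
  have "emeasure (iid \<mu>) E = emeasure (distr (measure_pmf \<mu> \<Otimes>\<^sub>M iid \<mu>) (iid \<mu>) (\<lambda>(s, X). case_nat s X)) E"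
    by (simp only: PiM_iter)
  also have "\<dots> = emeasure (measure_pmf \<mu> \<Otimes>\<^sub>M iid \<mu>) ((\<lambda>(s, X). case_nat s X) -` E \<inter> space (measure_pmf \<mu> \<Otimes>\<^sub>M iid \<mu>))"
    by (rule emeasure_distr[OF m E])
  also have "\<dots> = (\<integral>\<^sup>+ s. emeasure (iid \<mu>) (Pair s -` ((\<lambda>(s, X). case_nat s X) -` E \<inter> space (measure_pmf \<mu> \<Otimes>\<^sub>M iid \<mu>))) \<partial>measure_pmf \<mu>)"
    by (intro P.emeasure_pair_measure_alt measurable_sets[OF m E])
  also have "\<dots> = (\<integral>\<^sup>+ s. emeasure (iid \<mu>) {X. case_nat s X \<in> E} \<partial>measure_pmf \<mu>)"
    by (intro nn_integral_cong arg_cong2[where f = emeasure]) (auto simp: space_pair_measure)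
  finally show ?thesis .
qed

lemma (in group) rw_prod_cons:
  assumes "s \<in> carrier G" "\<And>i. X i \<in> carrier G"
  shows "rw_prod G (case_nat s X) (Suc n) = s \<otimes> rw_prod G X n"
proof (induction n)
  case (Suc n)
  have "rw_prod G X n \<in> carrier G" by (induction n) (auto simp: assms)
  then show ?case using Suc assms by (simp add: m_assoc)
qed simp

lemma (in group) rw_prod_closed:
  assumes "\<And>i. X i \<in> carrier G"
  shows "rw_prod G X n \<in> carrier G"
  by (induction n) (auto simp: assms)

text \<open>The probability \<open>h x\<close> of an invariant event from the start \<open>x\<close>
  is harmonic, hence a constant \<open>c\<close>. By the Markov property the event keeps probability
  \<open>c\<close> given any finite stretch of increments, so it is independent of all cylinders and
  then of itself; thus \<open>c\<close> is zero or one.\<close>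

theorem pb_trivial_of_harmonic_const:
  fixes G :: "('a::countable, 'm) monoid_scheme"
  assumes "group G" and supp: "set_pmf \<mu> \<subseteq> carrier G"
    and const: "\<And>f :: 'a \<Rightarrow> real. (\<And>x. 0 \<le> f x) \<Longrightarrow> (\<And>x. f x \<le> 1) \<Longrightarrow>
      (\<And>x. x \<in> carrier G \<Longrightarrow> f x = measure_pmf.expectation \<mu> (\<lambda>s. f (x \<otimes>\<^bsub>G\<^esub> s))) \<Longrightarrow>
      (\<And>x. x \<in> carrier G \<Longrightarrow> f x = f \<one>\<^bsub>G\<^esub>)"
  shows "pb_trivial G \<mu>"
  unfolding pb_trivial_def
proof
  fix A :: "(nat \<Rightarrow> 'a) set" assume "A \<in> shift_inv_sets"
  then have A: "A \<in> sets traj_space" and shift: "\<And>\<omega>. \<omega> \<circ> Suc \<in> A \<longleftrightarrow> \<omega> \<in> A"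
    by (auto simp: shift_inv_sets_def)
  interpret group G by fact
  interpret S: prob_space "iid \<mu>" by (rule prob_space_iid)
  interpret sq: sequence_space "measure_pmf \<mu>" by (rule sequence_space_pmf)
  define Z where "Z x X = (\<lambda>n. x \<otimes>\<^bsub>G\<^esub> rw_prod G X n)" for x X
  define V where "V x = {X. Z x X \<in> A}" for x
  have V [measurable]: "V x \<in> sets (iid \<mu>)" for x
    using measurable_sets[OF walk_measurable[where x = x and G = G and \<mu> = \<mu>] A] by (simp add: V_def Z_def vimage_def)
  \<comment> \<open>Invariance of \<open>A\<close> is used here: dropping the first position turns
    the walk from \<open>x\<close> into the walk from \<open>x s\<close>.\<close>
  have consV: "case_nat s X \<in> V x \<longleftrightarrow> X \<in> V (x \<otimes>\<^bsub>G\<^esub> s)"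
    if "x \<in> carrier G" "s \<in> carrier G" "\<And>i. X i \<in> carrier G" for x s X
  proof -
    have "Z x (case_nat s X) \<circ> Suc = Z (x \<otimes>\<^bsub>G\<^esub> s) X"
      using that rw_prod_closed[of X] by (auto simp: Z_def fun_eq_iff rw_prod_cons m_assoc simp del: rw_prod.simps)
    then show ?thesis using shift[of "Z x (case_nat s X)"] by (simp add: V_def)
  qed
  have consV_emeasure: "emeasure (iid \<mu>) {X. case_nat s X \<in> V x \<and> X \<in> C} = emeasure (iid \<mu>) {X. X \<in> V (x \<otimes>\<^bsub>G\<^esub> s) \<and> X \<in> C}"
    if xs: "x \<in> carrier G" "s \<in> carrier G" and C: "C \<in> sets (iid \<mu>)" for x s C
  proof (rule emeasure_eq_AE)
    show "AE X in iid \<mu>. (X \<in> {X. case_nat s X \<in> V x \<and> X \<in> C}) = (X \<in> {X. X \<in> V (x \<otimes>\<^bsub>G\<^esub> s) \<and> X \<in> C})"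
      using AE_iid_carrier[OF supp] by eventually_elim (use consV[OF xs] in auto)
    have "(\<lambda>X. case_nat s X) \<in> iid \<mu> \<rightarrow>\<^sub>M iid \<mu>" by measurable
    from measurable_sets[OF this V[of x]] have "{X. case_nat s X \<in> V x} \<in> sets (iid \<mu>)"
      by (simp add: vimage_def)
    then have "{X. case_nat s X \<in> V x} \<inter> C \<in> sets (iid \<mu>)" using C by blast
    then show "{X. case_nat s X \<in> V x \<and> X \<in> C} \<in> sets (iid \<mu>)" by (simp add: Int_def)
    have "V (x \<otimes>\<^bsub>G\<^esub> s) \<inter> C \<in> sets (iid \<mu>)" using C V by blast
    then show "{X. X \<in> V (x \<otimes>\<^bsub>G\<^esub> s) \<and> X \<in> C} \<in> sets (iid \<mu>)" by (simp add: Int_def)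
  qed
  define h where "h x = measure (iid \<mu>) (V x)" for x
  have h01: "0 \<le> h x" "h x \<le> 1" for x by (auto simp: h_def)
  have "h x = measure_pmf.expectation \<mu> (\<lambda>s. h (x \<otimes>\<^bsub>G\<^esub> s))" if x: "x \<in> carrier G" for x
  proof -
    have "ennreal (h x) = (\<integral>\<^sup>+ s. emeasure (iid \<mu>) {X. case_nat s X \<in> V x} \<partial>measure_pmf \<mu>)"
      using emeasure_iid_cons[OF V[of x]] by (simp add: h_def S.emeasure_eq_measure)
    also have "\<dots> = (\<integral>\<^sup>+ s. ennreal (h (x \<otimes>\<^bsub>G\<^esub> s)) \<partial>measure_pmf \<mu>)"
    proof (rule nn_integral_cong_AE)
      show "AE s in measure_pmf \<mu>. emeasure (iid \<mu>) {X. case_nat s X \<in> V x} = ennreal (h (x \<otimes>\<^bsub>G\<^esub> s))"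
        unfolding AE_measure_pmf_iff
      proof
        fix s assume "s \<in> set_pmf \<mu>"
        then have s: "s \<in> carrier G" using supp by blast
        show "emeasure (iid \<mu>) {X. case_nat s X \<in> V x} = ennreal (h (x \<otimes>\<^bsub>G\<^esub> s))"
          using consV_emeasure[OF x s, of UNIV] sets.top[of "iid \<mu>"] by (simp add: h_def S.emeasure_eq_measure)
      qed
    qed
    also have "\<dots> = ennreal (measure_pmf.expectation \<mu> (\<lambda>s. h (x \<otimes>\<^bsub>G\<^esub> s)))"
      using h01 by (intro nn_integral_eq_integral pmf_integrable_bounded[where B = 1]) auto
    finally show ?thesis using h01 by (simp add: ennreal_inj)
  qed
  then have hc: "h x = h \<one>\<^bsub>G\<^esub>" if "x \<in> carrier G" for x using const[of h] h01 that by blast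
  define c where "c = ennreal (h \<one>\<^bsub>G\<^esub>)"
  have Vc: "emeasure (iid \<mu>) (V x) = c" if "x \<in> carrier G" for x
    using hc[OF that] by (simp add: c_def h_def S.emeasure_eq_measure)
  \<comment> \<open>The start varies in the induction because every increment consumed moves it,
    while the constant \<open>c\<close> stays the same.\<close>
  have cyl: "emeasure (iid \<mu>) {X. X \<in> V x \<and> X \<in> {X. \<forall>i<n. X i \<in> B i}} = (\<Prod>i<n. emeasure (measure_pmf \<mu>) (B i)) * c"
    if "x \<in> carrier G" for n B x
    using that
  proof (induction n arbitrary: x B)
    case 0
    then show ?case using Vc[of x] by simp
  next
    case (Suc n)
    let ?E = "{X. X \<in> V x \<and> X \<in> {X. \<forall>i<Suc n. X i \<in> B i}}"
    let ?p = "(\<Prod>i<n. emeasure (measure_pmf \<mu>) (B (Suc i))) * c"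
    have E: "?E \<in> sets (iid \<mu>)"
      using sets.Int[OF V[of x] cylinder_measurable[where n = "Suc n" and B = B]] by (simp add: Int_def)
    have "emeasure (iid \<mu>) ?E = (\<integral>\<^sup>+ s. emeasure (iid \<mu>) {X. case_nat s X \<in> ?E} \<partial>measure_pmf \<mu>)"
      by (rule emeasure_iid_cons[OF E])
    also have "\<dots> = (\<integral>\<^sup>+ s. ?p * indicator (B 0) s \<partial>measure_pmf \<mu>)"
    proof (rule nn_integral_cong_AE)
      show "AE s in measure_pmf \<mu>. emeasure (iid \<mu>) {X. case_nat s X \<in> ?E} = ?p * indicator (B 0) s"
        unfolding AE_measure_pmf_iff
      proof
        fix s assume "s \<in> set_pmf \<mu>"
        then have s: "s \<in> carrier G" using supp by blast
        show "emeasure (iid \<mu>) {X. case_nat s X \<in> ?E} = ?p * indicator (B 0) s"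
        proof (cases "s \<in> B 0")
          case True
          have "{X. case_nat s X \<in> ?E} = {X. case_nat s X \<in> V x \<and> X \<in> {X. \<forall>i<n. X i \<in> B (Suc i)}}"
            using True by (auto simp: all_conj_distrib less_Suc_eq_0_disj)
          then have "emeasure (iid \<mu>) {X. case_nat s X \<in> ?E} =
              emeasure (iid \<mu>) {X. X \<in> V (x \<otimes>\<^bsub>G\<^esub> s) \<and> X \<in> {X. \<forall>i<n. X i \<in> B (Suc i)}}"
            using consV_emeasure[OF Suc.prems s cylinder_measurable] by simp
          also have "\<dots> = ?p" using Suc.prems s by (intro Suc.IH) auto
          finally show ?thesis using True by simp
        next
          case False
          then have "{X. case_nat s X \<in> ?E} = {}" by auto
          then have "emeasure (iid \<mu>) {X. case_nat s X \<in> ?E} = 0" by (simp only: emeasure_empty)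
          then show ?thesis using False by simp
        qed
      qed
    qed
    also have "\<dots> = ?p * emeasure (measure_pmf \<mu>) (B 0)" by (simp add: nn_integral_cmult_indicator)
    also have "\<dots> = (\<Prod>i<Suc n. emeasure (measure_pmf \<mu>) (B i)) * c"
      by (simp only: prod.lessThan_Suc_shift mult_ac)
    finally show ?case .
  qed
  have "c = 0 \<or> c = 1"
  proof (rule disjCI)
    assume c0: "c \<noteq> 1"
    show "c = 0"
    proof (rule ccontr)
      assume c: "c \<noteq> 0"
      have cV: "emeasure (iid \<mu>) (V \<one>\<^bsub>G\<^esub>) = c" by (rule Vc) simp
      have cf: "c \<noteq> \<infinity>" by (simp add: c_def)
      \<comment> \<open>Conditioning on the event leaves the law of the increments unchanged. Under
        this one law the event has both probability \<open>c\<close> and probability one.\<close>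
      have "uniform_measure (iid \<mu>) (V \<one>\<^bsub>G\<^esub>) = iid \<mu>"
      proof (rule sq.PiM_eq)
        show "sets (uniform_measure (iid \<mu>) (V \<one>\<^bsub>G\<^esub>)) = sets (iid \<mu>)" by simp
        fix J :: "nat set" and F :: "nat \<Rightarrow> 'a set" assume J: "finite J"
        define B where "B i = (if i \<in> J then F i else UNIV)" for i
        define n where "n = Suc (Max (insert 0 J))"
        have Jn: "J \<subseteq> {..<n}" using J by (auto simp: n_def less_Suc_eq_le)
        have emb: "prod_emb UNIV (\<lambda>_. measure_pmf \<mu>) J (Pi\<^sub>E J F) = {X. \<forall>i<n. X i \<in> B i}"
          using Jn by (auto simp: prod_emb_def B_def PiE_iff subset_eq)
        have "emeasure (uniform_measure (iid \<mu>) (V \<one>\<^bsub>G\<^esub>)) {X. \<forall>i<n. X i \<in> B i}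
          = emeasure (iid \<mu>) (V \<one>\<^bsub>G\<^esub> \<inter> {X. \<forall>i<n. X i \<in> B i}) / c"
          by (subst emeasure_uniform_measure[OF V cylinder_measurable]) (simp add: cV)
        also have "V \<one>\<^bsub>G\<^esub> \<inter> {X. \<forall>i<n. X i \<in> B i} = {X. X \<in> V \<one>\<^bsub>G\<^esub> \<and> X \<in> {X. \<forall>i<n. X i \<in> B i}}" by blast
        also have "emeasure (iid \<mu>) \<dots> / c = (\<Prod>i<n. emeasure (measure_pmf \<mu>) (B i))"
          unfolding cyl[OF one_closed] using c cf by (simp add: ennreal_mult_divide_eq)
        also have "\<dots> = (\<Prod>i\<in>J. emeasure (measure_pmf \<mu>) (F i))"
          by (rule prod.mono_neutral_cong_right) (use Jn in \<open>auto simp: B_def\<close>)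
        finally show "emeasure (uniform_measure (iid \<mu>) (V \<one>\<^bsub>G\<^esub>)) (prod_emb UNIV (\<lambda>_. measure_pmf \<mu>) J (Pi\<^sub>E J F)) =
          (\<Prod>j\<in>J. emeasure (measure_pmf \<mu>) (F j))" unfolding emb .
      qed
      then have "c = emeasure (uniform_measure (iid \<mu>) (V \<one>\<^bsub>G\<^esub>)) (V \<one>\<^bsub>G\<^esub>)" using cV by simp
      also have "\<dots> = c / c" by (subst emeasure_uniform_measure[OF V V]) (simp add: cV)
      also have "\<dots> = 1" using ennreal_mult_divide_eq[OF c, of 1] cf by simp
      finally show False using c0 by simp
    qed
  qed
  then show "pb_null G \<mu> A \<or> pb_null G \<mu> (UNIV - A)"
  proof
    assume c: "c = 0"
    have "pb_null G \<mu> A" unfolding pb_null_def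
      using Vc c by (auto simp: emeasure_path_meas[OF A] V_def Z_def)
    then show ?thesis ..
  next
    assume c: "c = 1"
    have UA: "UNIV - A \<in> sets traj_space" using A sets.compl_sets[OF A] by simp
    have "emeasure (iid \<mu>) (UNIV - V x) = 0" if "x \<in> carrier G" for x
      using Vc[OF that] c S.prob_compl[OF V[of x]] by (simp add: S.emeasure_eq_measure)
    moreover have "{X. Z x X \<in> UNIV - A} = UNIV - V x" for x by (auto simp: V_def)
    ultimately have "pb_null G \<mu> (UNIV - A)" unfolding pb_null_def
      by (auto simp: emeasure_path_meas[OF UA] Z_def)
    then show ?thesis ..
  qed
qed

section \<open>Records of the levels\<close>

definition level_pmf :: "nat pmf" where
  "level_pmf = embed_pmf (\<lambda>k. 1 / (real k + 1) - 1 / (real k + 2))"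

lemma inverse_Suc_tendsto: "(\<lambda>k. 1 / (real k + 1)) \<longlonglongrightarrow> 0"
  using LIMSEQ_Suc[OF lim_1_over_n] by (simp add: add.commute)

lemma pmf_level: "pmf level_pmf k = 1 / (real k + 1) - 1 / (real k + 2)"
  unfolding level_pmf_def
proof (rule pmf_embed_pmf)
  show nonneg: "0 \<le> 1 / (real x + 1) - 1 / (real x + 2)" for x by (simp add: field_simps)
  have "(\<lambda>k. 1 / (real k + 1) - 1 / (real (Suc k) + 1)) sums (1 / (real 0 + 1) - 0)"
    by (rule telescope_sums'[OF inverse_Suc_tendsto])
  then have "(\<lambda>k. 1 / (real k + 1) - 1 / (real k + 2)) sums 1" by (simp add: add.commute)
  then have "(\<Sum>k. ennreal (1 / (real k + 1) - 1 / (real k + 2))) = 1"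
    using suminf_ennreal_eq[OF nonneg] by simp
  then show "(\<integral>\<^sup>+ k. ennreal (1 / (real k + 1) - 1 / (real k + 2)) \<partial>count_space UNIV) = 1"
    by (simp add: nn_integral_count_space_nat)
qed

lemma prob_level_less: "measure_pmf.prob level_pmf {..<k} = 1 - 1 / (real k + 1)"
proof -
  have "measure_pmf.prob level_pmf {..<k} = (\<Sum>j<k. pmf level_pmf j)"
    by (rule measure_measure_pmf_finite) simp
  also have "\<dots> = 1 - 1 / (real k + 1)"
    by (induction k) (auto simp: pmf_level add.commute)
  finally show ?thesis .
qed

lemma prob_level_atMost: "measure_pmf.prob level_pmf {..k} = 1 - 1 / (real k + 2)"
  using prob_level_less[of "Suc k"] by (simp add: lessThan_Suc_atMost add.commute)

text \<open>With \<open>u = 1 / (k + 1)\<close> this is \<open>1 - u \<le> exp (- u)\<close> raised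
  to the power \<open>1 / u^2\<close>. The square in the exponent is what makes the bound summable
  in \<open>k\<close>.\<close>

lemma prob_level_power_le: "measure_pmf.prob level_pmf {..<k} ^ (k + 1)\<^sup>2 \<le> exp (- 1) ^ k"
proof -
  have p: "0 \<le> measure_pmf.prob level_pmf {..<k}" by simp
  have "measure_pmf.prob level_pmf {..<k} \<le> exp (- (1 / (real k + 1)))"
    using exp_ge_add_one_self[of "- (1 / (real k + 1))"] by (simp add: prob_level_less)
  then have "measure_pmf.prob level_pmf {..<k} ^ (k + 1)\<^sup>2 \<le> exp (- (1 / (real k + 1))) ^ (k + 1)\<^sup>2"
    using p by (intro power_mono)
  also have "\<dots> = exp (- (real k + 1))"
  proof -
    have "real ((k + 1)\<^sup>2) * (- (1 / (real k + 1))) = - (real k + 1)"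
      by (simp add: power2_eq_square divide_simps) (simp add: algebra_simps)
    then show ?thesis unfolding exp_of_nat_mult[symmetric] by simp
  qed
  also have "\<dots> \<le> exp (- real k)" by simp
  also have "\<dots> = exp (- 1) ^ k" by (simp add: exp_of_nat_mult[symmetric])
  finally show ?thesis .
qed

lemma prob_level_decay: "(\<lambda>k. measure_pmf.prob level_pmf {..<k} ^ (k + 2)\<^sup>2) \<longlonglongrightarrow> 0"
proof (rule tendsto_sandwich[OF _ _ tendsto_const LIMSEQ_power_zero[of "exp (- 1 :: real)"]])
  show "\<forall>\<^sub>F k in sequentially. measure_pmf.prob level_pmf {..<k} ^ (k + 2)\<^sup>2 \<le> exp (- 1) ^ k"
  proof (intro always_eventually allI)
    fix k
    have "measure_pmf.prob level_pmf {..<k} ^ (k + 2)\<^sup>2 \<le> measure_pmf.prob level_pmf {..<k} ^ (k + 1)\<^sup>2"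
      by (intro power_decreasing power_mono) auto
    then show "measure_pmf.prob level_pmf {..<k} ^ (k + 2)\<^sup>2 \<le> exp (- 1) ^ k"
      using prob_level_power_le[of k] by linarith
  qed
qed auto

text \<open>The level is kept next to the increment, as one group element may arise at several
  levels. Records live on this larger space; the actual step law is the image under
  \<open>snd\<close>.\<close>

definition levelled :: "(nat \<Rightarrow> 'a pmf) \<Rightarrow> (nat \<times> 'a) pmf" where
  "levelled \<nu> = bind_pmf level_pmf (\<lambda>k. map_pmf (Pair k) (\<nu> k))"

lemma map_fst_levelled: "map_pmf fst (levelled \<nu>) = level_pmf"
  by (simp add: levelled_def map_bind_pmf pmf.map_comp o_def bind_return_pmf')

lemma set_pmf_level: "set_pmf level_pmf = UNIV"
proof -
  have "0 < pmf level_pmf k" for k by (simp add: pmf_level frac_less2)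
  then show ?thesis by (auto simp: set_pmf_eq less_le)
qed

lemma set_levelled: "(k, s) \<in> set_pmf (levelled \<nu>) \<longleftrightarrow> s \<in> set_pmf (\<nu> k)"
  by (auto simp: levelled_def set_pmf_level)

lemma prob_levelled_level: "measure_pmf.prob (levelled \<nu>) {y. fst y \<in> L} = measure_pmf.prob level_pmf L"
  unfolding map_fst_levelled[of \<nu>, symmetric] by (simp add: vimage_def)

lemma prob_levelled_pair:
  "measure_pmf.prob (levelled \<nu>) {y. fst y = k \<and> snd y \<in> B} = pmf level_pmf k * measure_pmf.prob (\<nu> k) B"
proof -
  have i: "\<bar>indicator A y :: real\<bar> \<le> 1" for A and y :: "nat \<times> 'a" by (simp add: indicator_def)
  have "measure_pmf.prob (levelled \<nu>) {y. fst y = k \<and> snd y \<in> B} =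
      measure_pmf.expectation (levelled \<nu>) (indicator {y. fst y = k \<and> snd y \<in> B})" by simp
  also have "\<dots> = measure_pmf.expectation level_pmf (\<lambda>j. measure_pmf.expectation (\<nu> j)
      (\<lambda>s. indicator {y. fst y = k \<and> snd y \<in> B} (j, s)))"
    unfolding levelled_def by (subst pmf_expectation_bind_bounded[where B = 1, OF i]) (simp only: integral_map_pmf)
  also have "\<dots> = measure_pmf.expectation level_pmf (\<lambda>j. indicator {k} j * measure_pmf.prob (\<nu> k) B)"
  proof (intro Bochner_Integration.integral_cong refl)
    fix j
    have "(\<lambda>s. indicator {y. fst y = k \<and> snd y \<in> B} (j, s) :: real) = (\<lambda>s. indicator {k} j * indicator B s)"
      by (auto simp: indicator_def fun_eq_iff)
    then show "measure_pmf.expectation (\<nu> j) (\<lambda>s. indicator {y. fst y = k \<and> snd y \<in> B} (j, s)) =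
        indicator {k} j * measure_pmf.prob (\<nu> k) B" by (cases "j = k") simp_all
  qed
  also have "\<dots> = pmf level_pmf k * measure_pmf.prob (\<nu> k) B" by (simp add: measure_pmf_single)
  finally show ?thesis .
qed

lemma measure_cylinder:
  "measure (iid \<kappa>) {Y. \<forall>l<n. Y l \<in> B l} = (\<Prod>l<n. measure_pmf.prob \<kappa> (B l))"
proof -
  interpret sequence_space "measure_pmf \<kappa>" by (rule sequence_space_pmf)
  have "emeasure (iid \<kappa>) {Y \<in> space (iid \<kappa>). \<forall>l\<in>{..<n}. Y l \<in> B l} = (\<Prod>l<n. emeasure (measure_pmf \<kappa>) (B l))"
    by (rule emeasure_PiM_Collect) auto
  then have "emeasure (iid \<kappa>) {Y. \<forall>l<n. Y l \<in> B l} = ennreal (\<Prod>l<n. measure_pmf.prob \<kappa> (B l))"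
    by (simp add: Ball_def measure_pmf.emeasure_eq_measure prod_ennreal)
  then show ?thesis by (simp add: measure_def prod_nonneg)
qed

text \<open>The two kinds of bad records are written as countable unions of cylinders, so that their
  probabilities are bounded by the sum over the times of the record.\<close>

definition tie :: "nat \<Rightarrow> (nat \<Rightarrow> nat \<times> 'a) set" where
  "tie k = (\<Union>n. \<Union>i\<in>{..<Suc n}. {Y. \<forall>l<Suc (Suc n). Y l \<in> {y. fst y \<in> (if l = i \<or> l = Suc n then {k} else {..k})}})"

definition bad_record :: "(nat \<Rightarrow> 'a set) \<Rightarrow> nat \<Rightarrow> (nat \<Rightarrow> nat \<times> 'a) set" where
  "bad_record S k = (\<Union>n. {Y. \<forall>l<Suc n. Y l \<in> (if l = n then {y. fst y = k \<and> snd y \<in> - S k} else {y. fst y \<in> {..k}})})"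

definition late :: "nat \<Rightarrow> (nat \<Rightarrow> nat \<times> 'a) set" where
  "late k = {Y. \<forall>l<(k + 1)\<^sup>2. Y l \<in> {y. fst y \<in> {..<k}}}"

lemma measure_UN_le_sums:
  fixes A :: "nat \<Rightarrow> 'x set"
  assumes "prob_space M" "\<And>n. A n \<in> sets M" "\<And>n. measure M (A n) \<le> b n" "b sums s"
  shows "measure M (\<Union>n. A n) \<le> s"
proof -
  interpret prob_space M by fact
  have sm: "summable (\<lambda>n. measure M (A n))"
    by (rule summable_comparison_test'[OF sums_summable[OF assms(4)], of 0]) (simp add: assms(3))
  have "measure M (\<Union>n. A n) \<le> (\<Sum>n. measure M (A n))"
    using assms(2) sm by (intro finite_measure_subadditive_countably) auto
  also have "\<dots> \<le> (\<Sum>n. b n)" using assms(3,4) sm by (intro suminf_le sums_summable) auto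
  finally show ?thesis using assms(4) by (simp add: sums_iff)
qed

lemma level_tail_norm: "norm (1 - 1 / (real k + 2)) < 1"
  by (simp add: field_simps)

text \<open>If the later of the two times is \<open>n + 1\<close>, there are \<open>n + 1\<close>
  choices for the earlier one, and the remaining \<open>n\<close> levels contribute
  \<open>c ^ n\<close> with \<open>1 - c = 1 / (k + 2)\<close>. Summing over \<open>n\<close> gives
  \<open>(p / (1 - c))\<^sup>2\<close>.\<close>

lemma measure_tie: "measure (iid (levelled \<nu>)) (tie k) \<le> 1 / (real k + 1)\<^sup>2"
proof -
  interpret prob_space "iid (levelled \<nu>)" by (rule prob_space_iid)
  let ?p = "pmf level_pmf k" and ?c = "1 - 1 / (real k + 2)"
  define C where "C n i = {Y :: nat \<Rightarrow> nat \<times> 'a. \<forall>l<Suc (Suc n). Y l \<in> {y. fst y \<in> (if l = i \<or> l = Suc n then {k} else {..k})}}" for n i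
  have Cm: "C n i \<in> sets (iid (levelled \<nu>))" for n i unfolding C_def by (rule cylinder_measurable)
  have C: "measure (iid (levelled \<nu>)) (C n i) = ?p\<^sup>2 * ?c ^ n" if i: "i < Suc n" for n i
  proof -
    have "measure (iid (levelled \<nu>)) (C n i) = (\<Prod>l<Suc (Suc n). if l \<in> {i, Suc n} then ?p else ?c)"
      unfolding C_def measure_cylinder prob_levelled_level
      by (intro prod.cong) (auto simp: prob_level_atMost measure_pmf_single)
    also have "\<dots> = ?p ^ card ({..<Suc (Suc n)} \<inter> {i, Suc n}) * ?c ^ card ({..<Suc (Suc n)} - {i, Suc n})"
      by (subst prod.If_cases) (simp, simp only: prod_constant Collect_mem_eq Diff_eq)
    also have "{..<Suc (Suc n)} \<inter> {i, Suc n} = {i, Suc n}" using i by auto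
    also have "card ({..<Suc (Suc n)} - {i, Suc n}) = n"
      using i by (subst card_Diff_subset) auto
    also have "card {i, Suc n} = 2" using i by auto
    finally show ?thesis .
  qed
  have "measure (iid (levelled \<nu>)) (\<Union>n. \<Union>i\<in>{..<Suc n}. C n i) \<le> ?p\<^sup>2 * (1 / (1 - ?c)\<^sup>2)"
  proof (rule measure_UN_le_sums[OF prob_space_axioms])
    show "(\<Union>i\<in>{..<Suc n}. C n i) \<in> sets (iid (levelled \<nu>))" for n
      using Cm by (intro sets.finite_UN) auto
    show "measure (iid (levelled \<nu>)) (\<Union>i\<in>{..<Suc n}. C n i) \<le> ?p\<^sup>2 * (of_nat (Suc n) * ?c ^ n)" for n
    proof -
      have "measure (iid (levelled \<nu>)) (\<Union>i\<in>{..<Suc n}. C n i) \<le> (\<Sum>i<Suc n. measure (iid (levelled \<nu>)) (C n i))"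
        using Cm by (intro finite_measure_subadditive_finite) auto
      also have "\<dots> = (\<Sum>i<Suc n. ?p\<^sup>2 * ?c ^ n)" by (intro sum.cong) (auto simp: C)
      finally show ?thesis by (simp add: mult_ac)
    qed
    show "(\<lambda>n. ?p\<^sup>2 * (of_nat (Suc n) * ?c ^ n)) sums (?p\<^sup>2 * (1 / (1 - ?c)\<^sup>2))"
      by (intro sums_mult geometric_deriv_sums level_tail_norm)
  qed
  also have "?p\<^sup>2 * (1 / (1 - ?c)\<^sup>2) = (?p / (1 - ?c))\<^sup>2" by (simp only: power_divide times_divide_eq_right mult_1_right)
  also have "?p / (1 - ?c) = 1 / (real k + 1)" by (simp add: pmf_level divide_simps)
  finally show ?thesis by (simp add: tie_def C_def power_divide)
qed

text \<open>The sum over the time of the record contributes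
  \<open>p / (1 - c) = 1 / (k + 1)\<close>, and the assumed bound on leaving \<open>S k\<close>
  contributes the same factor once more.\<close>

lemma measure_bad_record:
  assumes "measure_pmf.prob (\<nu> k) (- S k) \<le> 1 / (real k + 1)"
  shows "measure (iid (levelled \<nu>)) (bad_record S k) \<le> 1 / (real k + 1)\<^sup>2"
proof -
  let ?p = "pmf level_pmf k" and ?c = "1 - 1 / (real k + 2)"
  define C where "C n = {Y :: nat \<Rightarrow> nat \<times> 'a. \<forall>l<Suc n. Y l \<in> (if l = n then {y. fst y = k \<and> snd y \<in> - S k} else {y. fst y \<in> {..k}})}" for n
  have "measure (iid (levelled \<nu>)) (\<Union>n. C n) \<le> ?p * (1 / (real k + 1)) * (1 / (1 - ?c))"
  proof (rule measure_UN_le_sums[OF prob_space_iid])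
    show "C n \<in> sets (iid (levelled \<nu>))" for n unfolding C_def by (rule cylinder_measurable)
    show "measure (iid (levelled \<nu>)) (C n) \<le> ?p * (1 / (real k + 1)) * ?c ^ n" for n
    proof -
      have 1: "measure_pmf.prob (levelled \<nu>) (if l = n then {y. fst y = k \<and> snd y \<in> - S k} else {y. fst y \<in> {..k}}) = ?c"
        if "l \<in> {..<n}" for l
        using that by (subst if_not_P) (simp, simp only: prob_levelled_level prob_level_atMost)
      have 2: "measure_pmf.prob (levelled \<nu>) (if n = n then {y. fst y = k \<and> snd y \<in> - S k} else {y. fst y \<in> {..k}})
          = ?p * measure_pmf.prob (\<nu> k) (- S k)"
        by (subst if_P[OF refl]) (rule prob_levelled_pair)
      have "measure (iid (levelled \<nu>)) (C n) = (\<Prod>l<n. ?c) * (?p * measure_pmf.prob (\<nu> k) (- S k))"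
        unfolding C_def measure_cylinder prod.lessThan_Suc by (intro arg_cong2[where f = "(*)"] prod.cong refl 1 2)
      also have "\<dots> \<le> (\<Prod>l<n. ?c) * (?p * (1 / (real k + 1)))"
        using assms by (intro mult_left_mono prod_nonneg) (auto simp: field_simps)
      finally show ?thesis by (simp add: mult_ac)
    qed
    show "(\<lambda>n. ?p * (1 / (real k + 1)) * ?c ^ n) sums (?p * (1 / (real k + 1)) * (1 / (1 - ?c)))"
      by (intro sums_mult geometric_sums level_tail_norm)
  qed
  also have "?p * (1 / (real k + 1)) * (1 / (1 - ?c)) = 1 / (real k + 1)\<^sup>2"
    by (simp add: pmf_level divide_simps power2_eq_square)
  finally show ?thesis by (simp add: bad_record_def C_def)
qed

lemma measure_late: "measure (iid (levelled \<nu>)) (late k) \<le> exp (- 1) ^ k"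
  unfolding late_def measure_cylinder prob_levelled_level
  using prob_level_power_le[of k] by (simp only: prod_constant card_lessThan)

lemma summable_inverse_Suc_squares: "summable (\<lambda>k. 1 / (real k + 1)\<^sup>2)"
proof -
  have "summable (\<lambda>k. inverse (real (Suc k) ^ 2))"
    by (subst summable_Suc_iff) (rule inverse_power_summable, simp)
  moreover have "inverse (real (Suc k) ^ 2) = 1 / (real k + 1)\<^sup>2" for k
    by (simp add: inverse_eq_divide add.commute)
  ultimately show ?thesis by simp
qed

lemma AE_levelled:
  assumes "\<And>k. measure_pmf.prob (\<nu> k) (- S k) \<le> 1 / (real k + 1)"
  shows "AE Y in iid (levelled \<nu>). \<exists>k0. \<forall>k\<ge>k0. Y \<notin> tie k \<and> Y \<notin> bad_record S k \<and> Y \<notin> late k"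
proof -
  interpret prob_space "iid (levelled \<nu>)" by (rule prob_space_iid)
  have bc: "AE Y in iid (levelled \<nu>). \<exists>k0. \<forall>k\<ge>k0. Y \<notin> A k"
    if "\<And>k. A k \<in> sets (iid (levelled \<nu>))" "\<And>k. measure (iid (levelled \<nu>)) (A k) \<le> b k" "summable b"
    for A :: "nat \<Rightarrow> (nat \<Rightarrow> nat \<times> 'a) set" and b :: "nat \<Rightarrow> real"
  proof -
    have "AE Y in iid (levelled \<nu>). eventually (\<lambda>k. Y \<in> space (iid (levelled \<nu>)) - A k) sequentially"
    proof (rule borel_cantelli_AE1[OF that(1)])
      show "emeasure (iid (levelled \<nu>)) (A n) < \<infinity>" for n by (simp add: emeasure_eq_measure)
      show "summable (\<lambda>n. measure (iid (levelled \<nu>)) (A n))"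
        by (rule summable_comparison_test'[OF that(3), of 0]) (simp add: that(2))
    qed
    then show ?thesis by (simp add: eventually_sequentially)
  qed
  have m1: "tie k \<in> sets (iid (levelled \<nu>))" for k
    unfolding tie_def
    by (rule sets.countable_UN''[OF countableI_type], rule sets.finite_UN[OF finite_lessThan], rule cylinder_measurable)
  have m2: "bad_record S k \<in> sets (iid (levelled \<nu>))" for k
    unfolding bad_record_def by (rule sets.countable_UN''[OF countableI_type], rule cylinder_measurable)
  have m3: "late k \<in> sets (iid (levelled \<nu>))" for k
    unfolding late_def by (rule cylinder_measurable)
  have "AE Y in iid (levelled \<nu>). \<exists>k0. \<forall>k\<ge>k0. Y \<notin> tie k"
    by (rule bc[OF m1 measure_tie summable_inverse_Suc_squares])
  moreover have "AE Y in iid (levelled \<nu>). \<exists>k0. \<forall>k\<ge>k0. Y \<notin> bad_record S k"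
    by (rule bc[OF m2 measure_bad_record[OF assms] summable_inverse_Suc_squares])
  moreover have "AE Y in iid (levelled \<nu>). \<exists>k0. \<forall>k\<ge>k0. Y \<notin> late k"
    by (rule bc[OF m3 measure_late]) (simp add: summable_geometric)
  ultimately show ?thesis
  proof eventually_elim
    case (elim Y)
    then obtain a b c where "\<forall>k\<ge>a. Y \<notin> tie k" "\<forall>k\<ge>b. Y \<notin> bad_record S k" "\<forall>k\<ge>c. Y \<notin> late k" by blast
    then show ?case by (intro exI[of _ "a + b + c"]) auto
  qed
qed

text \<open>Used to push almost sure statements about levelled increments forward to the increments
  themselves.\<close>

lemma iid_map: "distr (iid \<kappa>) (iid (map_pmf f \<kappa>)) (\<lambda>Y i. f (Y i)) = iid (map_pmf f \<kappa>)"
proof -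
  interpret A: sequence_space "measure_pmf \<kappa>" by (rule sequence_space_pmf)
  interpret B: sequence_space "measure_pmf (map_pmf f \<kappa>)" by (rule sequence_space_pmf)
  have m: "(\<lambda>Y i. f (Y i)) \<in> iid \<kappa> \<rightarrow>\<^sub>M iid (map_pmf f \<kappa>)"
  proof (rule measurable_abs_UNIV)
    show "(\<lambda>Y. f (Y n)) \<in> iid \<kappa> \<rightarrow>\<^sub>M measure_pmf (map_pmf f \<kappa>)" for n
      by (rule measurable_compose[OF coordinate_measurable]) simp
  qed
  show ?thesis
  proof (rule B.PiM_eq)
    fix J :: "nat set" and F assume J: "finite J"
    have F: "prod_emb UNIV (\<lambda>_. measure_pmf (map_pmf f \<kappa>)) J (Pi\<^sub>E J F) = {X \<in> space (iid (map_pmf f \<kappa>)). \<forall>i\<in>J. X i \<in> F i}"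
      by (auto simp: prod_emb_def PiE_iff)
    have Fm: "{X \<in> space (iid (map_pmf f \<kappa>)). \<forall>i\<in>J. X i \<in> F i} \<in> sets (iid (map_pmf f \<kappa>))"
      unfolding F[symmetric] using J by (intro sets_PiM_I) auto
    have "emeasure (distr (iid \<kappa>) (iid (map_pmf f \<kappa>)) (\<lambda>Y i. f (Y i))) {X \<in> space (iid (map_pmf f \<kappa>)). \<forall>i\<in>J. X i \<in> F i} =
       emeasure (iid \<kappa>) {Y \<in> space (iid \<kappa>). \<forall>i\<in>J. Y i \<in> f -` F i}"
      using emeasure_distr[OF m Fm] by (simp add: vimage_def)
    also have "\<dots> = (\<Prod>i\<in>J. emeasure (measure_pmf \<kappa>) (f -` F i))"
      using J by (intro A.emeasure_PiM_Collect) auto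
    finally show "emeasure (distr (iid \<kappa>) (iid (map_pmf f \<kappa>)) (\<lambda>Y i. f (Y i))) (prod_emb UNIV (\<lambda>_. measure_pmf (map_pmf f \<kappa>)) J (Pi\<^sub>E J F)) =
       (\<Prod>i\<in>J. emeasure (measure_pmf (map_pmf f \<kappa>)) (F i))"
      unfolding F by simp
  qed simp
qed

section \<open>Reading off the past from the last record\<close>

text \<open>The factors are \<open>X a\<close> to \<open>X (a + n - 1)\<close>. Unlike
  \<open>rw_prod G X n\<close>, which has \<open>n + 1\<close> factors, it can be empty, as is the
  stretch before a record at time zero.\<close>

primrec segment :: "('a, 'm) monoid_scheme \<Rightarrow> (nat \<Rightarrow> 'a) \<Rightarrow> nat \<Rightarrow> nat \<Rightarrow> 'a" where
  "segment G X a 0 = \<one>\<^bsub>G\<^esub>"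
| "segment G X a (Suc n) = segment G X a n \<otimes>\<^bsub>G\<^esub> X (a + n)"

context group
begin

lemma segment_closed: "(\<And>i. X i \<in> carrier G) \<Longrightarrow> segment G X a n \<in> carrier G"
  by (induction n) auto

lemma segment_add:
  "(\<And>i. X i \<in> carrier G) \<Longrightarrow> segment G X a (m + n) = segment G X a m \<otimes> segment G X (a + m) n"
  by (induction n) (auto simp: segment_closed m_assoc add.assoc)

lemma rw_prod_segment: "(\<And>i. X i \<in> carrier G) \<Longrightarrow> rw_prod G X n = segment G X 0 (Suc n)"
  by (induction n) auto

lemma segment_words: "(\<And>i. i < n \<Longrightarrow> X (a + i) \<in> B) \<Longrightarrow> segment G X a n \<in> words G n B"
  by (induction n) auto

end

lemma traj_act_sets:
  fixes G :: "('a::countable, 'm) monoid_scheme"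
  assumes "A \<in> sets traj_space"
  shows "traj_act G g A \<in> sets traj_space"
proof -
  have "(\<lambda>\<omega>. inv\<^bsub>G\<^esub> g \<otimes>\<^bsub>G\<^esub> \<omega> n) \<in> traj_space \<rightarrow>\<^sub>M count_space UNIV" for n
    by (rule measurable_compose[OF traj_coordinate_measurable]) simp
  then have "(\<lambda>\<omega> n. inv\<^bsub>G\<^esub> g \<otimes>\<^bsub>G\<^esub> \<omega> n) \<in> traj_space \<rightarrow>\<^sub>M traj_space"
    unfolding traj_space_def[where ?'a = 'a] by (intro measurable_abs_UNIV)
  from measurable_sets[OF this assms] show ?thesis by (simp add: traj_act_def)
qed

text \<open>The product structure is forgotten here: \<open>decode\<close> and \<open>fresh\<close>
  come from the law of one level, \<open>later\<close> and \<open>absorb\<close> from the growth of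
  \<open>M\<close>. The number \<open>(k + 2)\<^sup>2\<close> in \<open>absorb\<close> is the
  deadline for level \<open>k + 1\<close>, hence bounds the time during which \<open>k\<close> is
  the maximal level.\<close>

locale levelled_walk = group G for G :: "('a::countable, 'm) monoid_scheme" (structure) +
  fixes \<nu> :: "nat \<Rightarrow> 'a pmf" and S M :: "nat \<Rightarrow> 'a set"
  assumes supp: "set_pmf (\<nu> k) \<subseteq> carrier G"
    and junk: "measure_pmf.prob (\<nu> k) (- S k) \<le> 1 / (real k + 1)"
    and decode: "m \<in> M k \<Longrightarrow> n \<in> M k \<Longrightarrow> m' \<in> M k \<Longrightarrow> n' \<in> M k \<Longrightarrow> s \<in> S k \<Longrightarrow> s' \<in> S k \<Longrightarrow>
      m \<otimes> s \<otimes> n = m' \<otimes> s' \<otimes> n' \<Longrightarrow> m = m'"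
    and fresh: "m \<in> M k \<Longrightarrow> n \<in> M k \<Longrightarrow> s \<in> S k \<Longrightarrow> m \<otimes> s \<otimes> n \<notin> M k"
    and later: "k < j \<Longrightarrow> m \<in> M k \<Longrightarrow> n \<in> M k \<Longrightarrow> s \<in> S k \<Longrightarrow> m \<otimes> s \<otimes> n \<in> M j"
    and absorb: "x \<in> carrier G \<Longrightarrow> \<exists>k0. \<forall>k\<ge>k0. \<forall>n\<le>(k + 2)\<^sup>2. \<forall>w\<in>words G n (\<Union>j<k. set_pmf (\<nu> j)). x \<otimes> w \<in> M k"
begin

text \<open>\<open>v\<close> is meant as the position before the record of level \<open>k\<close>,
  \<open>s\<close> as the record increment and \<open>h\<close> as the displacement since
  then.\<close>

definition decoded :: "nat \<Rightarrow> 'a \<Rightarrow> 'a \<Rightarrow> bool" where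
  "decoded k v w \<longleftrightarrow> v \<in> M k \<and> (\<exists>s\<in>S k. \<exists>h\<in>M k. w = v \<otimes> s \<otimes> h)"

text \<open>If the levels differed, \<open>later\<close> would put \<open>w\<close> into the
  \<open>M\<close> of the higher level, which \<open>fresh\<close> forbids. For equal levels
  \<open>decode\<close> applies.\<close>

lemma decoded_unique:
  assumes "decoded k v w" "decoded j u w"
  shows "k = j \<and> v = u"
proof -
  obtain s h where 1: "v \<in> M k" "s \<in> S k" "h \<in> M k" "w = v \<otimes> s \<otimes> h"
    using assms(1) by (auto simp: decoded_def)
  obtain s' h' where 2: "u \<in> M j" "s' \<in> S j" "h' \<in> M j" "w = u \<otimes> s' \<otimes> h'"
    using assms(2) by (auto simp: decoded_def)
  have "\<not> k < j" using later[of k j v h s] fresh[of u j h' s'] 1 2 by auto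
  moreover have "\<not> j < k" using later[of j k u h' s'] fresh[of v k h s] 1 2 by auto
  ultimately have "k = j" by simp
  then show ?thesis using decode[of v k h u h' s s'] 1 2 by auto
qed

text \<open>Unwinding the records: the position before the last record is decoded from
  \<open>w\<close>, the position before the preceding record from that one, and so on until level
  \<open>k\<close> is met.\<close>

inductive record_prefix :: "nat \<Rightarrow> 'a \<Rightarrow> 'a \<Rightarrow> bool" for k z where
  last: "decoded k z w \<Longrightarrow> record_prefix k z w"
| earlier: "decoded j v w \<Longrightarrow> j \<noteq> k \<Longrightarrow> record_prefix k z v \<Longrightarrow> record_prefix k z w"

lemma record_prefix_unique:
  assumes "record_prefix k z w" "record_prefix k z' w"
  shows "z = z'"
  using assms
proof (induction arbitrary: z' rule: record_prefix.induct)
  case (last w)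
  from last(2) show ?case
    by (cases rule: record_prefix.cases) (use last(1) decoded_unique in blast)+
next
  case (earlier j v w)
  from earlier.prems show ?case
  proof (cases rule: record_prefix.cases)
    case last
    then show ?thesis using earlier.hyps decoded_unique by blast
  next
    case (earlier j' v')
    then have "v' = v" using \<open>decoded j v w\<close> decoded_unique by blast
    then show ?thesis using earlier \<open>\<And>z'. record_prefix k z' v \<Longrightarrow> z = z'\<close> by blast
  qed
qed

text \<open>All late positions must decode to the same \<open>z\<close>; this makes the event
  invariant under the shift, so that \<open>z\<close> is a function of the boundary point.\<close>

definition has_prefix :: "nat \<Rightarrow> 'a \<Rightarrow> (nat \<Rightarrow> 'a) set" where
  "has_prefix k z = {\<omega>. \<exists>n0. \<forall>n\<ge>n0. record_prefix k z (\<omega> n)}"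

lemma has_prefix_sets: "has_prefix k z \<in> sets traj_space"
proof -
  have "{\<omega>. record_prefix k z (\<omega> n)} \<in> sets traj_space" for n
    using measurable_sets[OF traj_coordinate_measurable[of n], of "{w. record_prefix k z w}"]
    by (simp add: vimage_def)
  then have "(\<Union>n0. \<Inter>n. if n0 \<le> n then {\<omega>. record_prefix k z (\<omega> n)} else space traj_space) \<in> sets traj_space"
    using sets.top[of traj_space] by (intro sets.countable_UN'' sets.countable_INT'') auto
  moreover have "(\<Union>n0. \<Inter>n. if n0 \<le> n then {\<omega>. record_prefix k z (\<omega> n)} else space traj_space) = has_prefix k z"
    by (auto simp: has_prefix_def split: if_splits)
  ultimately show ?thesis by simp
qed

lemma has_prefix_inv: "has_prefix k z \<in> shift_inv_sets"
proof -
  have "(\<lambda>\<omega>. \<omega> \<circ> Suc) -` has_prefix k z = has_prefix k z"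
  proof (intro Set.set_eqI iffI)
    fix \<omega> assume "\<omega> \<in> (\<lambda>\<omega>. \<omega> \<circ> Suc) -` has_prefix k z"
    then obtain n0 where n0: "\<And>n. n \<ge> n0 \<Longrightarrow> record_prefix k z (\<omega> (Suc n))" by (auto simp: has_prefix_def)
    have "record_prefix k z (\<omega> n)" if "n \<ge> Suc n0" for n using n0[of "n - 1"] that by simp
    then show "\<omega> \<in> has_prefix k z" by (auto simp: has_prefix_def)
  next
    fix \<omega> assume "\<omega> \<in> has_prefix k z"
    then obtain n0 where "\<And>n. n \<ge> n0 \<Longrightarrow> record_prefix k z (\<omega> n)" by (auto simp: has_prefix_def)
    then show "\<omega> \<in> (\<lambda>\<omega>. \<omega> \<circ> Suc) -` has_prefix k z"
      by (auto simp: has_prefix_def intro!: exI[of _ n0])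
  qed
  then show ?thesis using has_prefix_sets by (simp add: shift_inv_sets_def)
qed

lemma has_prefix_disjoint: "\<omega> \<in> has_prefix k z \<Longrightarrow> \<omega> \<in> has_prefix k z' \<Longrightarrow> z = z'"
  unfolding has_prefix_def mem_Collect_eq
  by (elim exE) (metis max.cobounded1 max.cobounded2 record_prefix_unique)

text \<open>Induction on the time \<open>n\<close>. The last record up to \<open>n\<close> is at the
  time \<open>t'\<close> of the maximal level, and decoding it returns the position at time
  \<open>t' - 1\<close>. That is the end of a shorter walk, which still contains the record at
  \<open>t\<close> unless \<open>t = t'\<close>.\<close>

lemma record_prefix_of_record:
  assumes Y: "\<forall>k\<ge>k0. Y \<notin> tie k \<and> Y \<notin> bad_record S k \<and> Y \<notin> late k"
    and Yc: "\<And>i. snd (Y i) \<in> set_pmf (\<nu> (fst (Y i)))"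
    and x: "x \<in> carrier G"
  shows "\<exists>k1. \<forall>n t. t \<le> n \<longrightarrow> (\<forall>l<t. fst (Y l) < fst (Y t)) \<longrightarrow> k1 \<le> fst (Y t) \<longrightarrow>
    record_prefix (fst (Y t)) (x \<otimes> segment G (\<lambda>i. snd (Y i)) 0 t) (x \<otimes> rw_prod G (\<lambda>i. snd (Y i)) n)"
proof -
  define K where "K i = fst (Y i)" for i
  define X where "X i = snd (Y i)" for i
  have Xc: "X i \<in> carrier G" for i using Yc supp by (auto simp: X_def)
  note seg_cl = segment_closed[of X, OF Xc]
  obtain a where a: "\<And>k n w. a \<le> k \<Longrightarrow> n \<le> (k + 2)\<^sup>2 \<Longrightarrow> w \<in> words G n (\<Union>j<k. set_pmf (\<nu> j)) \<Longrightarrow> x \<otimes> w \<in> M k"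
    using absorb[OF x] by blast
  obtain b where b: "\<And>k n w. b \<le> k \<Longrightarrow> n \<le> (k + 2)\<^sup>2 \<Longrightarrow> w \<in> words G n (\<Union>j<k. set_pmf (\<nu> j)) \<Longrightarrow> \<one> \<otimes> w \<in> M k"
    using absorb[OF one_closed] by blast
  \<comment> \<open>\<open>k0\<close> rules out the three failures, \<open>a\<close> places the walk
    from \<open>x\<close> before a record into \<open>M k\<close>, and \<open>b\<close> does so for
    the displacement after it, a walk from \<open>\<one>\<close>.\<close>
  define k1 where "k1 = k0 + a + b"
  have "record_prefix (K t) (x \<otimes> segment G X 0 t) (x \<otimes> rw_prod G X n)"
    if "t \<le> n" "\<forall>l<t. K l < K t" "k1 \<le> K t" for n t
    using that
  proof (induction n rule: less_induct)
    case (less n)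
    define k where "k = Max (K ` {..n})"
    have kmax: "K l \<le> k" if "l \<le> n" for l using that by (auto simp: k_def)
    have "k \<in> K ` {..n}" unfolding k_def by (intro Max_in) auto
    then obtain t0 where t0: "t0 \<le> n" "K t0 = k" by auto
    \<comment> \<open>The first time of the maximal level. Without ties it is the only one, so all
      other steps up to \<open>n\<close> have lower level.\<close>
    define t' where "t' = (LEAST l. K l = k)"
    have t': "K t' = k" "t' \<le> n" using LeastI[of "\<lambda>l. K l = k" t0] Least_le[of "\<lambda>l. K l = k" t0] t0 by (auto simp: t'_def)
    have first: "K l \<noteq> k" if "l < t'" for l using not_less_Least[of l "\<lambda>l. K l = k"] that by (auto simp: t'_def)
    have kk: "k1 \<le> k" using kmax[OF less.prems(1)] less.prems(3) by simp
    have uniq: "K l \<noteq> k" if "l \<le> n" "l \<noteq> t'" for l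
    proof
      assume Kl: "K l = k"
      then have "t' < l" using first[of l] that by (metis linorder_neqE_nat)
      then obtain q where q: "l = Suc q" "t' < Suc q" by (cases l) auto
      have "\<forall>r<Suc (Suc q). Y r \<in> {y. fst y \<in> (if r = t' \<or> r = Suc q then {k} else {..k})}"
        using Kl t' q that(1) kmax by (auto simp: K_def)
      then have "Y \<in> tie k" unfolding tie_def using q(2) by blast
      then show False using Y kk by (auto simp: k1_def)
    qed
    have Sk: "X t' \<in> S k"
    proof (rule ccontr)
      assume "X t' \<notin> S k"
      then have "\<forall>l<Suc t'. Y l \<in> (if l = t' then {y. fst y = k \<and> snd y \<in> - S k} else {y. fst y \<in> {..k}})"
        using t' kmax by (auto simp: K_def X_def)
      then have "Y \<in> bad_record S k" unfolding bad_record_def by blast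
      then show False using Y kk by (auto simp: k1_def)
    qed
    \<comment> \<open>No level up to time \<open>n\<close> exceeds \<open>k\<close>, so the failure
      to exclude is lateness of level \<open>k + 1\<close>, whose deadline is
      \<open>(k + 2)\<^sup>2\<close>.\<close>
    have len: "n < (k + 2)\<^sup>2"
    proof (rule ccontr)
      assume "\<not> n < (k + 2)\<^sup>2"
      then have "\<forall>l<(Suc k + 1)\<^sup>2. Y l \<in> {y. fst y \<in> {..<Suc k}}"
        using kmax by (auto simp: K_def less_Suc_eq_le)
      then have "Y \<in> late (Suc k)" by (simp add: late_def)
      then show False using Y kk by (auto simp: k1_def)
    qed
    have low: "X l \<in> (\<Union>j<k. set_pmf (\<nu> j))" if "l \<le> n" "l \<noteq> t'" for l
      using uniq[OF that] kmax[OF that(1)] Yc[of l] by (auto simp: K_def X_def)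
    have "segment G X 0 t' \<in> words G t' (\<Union>j<k. set_pmf (\<nu> j))"
      using low t' by (intro segment_words) auto
    then have m: "x \<otimes> segment G X 0 t' \<in> M k"
      using kk len t' by (intro a[of k t']) (auto simp: k1_def)
    have "segment G X (Suc t') (n - t') \<in> words G (n - t') (\<Union>j<k. set_pmf (\<nu> j))"
      using low t' by (intro segment_words) auto
    then have "\<one> \<otimes> segment G X (Suc t') (n - t') \<in> M k"
      using kk len t' by (intro b[of k "n - t'"]) (auto simp: k1_def)
    then have h: "segment G X (Suc t') (n - t') \<in> M k" using seg_cl by simp
    have "segment G X 0 (Suc n) = segment G X 0 (Suc t' + (n - t'))" using t' by simp
    also have "\<dots> = segment G X 0 t' \<otimes> X t' \<otimes> segment G X (Suc t') (n - t')"
      using segment_add[of X 0 "Suc t'" "n - t'", OF Xc] by simp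
    finally have "x \<otimes> rw_prod G X n = x \<otimes> segment G X 0 t' \<otimes> X t' \<otimes> segment G X (Suc t') (n - t')"
      using rw_prod_segment[of X n, OF Xc] seg_cl Xc x by (simp add: m_assoc)
    then have dec: "decoded k (x \<otimes> segment G X 0 t') (x \<otimes> rw_prod G X n)"
      unfolding decoded_def using m h Sk by blast
    show ?case
    proof (cases "K t = k")
      case True
      then have "t = t'" using uniq[OF less.prems(1)] by blast
      then show ?thesis using dec True by (auto intro: record_prefix.last)
    next
      case False
      have "t < t'"
      proof (rule ccontr)
        assume "\<not> t < t'"
        then have "t' < t" using False t' by (cases "t = t'") auto
        then have "k < K t" using less.prems(2) t' by auto
        then show False using kmax[OF less.prems(1)] by simp
      qed
      \<comment> \<open>The position at \<open>u = t' - 1\<close> is exactly the position decoded at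
        \<open>n\<close>, so the induction hypothesis for \<open>u\<close> continues the
        unwinding.\<close>
      then obtain u where u: "t' = Suc u" "t \<le> u" by (cases t') auto
      have "record_prefix (K t) (x \<otimes> segment G X 0 t) (x \<otimes> rw_prod G X u)"
        using less.prems u t' by (intro less.IH) auto
      moreover have "x \<otimes> rw_prod G X u = x \<otimes> segment G X 0 t'"
        using rw_prod_segment[of X u, OF Xc] u by simp
      ultimately show ?thesis using record_prefix.earlier[OF dec, of "K t"] False by auto
    qed
  qed
  then show ?thesis unfolding K_def X_def by blast
qed

text \<open>The first time of level at least \<open>k\<close> is a record, and it exists because the
  walk is not late for \<open>k\<close>.\<close>

lemma ex_late_record:
  assumes Y: "\<forall>k\<ge>k0. Y \<notin> tie k \<and> Y \<notin> bad_record S k \<and> Y \<notin> late k"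
  shows "\<exists>t. (\<forall>l<t. fst (Y l) < fst (Y t)) \<and> k1 \<le> fst (Y t)"
proof -
  define k where "k = k0 + k1"
  have "Y \<notin> late k" using Y by (auto simp: k_def)
  then obtain i where i: "k \<le> fst (Y i)" by (auto simp: late_def not_less)
  define t where "t = (LEAST i. k \<le> fst (Y i))"
  have "k \<le> fst (Y t)" using LeastI[of "\<lambda>i. k \<le> fst (Y i)", OF i] by (simp add: t_def)
  moreover have "fst (Y l) < k" if "l < t" for l
    using not_less_Least[of l "\<lambda>i. k \<le> fst (Y i)"] that by (auto simp: t_def)
  ultimately show ?thesis by (intro exI[of _ t]) (auto simp: k_def intro: less_le_trans)
qed

text \<open>Record times depend only on the levels and not on the start. So at a record that is late
  enough for both starts, the same increments decode to \<open>z\<close> from \<open>x\<close> and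
  to \<open>g z\<close> from \<open>g x\<close>: this is the eventual equivariance of the decoded
  positions.\<close>

lemma AE_common_prefix:
  assumes g: "g \<in> carrier G" and x: "x \<in> carrier G"
  shows "AE X in iid (map_pmf snd (levelled \<nu>)). \<exists>k z. z \<in> carrier G \<and>
    (\<lambda>n. x \<otimes> rw_prod G X n) \<in> has_prefix k z \<and> (\<lambda>n. g \<otimes> x \<otimes> rw_prod G X n) \<in> has_prefix k (g \<otimes> z)"
    (is "AE X in _. ?P X")
proof -
  let ?\<kappa> = "levelled \<nu>"
  have Pm: "{X \<in> space (iid (map_pmf snd ?\<kappa>)). ?P X} \<in> sets (iid (map_pmf snd ?\<kappa>))"
  proof -
    have s: "{X. (\<lambda>n. y \<otimes> rw_prod G X n) \<in> has_prefix k z} \<in> sets (iid (map_pmf snd ?\<kappa>))" for y k z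
      using measurable_sets[OF walk_measurable[where x = y and G = G and \<mu> = "map_pmf snd ?\<kappa>"] has_prefix_sets[of k z]]
      by (simp add: vimage_def)
    have "(\<Union>k. \<Union>z\<in>carrier G. {X. (\<lambda>n. x \<otimes> rw_prod G X n) \<in> has_prefix k z} \<inter>
        {X. (\<lambda>n. g \<otimes> x \<otimes> rw_prod G X n) \<in> has_prefix k (g \<otimes> z)}) \<in> sets (iid (map_pmf snd ?\<kappa>))"
      using s by (intro sets.countable_UN'' sets.Int) auto
    also have "(\<Union>k. \<Union>z\<in>carrier G. {X. (\<lambda>n. x \<otimes> rw_prod G X n) \<in> has_prefix k z} \<inter>
        {X. (\<lambda>n. g \<otimes> x \<otimes> rw_prod G X n) \<in> has_prefix k (g \<otimes> z)}) = {X \<in> space (iid (map_pmf snd ?\<kappa>)). ?P X}"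
      by auto
    finally show ?thesis .
  qed
  have fm: "(\<lambda>Y i. snd (Y i)) \<in> iid ?\<kappa> \<rightarrow>\<^sub>M iid (map_pmf snd ?\<kappa>)"
  proof (rule measurable_abs_UNIV)
    show "(\<lambda>Y. snd (Y n)) \<in> iid ?\<kappa> \<rightarrow>\<^sub>M measure_pmf (map_pmf snd ?\<kappa>)" for n
      by (rule measurable_compose[OF coordinate_measurable]) simp
  qed
  have "AE Y in iid ?\<kappa>. ?P (\<lambda>i. snd (Y i))"
    using AE_levelled[of \<nu> S, OF junk] AE_iid_carrier[of ?\<kappa>, OF order_refl]
  proof eventually_elim
    case (elim Y)
    then obtain k0 where Y: "\<forall>k\<ge>k0. Y \<notin> tie k \<and> Y \<notin> bad_record S k \<and> Y \<notin> late k" by blast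
    have Yc: "snd (Y i) \<in> set_pmf (\<nu> (fst (Y i)))" for i
      using elim(2) set_levelled[of "fst (Y i)" "snd (Y i)" \<nu>] by simp
    define X where "X i = snd (Y i)" for i
    have Xc: "X i \<in> carrier G" for i using Yc supp by (auto simp: X_def)
    obtain a where a: "\<And>n t. t \<le> n \<Longrightarrow> (\<forall>l<t. fst (Y l) < fst (Y t)) \<Longrightarrow> a \<le> fst (Y t) \<Longrightarrow>
        record_prefix (fst (Y t)) (x \<otimes> segment G X 0 t) (x \<otimes> rw_prod G X n)"
      using record_prefix_of_record[OF Y Yc x] unfolding X_def by blast
    obtain b where b: "\<And>n t. t \<le> n \<Longrightarrow> (\<forall>l<t. fst (Y l) < fst (Y t)) \<Longrightarrow> b \<le> fst (Y t) \<Longrightarrow>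
        record_prefix (fst (Y t)) (g \<otimes> x \<otimes> segment G X 0 t) (g \<otimes> x \<otimes> rw_prod G X n)"
      using record_prefix_of_record[OF Y Yc m_closed[OF g x]] unfolding X_def by blast
    obtain t where t: "\<forall>l<t. fst (Y l) < fst (Y t)" "a + b \<le> fst (Y t)"
      using ex_late_record[OF Y] by blast
    define z where "z = x \<otimes> segment G X 0 t"
    have "(\<lambda>n. x \<otimes> rw_prod G X n) \<in> has_prefix (fst (Y t)) z"
      unfolding has_prefix_def z_def using a[OF _ t(1)] t(2) by auto
    moreover have "(\<lambda>n. g \<otimes> x \<otimes> rw_prod G X n) \<in> has_prefix (fst (Y t)) (g \<otimes> z)"
    proof -
      have "g \<otimes> z = g \<otimes> x \<otimes> segment G X 0 t"
        using g x segment_closed[of X, OF Xc] by (simp add: z_def m_assoc)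
      then show ?thesis unfolding has_prefix_def using b[OF _ t(1)] t(2) by auto
    qed
    moreover have "z \<in> carrier G" using x segment_closed[of X, OF Xc] by (simp add: z_def)
    ultimately show ?case unfolding X_def by blast
  qed
  then have "AE X in distr (iid ?\<kappa>) (iid (map_pmf snd ?\<kappa>)) (\<lambda>Y i. snd (Y i)). ?P X"
    using AE_distr_iff[OF fm Pm] by blast
  then show ?thesis unfolding iid_map .
qed

lemma set_total: "set_pmf (map_pmf snd (levelled \<nu>)) \<subseteq> carrier G"
proof -
  have "snd y \<in> carrier G" if "y \<in> set_pmf (levelled \<nu>)" for y
    using that set_levelled[of "fst y" "snd y" \<nu>] supp by auto
  then show ?thesis by auto
qed

text \<open>Suppose \<open>g\<close> fixes all invariant subsets of \<open>E\<close> mod 0. Almost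
  every trajectory in \<open>E\<close> has some prefix \<open>z\<close> for which its translate by
  \<open>g^-1\<close> has the prefix \<open>g^-1 z\<close>, which differs from \<open>z\<close>. So
  the trajectory lies in the symmetric difference belonging to \<open>has_prefix k z\<close>, and
  countably many null sets cover \<open>E\<close>.\<close>

theorem boundary_ess_free: "pb_ess_free G (map_pmf snd (levelled \<nu>))"
  unfolding pb_ess_free_def
proof (intro ballI impI notI)
  let ?\<mu> = "map_pmf snd (levelled \<nu>)"
  fix g assume g: "g \<in> carrier G" "g \<noteq> \<one>"
  assume "\<exists>E\<in>shift_inv_sets. \<not> pb_null G ?\<mu> E \<and>
    (\<forall>A\<in>shift_inv_sets. pb_null G ?\<mu> (sdiff (traj_act G g (A \<inter> E)) (A \<inter> E)))"
  then obtain E where E: "E \<in> shift_inv_sets" "\<not> pb_null G ?\<mu> E"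
    and fix_E: "\<And>A. A \<in> shift_inv_sets \<Longrightarrow> pb_null G ?\<mu> (sdiff (traj_act G g (A \<inter> E)) (A \<inter> E))" by blast
  then obtain x where x: "x \<in> carrier G" "emeasure (path_meas G ?\<mu> x) E \<noteq> 0" by (auto simp: pb_null_def)
  have Es: "E \<in> sets traj_space" using E by (simp add: shift_inv_sets_def)
  define Z where "Z X = (\<lambda>n. x \<otimes> rw_prod G X n)" for X
  define D where "D k z = sdiff (traj_act G g (has_prefix k z \<inter> E)) (has_prefix k z \<inter> E)" for k z
  have Ds: "D k z \<in> sets traj_space" for k z
    unfolding D_def sdiff_def using Es has_prefix_sets traj_act_sets by blast
  have "AE X in iid ?\<mu>. Z X \<notin> D k z" for k z
  proof -
    have "emeasure (iid ?\<mu>) {X. Z X \<in> D k z} = 0"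
      using fix_E[OF has_prefix_inv, of k z] x emeasure_path_meas[OF Ds, of G ?\<mu> x k z]
      by (auto simp: pb_null_def D_def Z_def)
    moreover have "{X. Z X \<in> D k z} \<in> sets (iid ?\<mu>)"
      using measurable_sets[OF walk_measurable[where x = x and G = G and \<mu> = ?\<mu>] Ds[of k z]]
      by (simp add: vimage_def Z_def)
    ultimately show ?thesis by (intro AE_I[of _ _ "{X. Z X \<in> D k z}"]) auto
  qed
  then have "AE X in iid ?\<mu>. \<forall>k z. Z X \<notin> D k z" by (simp add: AE_all_countable)
  moreover have "AE X in iid ?\<mu>. \<exists>k z. z \<in> carrier G \<and>
    (\<lambda>n. x \<otimes> rw_prod G X n) \<in> has_prefix k z \<and> (\<lambda>n. inv g \<otimes> x \<otimes> rw_prod G X n) \<in> has_prefix k (inv g \<otimes> z)"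
    using g x by (intro AE_common_prefix) auto
  moreover have "AE X in iid ?\<mu>. \<forall>i. X i \<in> carrier G" by (rule AE_iid_carrier[OF set_total])
  ultimately have "AE X in iid ?\<mu>. Z X \<notin> E"
  proof eventually_elim
    case (elim X)
    obtain k z where z: "z \<in> carrier G" "Z X \<in> has_prefix k z"
      "(\<lambda>n. inv g \<otimes> x \<otimes> rw_prod G X n) \<in> has_prefix k (inv g \<otimes> z)"
      using elim(2) unfolding Z_def by blast
    have "rw_prod G X n \<in> carrier G" for n using elim(3) by (intro rw_prod_closed) auto
    then have eq: "(\<lambda>n. inv g \<otimes> Z X n) = (\<lambda>n. inv g \<otimes> x \<otimes> rw_prod G X n)"
      using g x by (simp add: Z_def m_assoc)
    have "inv g \<otimes> z \<noteq> z"
    proof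
      assume "inv g \<otimes> z = z"
      then have "inv g = \<one>" using g z(1) by (metis inv_closed one_closed l_one right_cancel)
      then show False using g by (metis inv_inv inv_one)
    qed
    then have "(\<lambda>n. inv g \<otimes> Z X n) \<notin> has_prefix k z"
      using has_prefix_disjoint z(3) unfolding eq by blast
    then have "Z X \<notin> traj_act G g (has_prefix k z \<inter> E)" by (simp add: traj_act_def)
    moreover have "Z X \<notin> D k z" using elim(1) by blast
    ultimately show ?case using z(2) unfolding D_def sdiff_def by blast
  qed
  moreover have "{X. Z X \<in> E} \<in> sets (iid ?\<mu>)"
    using measurable_sets[OF walk_measurable[where x = x and G = G and \<mu> = ?\<mu>] Es]
    by (simp add: vimage_def Z_def)
  ultimately have "emeasure (iid ?\<mu>) {X. Z X \<in> E} = 0"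
    by (simp add: AE_iff_measurable[OF _ refl])
  then show False using x(2) emeasure_path_meas[OF Es, of G ?\<mu> x] by (simp add: Z_def)
qed

end

text \<open>On a trivial boundary each invariant set is null or conull, and its translates are of
  the same kind, so a non-identity \<open>g\<close> would fix the whole space mod 0.\<close>

lemma ess_free_not_trivial:
  fixes G :: "('a::countable, 'm) monoid_scheme"
  assumes "group G" and supp: "set_pmf \<mu> \<subseteq> carrier G" and nt: "carrier G \<noteq> {\<one>\<^bsub>G\<^esub>}"
    and free: "pb_ess_free G \<mu>"
  shows "\<not> pb_trivial G \<mu>"
proof
  assume triv: "pb_trivial G \<mu>"
  interpret group G by fact
  obtain g where g: "g \<in> carrier G" "g \<noteq> \<one>\<^bsub>G\<^esub>" using nt one_closed by blast
  \<comment> \<open>Translating the event amounts to moving the start. The two events agree only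
    almost surely, because associativity requires the increments to lie in the carrier.\<close>
  have act: "emeasure (path_meas G \<mu> x) (traj_act G g A) = emeasure (path_meas G \<mu> (inv\<^bsub>G\<^esub> g \<otimes>\<^bsub>G\<^esub> x)) A"
    if A: "A \<in> sets traj_space" and x: "x \<in> carrier G" for A x
  proof -
    note acts = traj_act_sets[OF A, of G g]
    have "emeasure (iid \<mu>) {X. (\<lambda>n. x \<otimes>\<^bsub>G\<^esub> rw_prod G X n) \<in> traj_act G g A} =
        emeasure (iid \<mu>) {X. (\<lambda>n. inv\<^bsub>G\<^esub> g \<otimes>\<^bsub>G\<^esub> x \<otimes>\<^bsub>G\<^esub> rw_prod G X n) \<in> A}"
    proof (rule emeasure_eq_AE)
      show "AE X in iid \<mu>. (X \<in> {X. (\<lambda>n. x \<otimes>\<^bsub>G\<^esub> rw_prod G X n) \<in> traj_act G g A}) =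
          (X \<in> {X. (\<lambda>n. inv\<^bsub>G\<^esub> g \<otimes>\<^bsub>G\<^esub> x \<otimes>\<^bsub>G\<^esub> rw_prod G X n) \<in> A})"
        using AE_iid_carrier[OF supp]
      proof eventually_elim
        case (elim X)
        then have "rw_prod G X n \<in> carrier G" for n by (intro rw_prod_closed) auto
        then show ?case using g x by (simp add: traj_act_def m_assoc)
      qed
      show "{X. (\<lambda>n. x \<otimes>\<^bsub>G\<^esub> rw_prod G X n) \<in> traj_act G g A} \<in> sets (iid \<mu>)"
        using measurable_sets[OF walk_measurable[where x = x and G = G and \<mu> = \<mu>] acts] by (simp add: vimage_def)
      show "{X. (\<lambda>n. inv\<^bsub>G\<^esub> g \<otimes>\<^bsub>G\<^esub> x \<otimes>\<^bsub>G\<^esub> rw_prod G X n) \<in> A} \<in> sets (iid \<mu>)"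
        using measurable_sets[OF walk_measurable[where x = "inv\<^bsub>G\<^esub> g \<otimes>\<^bsub>G\<^esub> x" and G = G and \<mu> = \<mu>] A] by (simp add: vimage_def)
    qed
    then show "emeasure (path_meas G \<mu> x) (traj_act G g A) = emeasure (path_meas G \<mu> (inv\<^bsub>G\<^esub> g \<otimes>\<^bsub>G\<^esub> x)) A"
      using emeasure_path_meas[OF A, of G \<mu> "inv\<^bsub>G\<^esub> g \<otimes>\<^bsub>G\<^esub> x"] emeasure_path_meas[OF acts, of G \<mu> x] by simp
  qed
  have null_act: "pb_null G \<mu> (traj_act G g A)" if "A \<in> sets traj_space" "pb_null G \<mu> A" for A
    using that act g by (auto simp: pb_null_def)
  have null_mono: "pb_null G \<mu> B" if "pb_null G \<mu> A" "B \<subseteq> A" "A \<in> sets traj_space" for A B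
    unfolding pb_null_def
  proof
    fix x assume "x \<in> carrier G"
    then have "emeasure (path_meas G \<mu> x) A = 0" using that(1) by (simp add: pb_null_def)
    moreover have "emeasure (path_meas G \<mu> x) B \<le> emeasure (path_meas G \<mu> x) A"
      by (rule emeasure_mono[OF that(2)]) (simp add: path_meas_def that(3))
    ultimately show "emeasure (path_meas G \<mu> x) B = 0" by simp
  qed
  have null_Un: "pb_null G \<mu> (A \<union> B)" if "pb_null G \<mu> A" "pb_null G \<mu> B" "A \<in> sets traj_space" "B \<in> sets traj_space" for A B
  proof -
    have "emeasure (path_meas G \<mu> x) (A \<union> B) \<le> emeasure (path_meas G \<mu> x) A + emeasure (path_meas G \<mu> x) B" for x
      using that(3,4) by (intro emeasure_subadditive) (auto simp: path_meas_def)
    then show ?thesis using that(1,2) unfolding pb_null_def by (metis add_0 le_zero_eq)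
  qed
  have U: "UNIV \<in> shift_inv_sets" using sets.top[of traj_space] by (simp add: shift_inv_sets_def)
  have "\<not> pb_null G \<mu> UNIV"
  proof
    assume "pb_null G \<mu> UNIV"
    then have "emeasure (iid \<mu>) UNIV = 0"
      using emeasure_path_meas[of UNIV G \<mu> "\<one>\<^bsub>G\<^esub>"] U by (auto simp: pb_null_def shift_inv_sets_def)
    then show False using prob_space.emeasure_space_1[OF prob_space_iid[of \<mu>]] by simp
  qed
  moreover have "pb_null G \<mu> (sdiff (traj_act G g (A \<inter> UNIV)) (A \<inter> UNIV))" if "A \<in> shift_inv_sets" for A
  proof -
    have A: "A \<in> sets traj_space" using that by (simp add: shift_inv_sets_def)
    have cA: "UNIV - A \<in> sets traj_space" using sets.compl_sets[OF A] by simp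
    have s: "traj_act G g A \<in> sets traj_space" "traj_act G g (UNIV - A) \<in> sets traj_space"
      by (rule traj_act_sets[OF A], rule traj_act_sets[OF cA])
    from triv that consider "pb_null G \<mu> A" | "pb_null G \<mu> (UNIV - A)" by (auto simp: pb_trivial_def)
    then show ?thesis
    proof cases
      case 1
      then have "pb_null G \<mu> (traj_act G g A \<union> A)" using null_act[OF A] null_Un s A by blast
      then show ?thesis by (rule null_mono) (use s A in \<open>auto simp: sdiff_def\<close>)
    next
      case 2
      then have "pb_null G \<mu> (traj_act G g (UNIV - A) \<union> (UNIV - A))" using null_act[OF cA] null_Un s cA by blast
      then show ?thesis by (rule null_mono) (use s cA in \<open>auto simp: sdiff_def traj_act_def\<close>)
    qed
  qed
  ultimately show False using free g U unfolding pb_ess_free_def by blast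
qed


section \<open>Construction of the measure\<close>

text \<open>A harmonic function \<open>f\<close> of the projected walk is pulled back along
  \<open>\<pi>\<close> to \<open>G\<close>. In this way absorption is used in \<open>G\<close>,
  while almost invariance is required only after projection.\<close>

lemma (in group) pb_trivial_image:
  fixes H :: "('c::countable, 'n) monoid_scheme" and \<pi> :: "'a \<Rightarrow> 'c"
  assumes H: "group H" and \<pi>: "\<pi> \<in> hom G H" "\<pi> ` carrier G = carrier H"
    and supp: "\<And>k. set_pmf (\<nu> k) \<subseteq> carrier G"
    and near: "\<And>k. near_inv H (\<pi> ` M k) (e k) (map_pmf \<pi> (\<nu> k))"
    and e: "e \<longlonglongrightarrow> 0"
    and M: "\<And>k. M k \<subseteq> carrier G" "\<And>j k. j \<le> k \<Longrightarrow> M j \<subseteq> M k"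
    and absorb: "\<And>x. x \<in> carrier G \<Longrightarrow> \<exists>k0. \<forall>k\<ge>k0. \<forall>n\<le>(k + 2)\<^sup>2. \<forall>w\<in>words G n (\<Union>j<k. set_pmf (\<nu> j)). x \<otimes> w \<in> M k"
  shows "pb_trivial H (map_pmf \<pi> (map_pmf snd (levelled \<nu>)))"
proof (rule pb_trivial_of_harmonic_const[OF H])
  have lev: "snd y \<in> carrier G" if "y \<in> set_pmf (levelled \<nu>)" for y
    using that set_levelled[of "fst y" "snd y" \<nu>] supp by auto
  show "set_pmf (map_pmf \<pi> (map_pmf snd (levelled \<nu>))) \<subseteq> carrier H"
    using lev \<pi>(2) by auto
  fix f :: "'c \<Rightarrow> real" and x
  assume f: "\<And>x. 0 \<le> f x" "\<And>x. f x \<le> 1"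
    and harm: "\<And>x. x \<in> carrier H \<Longrightarrow> f x = measure_pmf.expectation (map_pmf \<pi> (map_pmf snd (levelled \<nu>))) (\<lambda>s. f (x \<otimes>\<^bsub>H\<^esub> s))"
    and x: "x \<in> carrier H"
  have b: "\<bar>f x\<bar> \<le> 1" for x using f[of x] by linarith
  have mult: "\<pi> (u \<otimes> v) = \<pi> u \<otimes>\<^bsub>H\<^esub> \<pi> v" if "u \<in> carrier G" "v \<in> carrier G" for u v
    using \<pi>(1) that by (simp add: hom_def)
  have cong: "measure_pmf.expectation (\<nu> k) (\<lambda>s. f (\<pi> (u \<otimes> s))) = measure_pmf.expectation (\<nu> k) (\<lambda>s. f (\<pi> u \<otimes>\<^bsub>H\<^esub> \<pi> s))"
    if "u \<in> carrier G" for u k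
    using that supp by (intro integral_cong_AE) (auto simp: AE_measure_pmf_iff mult subset_eq)
  have const: "f (\<pi> u) = f (\<pi> \<one>)" if u: "u \<in> carrier G" for u
  proof (rule harmonic_const[where f = "\<lambda>u. f (\<pi> u)" and \<nu> = \<nu> and p = level_pmf and M = M and e = e and N = "\<lambda>k. (k + 2)\<^sup>2"])
    show "f (\<pi> u) = measure_pmf.expectation level_pmf (\<lambda>k. measure_pmf.expectation (\<nu> k) (\<lambda>s. f (\<pi> (u \<otimes> s))))"
      if u: "u \<in> carrier G" for u
    proof -
      have "f (\<pi> u) = measure_pmf.expectation (levelled \<nu>) (\<lambda>y. f (\<pi> u \<otimes>\<^bsub>H\<^esub> \<pi> (snd y)))"
        using harm[of "\<pi> u"] u \<pi>(2) by (auto simp: image_iff)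
      also have "\<dots> = measure_pmf.expectation level_pmf (\<lambda>k. measure_pmf.expectation (\<nu> k) (\<lambda>s. f (\<pi> u \<otimes>\<^bsub>H\<^esub> \<pi> s)))"
        unfolding levelled_def by (subst pmf_expectation_bind_bounded[where B = 1, OF b]) simp
      finally show ?thesis by (simp add: cong[OF u])
    qed
    show "\<bar>measure_pmf.expectation (\<nu> k) (\<lambda>s. f (\<pi> (y \<otimes> s))) - measure_pmf.expectation (\<nu> k) (\<lambda>s. f (\<pi> s))\<bar> \<le> e k"
      if "y \<in> M k" for k y
      using near_invD[OF near[of k], of f "\<pi> y"] f that M(1)[of k] cong[of y k] by auto
  qed (use f supp e M absorb prob_level_decay u in auto)
  have "\<pi> \<one> = \<one>\<^bsub>H\<^esub>"
    using group_hom.hom_one[of G H \<pi>] H \<pi>(1) is_group by (simp add: group_hom_def group_hom_axioms_def)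
  then show "f x = f \<one>\<^bsub>H\<^esub>" using const x \<pi>(2) by (metis imageE)
qed

section \<open>Finite sets of words\<close>

context group
begin

lemma words_mono: "B \<subseteq> C \<Longrightarrow> words G n B \<subseteq> words G n C"
  by (induction n) auto

lemma words_mult:
  "B \<subseteq> carrier G \<Longrightarrow> v \<in> words G m B \<Longrightarrow> w \<in> words G n B \<Longrightarrow> v \<otimes> w \<in> words G (m + n) B"
proof (induction n arbitrary: w)
  case 0
  then show ?case using words_closed by (auto simp: subset_eq)
next
  case (Suc n)
  then obtain w' s where w: "w = w' \<otimes> s" "w' \<in> words G n B" "s \<in> B" by auto
  then have "v \<otimes> w = (v \<otimes> w') \<otimes> s"
    using Suc.prems words_closed[OF Suc.prems(1)] by (simp add: m_assoc subset_eq)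
  then show ?case using Suc.IH[OF Suc.prems(1,2) w(2)] w(3) by auto
qed

lemma words_one: "B \<subseteq> carrier G \<Longrightarrow> b \<in> B \<Longrightarrow> b \<in> words G 1 B"
  by (auto intro!: exI[of _ b] simp: subset_eq)

lemma words_le:
  assumes "B \<subseteq> carrier G" "\<one> \<in> B" "m \<le> n"
  shows "words G m B \<subseteq> words G n B"
  using assms(3)
proof (induction n rule: dec_induct)
  case (step n)
  have "w \<in> words G (Suc n) B" if "w \<in> words G n B" for w
  proof -
    have "w = w \<otimes> \<one>" using that words_closed[OF assms(1), of n] by (simp add: subset_eq)
    then show ?thesis unfolding words.simps using that assms(2) by blast
  qed
  then show ?case using step.IH by blast
qed simp

lemma finite_words: "finite B \<Longrightarrow> finite (words G n B)"
proof (induction n)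
  case (Suc n)
  have "words G (Suc n) B = (\<lambda>(w, s). w \<otimes> s) ` (words G n B \<times> B)" by auto
  then show ?case using Suc by (simp only: finite_imageI finite_cartesian_product)
qed simp

end

theorem theoremA:
  fixes G1 :: "('a::countable) monoid" and G2 :: "('b::countable) monoid"
  assumes "group G1" and "group G2"
    and "carrier G1 \<noteq> {\<one>\<^bsub>G1\<^esub>}" and "carrier G2 \<noteq> {\<one>\<^bsub>G2\<^esub>}"
    and "amenable G1" and "amenable G2"
    and "ICC G1" and "ICC G2"
  shows "\<exists>\<nu> :: ('a \<times> 'b) pmf.
           set_pmf \<nu> = carrier (G1 \<times>\<times> G2) \<and>
           (\<forall>g\<in>carrier (G1 \<times>\<times> G2). pmf \<nu> g = pmf \<nu> (inv\<^bsub>G1 \<times>\<times> G2\<^esub> g)) \<and>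
           \<not> pb_trivial (G1 \<times>\<times> G2) \<nu> \<and>
           pb_ess_free (G1 \<times>\<times> G2) \<nu> \<and>
           pb_trivial G1 (map_pmf fst \<nu>) \<and>
           pb_trivial G2 (map_pmf snd \<nu>)"
proof -
  let ?G = "G1 \<times>\<times> G2"
  interpret A: group G1 by fact
  interpret B: group G2 by fact
  interpret group ?G by (rule DirProd_group) fact+
  note ct = countable_subset[OF subset_UNIV countableI_type]
  have ne: "carrier ?G \<noteq> {}" using one_closed by blast
  define \<gamma> where "\<gamma> = from_nat_into (carrier ?G)"
  have \<gamma>c: "\<gamma> k \<in> carrier ?G" for k unfolding \<gamma>_def by (rule from_nat_into[OF ne])
  have \<gamma>s: "\<exists>i. x = \<gamma> i" if "x \<in> carrier ?G" for x
    using from_nat_into_surj[OF ct that] unfolding \<gamma>_def by metis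
  \<comment> \<open>Positive and at most one, below the bound \<open>1 / (k + 1)\<close> on junk,
    and tending to zero as the harmonic function argument demands.\<close>
  define q where "q k = 1 / (real k + 2)" for k
  define step where "step k M = (SOME p. step_ok G1 G2 M (\<gamma> k) (q k) (fst p) (snd p))" for k M
  have step: "step_ok G1 G2 M (\<gamma> k) (q k) (fst (step k M)) (snd (step k M))"
    if M: "finite M" "M \<subseteq> carrier ?G" for k M
  proof -
    have "\<exists>\<nu> S. step_ok G1 G2 M (\<gamma> k) (q k) \<nu> S"
      using assms M \<gamma>c by (intro ex_step_ok ct) (auto simp: q_def)
    then have "\<exists>p. step_ok G1 G2 M (\<gamma> k) (q k) (fst p) (snd p)" by auto
    then show ?thesis unfolding step_def by (rule someI_ex)
  qed
  define base where "base k M = insert \<one>\<^bsub>?G\<^esub> (insert (\<gamma> k) (M \<union> set_pmf (fst (step k M))))" for k M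
  \<comment> \<open>\<open>(k + 3)\<^sup>2\<close> is the number of steps that \<open>absorb\<close>
    allows at level \<open>k + 1\<close>. The margin \<open>3\<close> leaves room for the starting
    point as one more letter and guarantees the three letters of \<open>m s n\<close> in
    \<open>later\<close>. As \<open>base\<close> contains \<open>\<one>\<close>, shorter words are
    included.\<close>
  define M where "M = rec_nat {\<one>\<^bsub>?G\<^esub>} (\<lambda>k M. words ?G ((k + 3)\<^sup>2 + 3) (base k M))"
  have M0: "M 0 = {\<one>\<^bsub>?G\<^esub>}" and MS: "\<And>k. M (Suc k) = words ?G ((k + 3)\<^sup>2 + 3) (base k (M k))"
    by (simp_all add: M_def)
  have base: "finite (base k M) \<and> base k M \<subseteq> carrier ?G" if "finite M" "M \<subseteq> carrier ?G" for k M
    using step[OF that, of k] that \<gamma>c[of k] one_closed unfolding base_def step_ok_def by blast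
  have M: "finite (M k) \<and> M k \<subseteq> carrier ?G" for k
  proof (induction k)
    case (Suc k)
    then have b: "finite (base k (M k))" "base k (M k) \<subseteq> carrier ?G" using base[of "M k" k] by blast+
    show ?case unfolding MS using finite_words[OF b(1)] words_closed[OF b(2)] by blast
  qed (simp add: M0)
  define \<nu> where "\<nu> k = fst (step k (M k))" for k
  \<comment> \<open>Cut down to the support, so that the steps in \<open>S k\<close> are letters of
    \<open>B k\<close>; the probability under \<open>\<nu> k\<close> is unaffected.\<close>
  define S where "S k = snd (step k (M k)) \<inter> set_pmf (\<nu> k)" for k
  define B where "B k = base k (M k)" for k
  have ok: "step_ok G1 G2 (M k) (\<gamma> k) (q k) (\<nu> k) (snd (step k (M k)))" for k
    unfolding \<nu>_def using M by (intro step) auto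
  have Bc: "B k \<subseteq> carrier ?G" for k unfolding B_def using base M by blast
  have B: "\<one>\<^bsub>?G\<^esub> \<in> B k" "\<gamma> k \<in> B k" "M k \<subseteq> B k" "set_pmf (\<nu> k) \<subseteq> B k" for k
    by (auto simp: B_def base_def \<nu>_def)
  have MB: "words ?G n (B k) \<subseteq> M (Suc k)" if "n \<le> (k + 3)\<^sup>2 + 3" for n k
    unfolding MS B_def[symmetric] by (rule words_le[OF Bc B(1) that])
  have BM: "B k \<subseteq> M (Suc k)" for k
    using words_one[OF Bc] MB[of 1 k] by (auto simp del: words.simps)
  have Mmono: "M j \<subseteq> M k" if "j \<le> k" for j k
    using that by (induction k rule: dec_induct) (use B(3) BM in blast)+
  have supp: "set_pmf (\<nu> k) \<subseteq> carrier ?G" for k using ok[of k] by (simp add: step_ok_def)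
  have absorb: "\<exists>k0. \<forall>k\<ge>k0. \<forall>n\<le>(k + 2)\<^sup>2. \<forall>w\<in>words ?G n (\<Union>j<k. set_pmf (\<nu> j)). x \<otimes>\<^bsub>?G\<^esub> w \<in> M k"
    if x: "x \<in> carrier ?G" for x
  proof -
    \<comment> \<open>Being \<open>\<gamma> i\<close>, the start \<open>x\<close> lies in
      \<open>B i\<close> and so counts as a single letter from level \<open>i + 1\<close>
      on.\<close>
    obtain i where i: "x = \<gamma> i" using \<gamma>s[OF x] by blast
    have "x \<otimes>\<^bsub>?G\<^esub> w \<in> M k" if k: "Suc i \<le> k" and n: "n \<le> (k + 2)\<^sup>2" and w: "w \<in> words ?G n (\<Union>j<k. set_pmf (\<nu> j))" for k n w
    proof -
      obtain k' where k': "k = Suc k'" using k by (cases k) auto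
      have below: "B j \<subseteq> B k'" if "j \<le> k'" for j
      proof (cases "j = k'")
        case False
        then have "B j \<subseteq> M k'" using that BM[of j] Mmono[of "Suc j" k'] by auto
        then show ?thesis using B(3) by blast
      qed simp
      have "x \<in> words ?G 1 (B k')"
        using words_one[OF Bc, of x k'] below[of i] B(2)[of i] k k' i by auto
      moreover have "w \<in> words ?G n (B k')"
      proof -
        have "(\<Union>j<k. set_pmf (\<nu> j)) \<subseteq> B k'"
          using below B(4) k' by (fastforce simp: less_Suc_eq_le)
        then show ?thesis using w words_mono by blast
      qed
      ultimately have "x \<otimes>\<^bsub>?G\<^esub> w \<in> words ?G (1 + n) (B k')" by (rule words_mult[OF Bc])
      moreover have "words ?G (1 + n) (B k') \<subseteq> M (Suc k')"
        using n unfolding k' by (intro MB) (simp add: numeral_eq_Suc)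
      ultimately show ?thesis unfolding k' by blast
    qed
    then show ?thesis by blast
  qed
  interpret L: levelled_walk ?G \<nu> S M
  proof
    fix k
    show "set_pmf (\<nu> k) \<subseteq> carrier ?G" by (rule supp)
    have "measure_pmf.prob (\<nu> k) (- S k) = measure_pmf.prob (\<nu> k) (- snd (step k (M k)))"
      by (intro measure_pmf.finite_measure_eq_AE) (auto simp: S_def AE_measure_pmf_iff)
    also have "\<dots> \<le> q k" using ok[of k] by (simp add: step_ok_def)
    also have "\<dots> \<le> 1 / (real k + 1)" by (simp add: q_def frac_le)
    finally show "measure_pmf.prob (\<nu> k) (- S k) \<le> 1 / (real k + 1)" .
  next
    fix m n m' n' s s' k
    assume "m \<in> M k" "n \<in> M k" "m' \<in> M k" "n' \<in> M k" "s \<in> S k" "s' \<in> S k"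
      "m \<otimes>\<^bsub>?G\<^esub> s \<otimes>\<^bsub>?G\<^esub> n = m' \<otimes>\<^bsub>?G\<^esub> s' \<otimes>\<^bsub>?G\<^esub> n'"
    then show "m = m'" using ok[of k] unfolding step_ok_def S_def by blast
  next
    fix m n s k
    assume h: "m \<in> M k" "n \<in> M k" "s \<in> S k"
    then show "m \<otimes>\<^bsub>?G\<^esub> s \<otimes>\<^bsub>?G\<^esub> n \<notin> M k" using ok[of k] unfolding step_ok_def S_def by blast
    fix j assume j: "k < j"
    have "m \<in> words ?G 1 (B k)" "s \<in> words ?G 1 (B k)" "n \<in> words ?G 1 (B k)"
      by (rule words_one[OF Bc], use h B(3,4)[of k] S_def in blast)+
    then have "m \<otimes>\<^bsub>?G\<^esub> s \<otimes>\<^bsub>?G\<^esub> n \<in> words ?G (1 + 1 + 1) (B k)" by (intro words_mult[OF Bc])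
    then have "m \<otimes>\<^bsub>?G\<^esub> s \<otimes>\<^bsub>?G\<^esub> n \<in> M (Suc k)" by (rule subsetD[OF MB, rotated]) simp
    then show "m \<otimes>\<^bsub>?G\<^esub> s \<otimes>\<^bsub>?G\<^esub> n \<in> M j" using Mmono[of "Suc k" j] j by auto
  next
    show "\<exists>k0. \<forall>k\<ge>k0. \<forall>n\<le>(k + 2)\<^sup>2. \<forall>w\<in>words ?G n (\<Union>j<k. set_pmf (\<nu> j)). x \<otimes>\<^bsub>?G\<^esub> w \<in> M k"
      if "x \<in> carrier ?G" for x by (rule absorb[OF that])
  qed
  define \<mu> where "\<mu> = map_pmf snd (levelled \<nu>)"
  have set\<mu>: "set_pmf \<mu> = carrier ?G"
  proof
    show "set_pmf \<mu> \<subseteq> carrier ?G" unfolding \<mu>_def by (rule L.set_total)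
    show "carrier ?G \<subseteq> set_pmf \<mu>"
    proof
      fix x assume "x \<in> carrier ?G"
      then obtain i where "x = \<gamma> i" using \<gamma>s by blast
      then have "(i, x) \<in> set_pmf (levelled \<nu>)" using ok[of i] by (simp add: set_levelled step_ok_def)
      then show "x \<in> set_pmf \<mu>" unfolding \<mu>_def by force
    qed
  qed
  have inv\<mu>: "map_pmf (\<lambda>x. inv\<^bsub>?G\<^esub> x) \<mu> = \<mu>"
  proof -
    have "map_pmf (\<lambda>x. inv\<^bsub>?G\<^esub> x) (\<nu> k) = \<nu> k" for k using ok[of k] by (simp add: step_ok_def)
    then show ?thesis
      by (simp add: \<mu>_def levelled_def map_bind_pmf pmf.map_comp o_def)
  qed
  have sym: "pmf \<mu> g = pmf \<mu> (inv\<^bsub>?G\<^esub> g)" if g: "g \<in> carrier ?G" for g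
  proof -
    have "inj_on (\<lambda>x. inv\<^bsub>?G\<^esub> x) (set_pmf \<mu>)" unfolding set\<mu> by (rule inj_onI) (metis inv_inv)
    then have "pmf (map_pmf (\<lambda>x. inv\<^bsub>?G\<^esub> x) \<mu>) (inv\<^bsub>?G\<^esub> g) = pmf \<mu> g"
      by (rule pmf_map_inj) (use g set\<mu> in simp)
    then show ?thesis by (simp add: inv\<mu>)
  qed
  have q0: "(\<lambda>k. 2 * q k) \<longlonglongrightarrow> 0"
  proof -
    have "(\<lambda>k. 1 / (real (Suc k) + 1)) \<longlonglongrightarrow> 0" by (rule LIMSEQ_Suc[OF inverse_Suc_tendsto])
    then have "(\<lambda>k. 2 * (1 / (real (Suc k) + 1))) \<longlonglongrightarrow> 2 * 0" by (rule tendsto_mult_left)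
    then show ?thesis by (simp add: q_def add.commute)
  qed
  have free: "pb_ess_free ?G \<mu>" unfolding \<mu>_def by (rule L.boundary_ess_free)
  have nontriv: "\<not> pb_trivial ?G \<mu>"
  proof (rule ess_free_not_trivial[OF is_group _ _ free])
    obtain x where "x \<in> carrier G1" "x \<noteq> \<one>\<^bsub>G1\<^esub>" using assms(3) A.one_closed by blast
    then have "(x, \<one>\<^bsub>G2\<^esub>) \<in> carrier ?G" "(x, \<one>\<^bsub>G2\<^esub>) \<noteq> \<one>\<^bsub>?G\<^esub>" by auto
    then show "carrier ?G \<noteq> {\<one>\<^bsub>?G\<^esub>}" by blast
  qed (simp add: set\<mu>)
  have triv1: "pb_trivial G1 (map_pmf fst \<mu>)"
    unfolding \<mu>_def
  proof (rule pb_trivial_image[where M = M and e = "\<lambda>k. 2 * q k"])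
    show "fst \<in> hom ?G G1" by (auto simp: hom_def)
    show "fst ` carrier ?G = carrier G1" using B.one_closed by (auto simp: image_iff)
    show "near_inv G1 (fst ` M k) (2 * q k) (map_pmf fst (\<nu> k))" for k using ok[of k] by (simp add: step_ok_def)
  qed (use assms supp q0 M Mmono absorb in auto)
  have triv2: "pb_trivial G2 (map_pmf snd \<mu>)"
    unfolding \<mu>_def
  proof (rule pb_trivial_image[where M = M and e = "\<lambda>k. 2 * q k"])
    show "snd \<in> hom ?G G2" by (auto simp: hom_def)
    show "snd ` carrier ?G = carrier G2" using A.one_closed by (auto simp: image_iff)
    show "near_inv G2 (snd ` M k) (2 * q k) (map_pmf snd (\<nu> k))" for k using ok[of k] by (simp add: step_ok_def)
  qed (use assms supp q0 M Mmono absorb in auto)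
  show ?thesis using set\<mu> sym nontriv free triv1 triv2 by blast
qed

end
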